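(* Let $M$ be a smooth manifold of dimension $n$. The existence (locally on $M$) of a paraconformal structure $TM=\mathbb{S}\odot\mathbb{S}\odot\cdots\odot\mathbb{S}=S^{n-1}(\mathbb{S})$ is equivalent to the existence of a sub-bundle of $\mathbb{P}(TM)$ with rational normal curves as fibres.
   Context: A paraconformal structure on an $n$-manifold $M$ is a bundle isomorphism $TM\cong S^{n-1}(\mathbb{S})$, where $\mathbb{S}\to M$ is a real rank-two vector bundle and $S^{n-1}$ denotes the $(n-1)$-fold symmetric tensor product $\odot$. $\mathbb{P}(TM)$ is the projectivised tangent bundle. A rational normal curve in $\mathbb{P}(V)$, $\dim V=n$, is a curve which under some linear isomorphism $V\cong\mathbb{R}^n$ becomes the image of $\mathbb{RP}^1\to\mathbb{RP}^{n-1}$, $x\mapsto[1:x:\dots:x^{n-1}]$; equivalently, under some isomorphism of $V$ with the space of homogeneous polynomials of degree $n-1$ in two variables, it is the curve of $(n-1)$th powers of linear forms. All results are local on $M$. *)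

theory Defs
  imports "HOL-Analysis.Analysis" "HOL-Library.Function_Algebras"
begin

section \<open>Function spaces as real vector spaces\<close>

instantiation "fun" :: (type, real_vector) real_vector
begin

definition scaleR_fun :: "real \<Rightarrow> ('a \<Rightarrow> 'b) \<Rightarrow> 'a \<Rightarrow> 'b" where
  "scaleR_fun r f = (\<lambda>x. r *\<^sub>R f x)"

instance
  by standard (auto simp: scaleR_fun_def fun_eq_iff scaleR_add_right scaleR_add_left)

end

definition linear_iso_on ::
    "'a::real_vector set \<Rightarrow> 'b::real_vector set \<Rightarrow> ('a \<Rightarrow> 'b) \<Rightarrow> bool" where
  "linear_iso_on V V' f \<longleftrightarrow> bij_betw f V V'
     \<and> (\<forall>x\<in>V. \<forall>y\<in>V. f (x + y) = f x + f y)
     \<and> (\<forall>r. \<forall>x\<in>V. f (r *\<^sub>R x) = r *\<^sub>R f x)"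


section \<open>Smooth maps and manifolds\<close>

text \<open>
  Only used for open sets in finite-dimensional spaces, where continuity of all directional
  derivatives up to order \<open>k\<close> of a differentiable map is the usual \<open>C\<^sup>k\<close> condition.
\<close>

primrec Ck_on ::
    "nat \<Rightarrow> 'a::real_normed_vector set \<Rightarrow> ('a \<Rightarrow> 'b::real_normed_vector) \<Rightarrow> bool" where
  "Ck_on 0 S = (\<lambda>f. continuous_on S f)"
| "Ck_on (Suc k) S = (\<lambda>f. \<exists>f'. (\<forall>x\<in>S. (f has_derivative f' x) (at x))
                           \<and> (\<forall>v. Ck_on k S (\<lambda>x. f' x v)))"

definition smooth_on ::
    "'a::real_normed_vector set \<Rightarrow> ('a \<Rightarrow> 'b::real_normed_vector) \<Rightarrow> bool" where
  "smooth_on S f \<longleftrightarrow> (\<forall>k. Ck_on k S f)"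

text \<open>A chart is its domain together with its coordinate map.\<close>

type_synonym ('m, 'e) chart = "'m set \<times> ('m \<Rightarrow> 'e)"

definition smooth_manifold :: "'m topology \<Rightarrow> ('m, 'e::euclidean_space) chart set \<Rightarrow> bool" where
  "smooth_manifold X A \<longleftrightarrow>
     Hausdorff_space X \<and> second_countable X
     \<and> (\<forall>(U, \<phi>)\<in>A. openin X U \<and> open (\<phi> ` U)
           \<and> homeomorphic_map (subtopology X U) (top_of_set (\<phi> ` U)) \<phi>)
     \<and> \<Union> (fst ` A) = topspace X
     \<and> (\<forall>(U, \<phi>)\<in>A. \<forall>(V, \<psi>)\<in>A. smooth_on (\<phi> ` (U \<inter> V)) (\<psi> \<circ> inv_into U \<phi>))"

definition smooth_fun ::
    "('m, 'e::euclidean_space) chart set \<Rightarrow> 'm set \<Rightarrow> ('m \<Rightarrow> 'b::real_normed_vector) \<Rightarrow> bool" where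
  "smooth_fun A U f \<longleftrightarrow> (\<forall>(V, \<phi>)\<in>A. smooth_on (\<phi> ` (U \<inter> V)) (f \<circ> inv_into V \<phi>))"

definition smooth_fun2 ::
    "('m, 'e::euclidean_space) chart set \<Rightarrow> 'm set \<Rightarrow> 'z::real_normed_vector set
       \<Rightarrow> ('m \<Rightarrow> 'z \<Rightarrow> 'b::real_normed_vector) \<Rightarrow> bool" where
  "smooth_fun2 A U Z f \<longleftrightarrow>
     (\<forall>(V, \<phi>)\<in>A. smooth_on (\<phi> ` (U \<inter> V) \<times> Z) (\<lambda>(x, z). f (inv_into V \<phi> x) z))"


section \<open>The tangent bundle and its projectivisation\<close>

text \<open>
  A tangent vector at \<open>p\<close> is given by its coordinate vectors in all charts around \<open>p\<close>, related
  to each other by the derivatives of the coordinate changes; the value at every other argument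
  is fixed to be \<open>0\<close>, so that \<open>T\<^sub>pM\<close> is a linear subspace of a function space.
\<close>

type_synonym ('m, 'e) tangent = "('m, 'e) chart \<Rightarrow> 'e"

definition tangent_space ::
    "('m, 'e::euclidean_space) chart set \<Rightarrow> 'm \<Rightarrow> ('m, 'e) tangent set" where
  "tangent_space A p =
     {\<xi>. (\<forall>(U, \<phi>)\<in>A. \<forall>(V, \<psi>)\<in>A. p \<in> U \<inter> V \<longrightarrow>
             \<xi> (V, \<psi>) = frechet_derivative (\<psi> \<circ> inv_into U \<phi>) (at (\<phi> p)) (\<xi> (U, \<phi>)))
         \<and> (\<forall>c. c \<notin> A \<or> p \<notin> fst c \<longrightarrow> \<xi> c = 0)}"

text \<open>The tangent vector at \<open>p\<close> whose coordinate vector in the chart \<open>c\<close> is \<open>w\<close>.\<close>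

definition coord_vector ::
    "('m, 'e::euclidean_space) chart set \<Rightarrow> ('m, 'e) chart \<Rightarrow> 'm \<Rightarrow> 'e \<Rightarrow> ('m, 'e) tangent" where
  "coord_vector A c p w = (\<lambda>d. if d \<in> A \<and> p \<in> fst d
     then frechet_derivative (snd d \<circ> inv_into (fst c) (snd c)) (at (snd c p)) w else 0)"

definition projective_space :: "'a::real_vector set \<Rightarrow> 'a set set" where
  "projective_space V = {span {v} | v. v \<in> V \<and> v \<noteq> 0}"

abbreviation RP1 :: "(real^2) set set" where
  "RP1 \<equiv> projective_space UNIV"

definition projective_tangent_bundle ::
    "('m, 'e::euclidean_space) chart set \<Rightarrow> 'm set \<Rightarrow> ('m \<times> ('m, 'e) tangent set) set" where
  "projective_tangent_bundle A W = (SIGMA p:W. projective_space (tangent_space A p))"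


section \<open>Vector bundles, symmetric powers, paraconformal structures\<close>

text \<open>
  A real vector bundle over the open set \<open>W\<close> whose rank is the cardinality of the type \<open>'r\<close>.
  As a set, each fibre is identified with \<open>\<real>\<^sup>r\<close> by some linear isomorphism (which is no
  restriction, as these identifications need not depend continuously on the base point); the
  bundle structure is given by the local trivialisations \<open>(U, \<tau>)\<close>, where \<open>\<tau> p\<close> maps the fibre
  over \<open>p \<in> U\<close> to the model fibre.  In particular, the bundle need not be trivial.
\<close>

type_synonym ('m, 'r) vbundle = "('m set \<times> ('m \<Rightarrow> real^'r^'r)) set"

definition vector_bundle ::
    "'m topology \<Rightarrow> ('m, 'e::euclidean_space) chart set \<Rightarrow> 'm set \<Rightarrow> ('m, 'r::finite) vbundle \<Rightarrow> bool"
  where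
  "vector_bundle X A W S \<longleftrightarrow>
     (\<forall>(U, \<tau>)\<in>S. openin X U \<and> U \<subseteq> W \<and> (\<forall>p\<in>U. invertible (\<tau> p)))
     \<and> \<Union> (fst ` S) = W
     \<and> (\<forall>(U, \<tau>)\<in>S. \<forall>(V, \<sigma>)\<in>S. smooth_fun A (U \<inter> V) (\<lambda>p. \<sigma> p ** matrix_inv (\<tau> p)))"

text \<open>
  The \<open>k\<close>-fold symmetric tensor product of \<open>\<real>\<^sup>r\<close>: a symmetric tensor is the array of its
  components \<open>\<psi>\<^sup>A\<^sup>B\<^sup>\<dots>\<^sup>C\<close> with respect to the standard basis, indexed by the list \<open>[A, B, \<dots>, C]\<close>
  of length \<open>k\<close> and set to \<open>0\<close> for lists of any other length.
\<close>

definition sym_power :: "nat \<Rightarrow> ('r list \<Rightarrow> real) set" where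
  "sym_power k = {\<psi>. (\<forall>l. length l \<noteq> k \<longrightarrow> \<psi> l = 0)
                    \<and> (\<forall>l l'. mset l = mset l' \<longrightarrow> \<psi> l = \<psi> l')}"

text \<open>The power \<open>s \<odot> s \<odot> \<dots> \<odot> s\<close> with \<open>k\<close> factors.\<close>

definition tensor_power :: "nat \<Rightarrow> real^'r \<Rightarrow> 'r list \<Rightarrow> real" where
  "tensor_power k s = (\<lambda>l. if length l = k then \<Prod>i<k. s $ (l ! i) else 0)"

text \<open>The map induced on tensors by a linear map \<open>g\<close> of \<open>\<real>\<^sup>r\<close>, i.e. \<open>g \<otimes> \<dots> \<otimes> g\<close>.\<close>

definition tensor_map :: "real^'r^'r \<Rightarrow> ('r::finite list \<Rightarrow> real) \<Rightarrow> 'r list \<Rightarrow> real" where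
  "tensor_map g \<psi> =
     (\<lambda>l. \<Sum>m | length m = length l. (\<Prod>i<length l. g $ (l ! i) $ (m ! i)) * \<psi> m)"

text \<open>
  A paraconformal structure over \<open>W\<close>: a rank-two bundle \<open>S\<close> and an isomorphism
  \<open>\<Phi> : TM \<rightarrow> S\<^sup>n\<^sup>-\<^sup>1(S)\<close> of vector bundles over \<open>W\<close>.  A trivialisation \<open>\<tau>\<close> of \<open>S\<close> induces the
  trivialisation \<open>tensor_map \<circ> \<tau>\<close> of the symmetric power, and smoothness is expressed in these
  trivialisations and the coordinate trivialisations of \<open>TM\<close>.  Smoothness of the inverse is
  automatic for a fibrewise linear isomorphism.
\<close>

definition paraconformal_structure ::
    "'m topology \<Rightarrow> ('m, 'e::euclidean_space) chart set \<Rightarrow> 'm set \<Rightarrow> ('m, 2) vbundle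
       \<Rightarrow> ('m \<Rightarrow> ('m, 'e) tangent \<Rightarrow> 2 list \<Rightarrow> real) \<Rightarrow> bool" where
  "paraconformal_structure X A W S \<Phi> \<longleftrightarrow>
     openin X W \<and> vector_bundle X A W S
     \<and> (\<forall>p\<in>W. linear_iso_on (tangent_space A p) (sym_power (DIM('e) - 1)) (\<Phi> p))
     \<and> (\<forall>c\<in>A. \<forall>(U, \<tau>)\<in>S. \<forall>w l.
           smooth_fun A (U \<inter> fst c) (\<lambda>p. tensor_map (\<tau> p) (\<Phi> p (coord_vector A c p w)) l))"

text \<open>
  The curve in \<open>P(T\<^sub>pM)\<close> determined by a paraconformal structure: the directions corresponding to
  \<open>(n-1)\<close>-st powers of elements of the fibre of \<open>S\<close>.
\<close>

definition power_curve ::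
    "('m, 'e::euclidean_space) chart set \<Rightarrow> ('m \<Rightarrow> ('m, 'e) tangent \<Rightarrow> 2 list \<Rightarrow> real)
       \<Rightarrow> 'm \<Rightarrow> ('m, 'e) tangent set set" where
  "power_curve A \<Phi> p = {span {\<xi>} | \<xi> s. \<xi> \<in> tangent_space A p \<and> s \<noteq> 0
                                   \<and> \<Phi> p \<xi> = tensor_power (DIM('e) - 1) s}"


section \<open>Sub-bundles with rational normal curves as fibres\<close>

text \<open>
  The linear isomorphism between \<open>V\<close> and \<open>\<real>\<^sup>n\<close> is given as a basis \<open>b\<close> of \<open>V\<close>; the curve
  \<open>x \<mapsto> [1 : x : \<dots> : x\<^sup>n\<^sup>-\<^sup>1]\<close> is written in homogeneous coordinates \<open>x = z\<^sub>2 / z\<^sub>1\<close> so as to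
  include the point with parameter \<open>\<infinity>\<close>.
\<close>

definition rational_normal_curve :: "'a::real_vector set \<Rightarrow> 'a set set \<Rightarrow> bool" where
  "rational_normal_curve V K \<longleftrightarrow> (\<exists>b. let n = dim V in
     inj_on b {..<n} \<and> independent (b ` {..<n}) \<and> span (b ` {..<n}) = V
     \<and> K = {span {\<Sum>j<n. ((z $ 1) ^ (n - 1 - j) * (z $ 2) ^ j) *\<^sub>R b j} | z::real^2. z \<noteq> 0})"

text \<open>
  \<open>F\<close> represents a map \<open>U \<times> RP\<^sup>1 \<rightarrow> P(TM)\<close> over \<open>U\<close>.  It is a smooth immersion if it is locally
  \<open>F p [y] = [v p y]\<close> for a smooth nowhere vanishing \<open>v\<close> (with \<open>y\<close> ranging over homogeneous
  coordinates of points in \<open>RP\<^sup>1\<close>) such that \<open>F p\<close> has non-zero derivative in the direction of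
  \<open>RP\<^sup>1\<close>.  As the tangent space of \<open>P(V)\<close> at \<open>[v]\<close> is \<open>Hom([v], V/[v])\<close>, the last condition
  means that the derivative of \<open>v p\<close> in a direction not tangent to the line \<open>[y]\<close> is not in the
  line \<open>[v p y]\<close>.
\<close>

definition smooth_immersion_over ::
    "'m topology \<Rightarrow> ('m, 'e::euclidean_space) chart set \<Rightarrow> 'm set
       \<Rightarrow> ('m \<Rightarrow> (real^2) set \<Rightarrow> ('m, 'e) tangent set) \<Rightarrow> bool" where
  "smooth_immersion_over X A U F \<longleftrightarrow>
     (\<forall>q\<in>U. \<forall>z. z \<noteq> 0 \<longrightarrow> (\<exists>N Z v.
        openin X N \<and> q \<in> N \<and> N \<subseteq> U \<and> open Z \<and> z \<in> Z \<and> 0 \<notin> Z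
        \<and> (\<forall>c\<in>A. smooth_fun2 A (N \<inter> fst c) Z (\<lambda>p y. v p y c))
        \<and> (\<forall>p\<in>N. \<forall>y\<in>Z. v p y \<in> tangent_space A p \<and> v p y \<noteq> 0 \<and> F p (span {y}) = span {v p y}
             \<and> (\<forall>c\<in>A. p \<in> fst c \<longrightarrow> (\<forall>w. w \<notin> span {y} \<longrightarrow>
                   frechet_derivative (\<lambda>y. v p y c) (at y) w \<notin> span {v p y c})))))"

text \<open>
  A sub-bundle of \<open>P(TM)\<close> over \<open>W\<close> with typical fibre \<open>RP\<^sup>1\<close>: locally the image of an injective
  smooth immersion \<open>U \<times> RP\<^sup>1 \<rightarrow> P(TM)\<close> over \<open>U\<close>, which is an embedding because \<open>RP\<^sup>1\<close> is compact.
\<close>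

definition curve_subbundle ::
    "'m topology \<Rightarrow> ('m, 'e::euclidean_space) chart set \<Rightarrow> 'm set
       \<Rightarrow> ('m \<times> ('m, 'e) tangent set) set \<Rightarrow> bool" where
  "curve_subbundle X A W C \<longleftrightarrow>
     openin X W \<and> C \<subseteq> projective_tangent_bundle A W
     \<and> (\<forall>p\<in>W. \<exists>U F. openin X U \<and> p \<in> U \<and> U \<subseteq> W
           \<and> smooth_immersion_over X A U F \<and> (\<forall>q\<in>U. bij_betw (F q) RP1 (C `` {q})))"

definition rnc_subbundle ::
    "'m topology \<Rightarrow> ('m, 'e::euclidean_space) chart set \<Rightarrow> 'm set
       \<Rightarrow> ('m \<times> ('m, 'e) tangent set) set \<Rightarrow> bool" where
  "rnc_subbundle X A W C \<longleftrightarrow>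
     curve_subbundle X A W C \<and> (\<forall>p\<in>W. rational_normal_curve (tangent_space A p) (C `` {p}))"

end

theory Submission
  imports Defs
begin

text \<open>
  Let \<open>n\<close> be the dimension of \<open>M\<close>. Both structures of the theorem are, locally, the same thing as a
  smooth frame \<open>f\<^sub>0, \<dots>, f\<^sub>n\<^sub>-\<^sub>1\<close> of \<open>TM\<close>, where the frame stands for the field of curves
  \<open>z \<mapsto> [z\<^sub>1\<^sup>n\<^sup>-\<^sup>1 f\<^sub>0 + z\<^sub>1\<^sup>n\<^sup>-\<^sup>2 z\<^sub>2 f\<^sub>1 + \<dots> + z\<^sub>2\<^sup>n\<^sup>-\<^sup>1 f\<^sub>n\<^sub>-\<^sub>1]\<close>; see \<open>smooth_frame\<close>, \<open>moment_curve\<close> and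
  \<open>locally_framed\<close>. The proof goes from each structure to a frame and back.

  Over a trivialisation of the rank-two bundle \<open>\<sigma>\<close>, an isomorphism \<open>TM \<cong> S\<^sup>n\<^sup>-\<^sup>1(\<sigma>)\<close> pulls the monomial basis of
  \<open>S\<^sup>n\<^sup>-\<^sup>1(\<real>\<^sup>2)\<close> back to a frame. In the monomial basis the power \<open>z \<odot> \<dots> \<odot> z\<close> is the moment curve, so
  the curve of powers is the curve of the frame (\<open>paraconformal_imp_frame\<close>). Conversely, a frame defines
  such an isomorphism with \<open>\<sigma>\<close> trivial (\<open>frame_imp_paraconformal\<close>). In both directions smoothness comes
  from the fact that the dual of a smooth frame is smooth (\<open>smooth_dual_frame\<close>). A frame also
  parametrises its field of curves by an injective immersion (\<open>smooth_frame_immersion\<close>,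
  \<open>moment_image_bij\<close>).

  The substantial step is to find a frame for a given sub-bundle (\<open>rnc_subbundle_imp_frame\<close>). The sub-bundle
  comes with some smooth parametrisation of its fibres by \<open>\<real>P\<^sup>1\<close>, which need not be a
  projective parametrisation, and with a rational normal parametrisation of each single fibre, which
  need not depend smoothly on the base point. They are reconciled by Steiner's theorem that a
  rational normal curve in \<open>P\<^sup>n\<^sup>-\<^sup>1\<close> is determined by \<open>n + 2\<close> of its points, with an explicit formula
  (\<open>rational_normal_curve_interpolation\<close>). If the points are spanned by \<open>u\<^sub>0, \<dots>, u\<^sub>n\<^sub>+\<^sub>1\<close>, then the first \<open>n\<close> of
  these vectors form a basis, the coordinates \<open>a\<^sub>i\<close> of \<open>u\<^sub>n\<close> and \<open>c\<^sub>i\<close> of \<open>u\<^sub>n\<^sub>+\<^sub>1\<close> in it are non-zero, and the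
  curve is
  \<open>[x : y] \<mapsto> [\<Sum>\<^sub>i u\<^sub>i \<Prod>\<^sub>j\<^sub>\<noteq>\<^sub>i (x / a\<^sub>j + y / c\<^sub>j)]\<close>.
  Evaluating the given smooth parametrisation at \<open>n + 2\<close> fixed points of \<open>\<real>P\<^sup>1\<close> yields smooth vector
  fields \<open>u\<^sub>i\<close>, hence smooth functions \<open>a\<^sub>i\<close>, \<open>c\<^sub>i\<close>, and the coefficients of the polynomial above are the
  frame.
\<close>

section \<open>Calculus of smooth functions\<close>

lemma Ck_on_SucI:
  assumes "\<And>x. x \<in> S \<Longrightarrow> (f has_derivative f' x) (at x)" "\<And>v. Ck_on k S (\<lambda>x. f' x v)"
  shows "Ck_on (Suc k) S f"
  unfolding Ck_on.simps using assms by (intro exI[of _ f']) blast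

lemma Ck_on_SucE:
  assumes "Ck_on (Suc k) S f"
  obtains f' where "\<And>x. x \<in> S \<Longrightarrow> (f has_derivative f' x) (at x)" "\<And>v. Ck_on k S (\<lambda>x. f' x v)"
  using assms unfolding Ck_on.simps by blast

lemma Ck_on_cong:
  assumes "open S" "\<And>x. x \<in> S \<Longrightarrow> f x = g x" "Ck_on k S f"
  shows "Ck_on k S g"
proof (cases k)
  case 0
  then show ?thesis using assms(2,3) continuous_on_cong[of S S f g] by simp
next
  case (Suc m)
  from assms(3) obtain f' where f': "\<And>x. x \<in> S \<Longrightarrow> (f has_derivative f' x) (at x)"
    "\<And>v. Ck_on m S (\<lambda>x. f' x v)" unfolding Suc by (rule Ck_on_SucE) (rule that)
  show ?thesis unfolding Suc
    by (rule Ck_on_SucI[of S g f'], rule has_derivative_transform_within_open[OF f'(1) assms(1)])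
      (use assms(2) f'(2) in auto)
qed

lemma Ck_on_subset: "T \<subseteq> S \<Longrightarrow> Ck_on k S f \<Longrightarrow> Ck_on k T f"
proof (induction k arbitrary: f)
  case 0
  then show ?case by (auto intro: continuous_on_subset)
next
  case (Suc k)
  from Suc.prems(2) obtain f' where f': "\<And>x. x \<in> S \<Longrightarrow> (f has_derivative f' x) (at x)"
    "\<And>v. Ck_on k S (\<lambda>x. f' x v)" by (rule Ck_on_SucE) (rule that)
  show ?case
    by (rule Ck_on_SucI[of T f f']) (use f' Suc in auto)
qed

lemma Ck_on_SucD: "Ck_on (Suc k) S f \<Longrightarrow> Ck_on k S f"
proof (induction k arbitrary: f)
  case 0
  then obtain f' where f': "\<And>x. x \<in> S \<Longrightarrow> (f has_derivative f' x) (at x)"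
    by (rule Ck_on_SucE) (rule that)
  then show ?case
    by (auto intro!: continuous_at_imp_continuous_on has_derivative_continuous)
next
  case (Suc k)
  from Suc.prems obtain f' where f': "\<And>x. x \<in> S \<Longrightarrow> (f has_derivative f' x) (at x)"
    "\<And>v. Ck_on (Suc k) S (\<lambda>x. f' x v)" by (rule Ck_on_SucE) (rule that)
  show ?case
    by (rule Ck_on_SucI[of S f f', OF f'(1) Suc.IH[OF f'(2)]])
qed

lemma Ck_on_const: "Ck_on k S (\<lambda>_. c)"
proof (induction k arbitrary: c)
  case (Suc k)
  show ?case by (rule Ck_on_SucI[of S _ "\<lambda>_ _. 0"]) (use Suc in auto)
qed simp

lemma Ck_on_bounded_linear:
  assumes "bounded_linear h"
  shows "Ck_on k S h"
proof (cases k)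
  case 0
  then show ?thesis using assms by (simp add: linear_continuous_on)
next
  case (Suc m)
  show ?thesis unfolding Suc
    by (rule Ck_on_SucI[of S h "\<lambda>_. h"])
      (use bounded_linear_imp_has_derivative[OF assms] Ck_on_const in auto)
qed

lemma Ck_on_linear_compose:
  assumes h: "bounded_linear h"
  shows "Ck_on k S f \<Longrightarrow> Ck_on k S (\<lambda>x. h (f x))"
proof (induction k arbitrary: f)
  case 0
  then show ?case using h by (auto intro: bounded_linear.continuous_on)
next
  case (Suc k)
  from Suc.prems obtain f' where f': "\<And>x. x \<in> S \<Longrightarrow> (f has_derivative f' x) (at x)"
    "\<And>v. Ck_on k S (\<lambda>x. f' x v)" by (rule Ck_on_SucE) (rule that)
  show ?case
    by (rule Ck_on_SucI[of S _ "\<lambda>x v. h (f' x v)",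
          OF bounded_linear.has_derivative[OF h f'(1)] Suc.IH[OF f'(2)]])
qed

text \<open>
  Affine substitutions suffice for everything below: they cover the projections of \<open>U \<times> Z\<close> and the
  inclusions of its slices \<open>U \<times> {z}\<close>. Changes of charts never have to be composed with anything,
  because smoothness on the manifold is tested in each chart separately.
\<close>
lemma Ck_on_compose_affine:
  assumes L: "bounded_linear L" and sub: "\<And>x. x \<in> S \<Longrightarrow> L x + c \<in> T"
  shows "Ck_on k T f \<Longrightarrow> Ck_on k S (\<lambda>x. f (L x + c))"
proof (induction k arbitrary: f)
  case 0
  have "continuous_on S (\<lambda>x. L x + c)"
    using L by (intro continuous_intros linear_continuous_on)
  then show ?case
    using 0 sub by (auto intro: continuous_on_compose2[of T f S "\<lambda>x. L x + c"])
next
  case (Suc k)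
  from Suc.prems obtain f' where f': "\<And>x. x \<in> T \<Longrightarrow> (f has_derivative f' x) (at x)"
    "\<And>v. Ck_on k T (\<lambda>x. f' x v)" by (rule Ck_on_SucE) (rule that)
  have "((\<lambda>x. f (L x + c)) has_derivative (\<lambda>v. f' (L x + c) (L v))) (at x)" if "x \<in> S" for x
  proof -
    have "((\<lambda>x. L x + c) has_derivative L) (at x)"
      by (rule has_derivative_add_const[OF bounded_linear_imp_has_derivative[OF L]])
    from has_derivative_compose[OF this f'(1)[OF sub[OF that]]] show ?thesis .
  qed
  then show ?case
    by (rule Ck_on_SucI[of S _ "\<lambda>x v. f' (L x + c) (L v)"]) (assumption, rule Suc.IH[OF f'(2)])
qed

lemma Ck_on_add: "Ck_on k S f \<Longrightarrow> Ck_on k S g \<Longrightarrow> Ck_on k S (\<lambda>x. f x + g x)"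
proof (induction k arbitrary: f g)
  case 0
  then show ?case by (auto intro: continuous_on_add)
next
  case (Suc k)
  from Suc.prems(1) obtain f' where f': "\<And>x. x \<in> S \<Longrightarrow> (f has_derivative f' x) (at x)"
    "\<And>v. Ck_on k S (\<lambda>x. f' x v)" by (rule Ck_on_SucE) (rule that)
  from Suc.prems(2) obtain g' where g': "\<And>x. x \<in> S \<Longrightarrow> (g has_derivative g' x) (at x)"
    "\<And>v. Ck_on k S (\<lambda>x. g' x v)" by (rule Ck_on_SucE) (rule that)
  show ?case
    by (rule Ck_on_SucI[of S _ "\<lambda>x v. f' x v + g' x v",
          OF has_derivative_add[OF f'(1) g'(1)] Suc.IH[OF f'(2) g'(2)]])
qed

lemma Ck_on_bilinear:
  assumes h: "bounded_bilinear h"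
  shows "Ck_on k S f \<Longrightarrow> Ck_on k S g \<Longrightarrow> Ck_on k S (\<lambda>x. h (f x) (g x))"
proof (induction k arbitrary: f g)
  case 0
  then show ?case using h by (auto intro: bounded_bilinear.continuous_on)
next
  case (Suc k)
  from Suc.prems(1) obtain f' where f': "\<And>x. x \<in> S \<Longrightarrow> (f has_derivative f' x) (at x)"
    "\<And>v. Ck_on k S (\<lambda>x. f' x v)" by (rule Ck_on_SucE) (rule that)
  from Suc.prems(2) obtain g' where g': "\<And>x. x \<in> S \<Longrightarrow> (g has_derivative g' x) (at x)"
    "\<And>v. Ck_on k S (\<lambda>x. g' x v)" by (rule Ck_on_SucE) (rule that)
  note fg = Suc.prems[THEN Ck_on_SucD]
  show ?case
    by (rule Ck_on_SucI[of S _ "\<lambda>x v. h (f x) (g' x v) + h (f' x v) (g x)",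
          OF bounded_bilinear.FDERIV[OF h f'(1) g'(1)]
             Ck_on_add[OF Suc.IH[OF fg(1) g'(2)] Suc.IH[OF f'(2) fg(2)]]])
qed

lemma Ck_on_inverse:
  fixes f :: "'a::real_normed_vector \<Rightarrow> real"
  assumes nz: "\<And>x. x \<in> S \<Longrightarrow> f x \<noteq> 0"
  shows "Ck_on k S f \<Longrightarrow> Ck_on k S (\<lambda>x. inverse (f x))"
proof (induction k)
  case 0
  then show ?case using nz by (auto intro: continuous_on_inverse)
next
  case (Suc k)
  from Suc.prems obtain f' where f': "\<And>x. x \<in> S \<Longrightarrow> (f has_derivative f' x) (at x)"
    "\<And>v. Ck_on k S (\<lambda>x. f' x v)" by (rule Ck_on_SucE) (rule that)
  have inv: "Ck_on k S (\<lambda>x. inverse (f x))"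
    by (rule Suc.IH[OF Ck_on_SucD[OF Suc.prems]])
  have "Ck_on k S (\<lambda>x. - (inverse (f x) * f' x v * inverse (f x)))" for v
    by (intro Ck_on_linear_compose[OF bounded_linear_minus[OF bounded_linear_ident]]
        Ck_on_bilinear[OF bounded_bilinear_mult] inv f'(2))
  moreover have "((\<lambda>x. inverse (f x)) has_derivative
      (\<lambda>v. - (inverse (f x) * f' x v * inverse (f x)))) (at x)" if "x \<in> S" for x
    by (rule Deriv.has_derivative_inverse) (use nz f'(1) that in auto)
  ultimately show ?case
    by (rule Ck_on_SucI[of S _ "\<lambda>x v. - (inverse (f x) * f' x v * inverse (f x))", rotated])
qed

lemma smooth_on_cong:
  "open S \<Longrightarrow> (\<And>x. x \<in> S \<Longrightarrow> f x = g x) \<Longrightarrow> smooth_on S f \<Longrightarrow> smooth_on S g"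
  unfolding smooth_on_def using Ck_on_cong[of S f g] by blast

lemma smooth_on_subset: "smooth_on S f \<Longrightarrow> T \<subseteq> S \<Longrightarrow> smooth_on T f"
  unfolding smooth_on_def using Ck_on_subset by blast

lemma smooth_on_const: "smooth_on S (\<lambda>_. c)"
  unfolding smooth_on_def using Ck_on_const by blast

lemma smooth_on_bounded_linear: "bounded_linear h \<Longrightarrow> smooth_on S h"
  unfolding smooth_on_def using Ck_on_bounded_linear by blast

lemma smooth_on_linear_compose: "bounded_linear h \<Longrightarrow> smooth_on S f \<Longrightarrow> smooth_on S (\<lambda>x. h (f x))"
  unfolding smooth_on_def using Ck_on_linear_compose by blast

lemma smooth_on_compose_affine:
  "smooth_on T f \<Longrightarrow> bounded_linear L \<Longrightarrow> (\<And>x. x \<in> S \<Longrightarrow> L x + c \<in> T)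
    \<Longrightarrow> smooth_on S (\<lambda>x. f (L x + c))"
  unfolding smooth_on_def using Ck_on_compose_affine[of L S c T] by blast

lemma smooth_on_add: "smooth_on S f \<Longrightarrow> smooth_on S g \<Longrightarrow> smooth_on S (\<lambda>x. f x + g x)"
  unfolding smooth_on_def using Ck_on_add by blast

lemma smooth_on_mult:
  fixes f g :: "'a::real_normed_vector \<Rightarrow> real"
  shows "smooth_on S f \<Longrightarrow> smooth_on S g \<Longrightarrow> smooth_on S (\<lambda>x. f x * g x)"
  unfolding smooth_on_def using Ck_on_bilinear[OF bounded_bilinear_mult] by blast

lemma smooth_on_scaleR: "smooth_on S f \<Longrightarrow> smooth_on S g \<Longrightarrow> smooth_on S (\<lambda>x. f x *\<^sub>R g x)"
  unfolding smooth_on_def using Ck_on_bilinear[OF bounded_bilinear_scaleR] by blast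

lemma smooth_on_inner: "smooth_on S f \<Longrightarrow> smooth_on S g \<Longrightarrow> smooth_on S (\<lambda>x. f x \<bullet> g x)"
  unfolding smooth_on_def using Ck_on_bilinear[OF bounded_bilinear_inner] by blast

lemma smooth_on_inverse:
  fixes f :: "'a::real_normed_vector \<Rightarrow> real"
  shows "(\<And>x. x \<in> S \<Longrightarrow> f x \<noteq> 0) \<Longrightarrow> smooth_on S f \<Longrightarrow> smooth_on S (\<lambda>x. inverse (f x))"
  unfolding smooth_on_def using Ck_on_inverse[of S f] by blast

lemma smooth_on_diff: "smooth_on S f \<Longrightarrow> smooth_on S g \<Longrightarrow> smooth_on S (\<lambda>x. f x - g x)"
  using smooth_on_add[of S f "\<lambda>x. - g x"]
    smooth_on_linear_compose[OF bounded_linear_minus[OF bounded_linear_ident], of S g] by simp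

lemma smooth_on_sum: "(\<And>i. i \<in> I \<Longrightarrow> smooth_on S (f i)) \<Longrightarrow> smooth_on S (\<lambda>x. \<Sum>i\<in>I. f i x)"
  by (induction I rule: infinite_finite_induct) (auto intro: smooth_on_const smooth_on_add)

lemma smooth_on_prod:
  fixes f :: "'i \<Rightarrow> 'a::real_normed_vector \<Rightarrow> real"
  shows "(\<And>i. i \<in> I \<Longrightarrow> smooth_on S (f i)) \<Longrightarrow> smooth_on S (\<lambda>x. \<Prod>i\<in>I. f i x)"
  by (induction I rule: infinite_finite_induct) (auto intro: smooth_on_const smooth_on_mult)

lemma smooth_on_power:
  fixes f :: "'a::real_normed_vector \<Rightarrow> real"
  shows "smooth_on S f \<Longrightarrow> smooth_on S (\<lambda>x. f x ^ k)"
  by (induction k) (auto intro: smooth_on_const smooth_on_mult)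

lemma smooth_on_compose_fst: "smooth_on S f \<Longrightarrow> smooth_on (S \<times> T) (\<lambda>x. f (fst x))"
  using smooth_on_compose_affine[of S f fst "S \<times> T" 0] bounded_linear_fst by auto

lemma smooth_on_compose_snd: "smooth_on T f \<Longrightarrow> smooth_on (S \<times> T) (\<lambda>x. f (snd x))"
  using smooth_on_compose_affine[of T f snd "S \<times> T" 0] bounded_linear_snd by auto

lemma smooth_on_slice:
  assumes "smooth_on (S \<times> T) f" "y \<in> T"
  shows "smooth_on S (\<lambda>x. f (x, y))"
proof -
  have "bounded_linear (\<lambda>x::'a. (x, 0::'b))"
    by (intro bounded_linear_Pair bounded_linear_ident bounded_linear_zero)
  from smooth_on_compose_affine[OF assms(1) this, of S "(0, y)"] assms(2)
  show ?thesis by simp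
qed

lemma smooth_on_imp_differentiable: "smooth_on S f \<Longrightarrow> x \<in> S \<Longrightarrow> f differentiable (at x)"
  unfolding smooth_on_def differentiable_def
  by (drule spec[of _ "Suc 0"]) auto

section \<open>Dual frames\<close>

text \<open>
  Gram-Schmidt, without normalisation: orthogonal projection to the complement of the span of a
  smooth family of independent vectors is given by a rational formula with non-zero denominators.
\<close>
lemma smooth_orthogonal_component:
  fixes r :: "'i \<Rightarrow> 'a::real_normed_vector \<Rightarrow> 'e::euclidean_space"
  assumes "finite I" "open S" "\<And>i. i \<in> I \<Longrightarrow> smooth_on S (r i)" "smooth_on S h"
    and "\<And>x. x \<in> S \<Longrightarrow> inj_on (\<lambda>i. r i x) I \<and> independent ((\<lambda>i. r i x) ` I)"
  shows "\<exists>g. smooth_on S g \<and> (\<forall>x\<in>S. (\<forall>i\<in>I. g x \<bullet> r i x = 0) \<and> h x - g x \<in> span ((\<lambda>i. r i x) ` I))"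
  using assms(1,3,4,5)
proof (induction I arbitrary: h rule: finite_induct)
  case empty
  then show ?case by (auto intro!: exI[of _ h])
next
  case (insert j J)
  have ind: "inj_on (\<lambda>i. r i x) J \<and> independent ((\<lambda>i. r i x) ` J)"
    and notin: "r j x \<notin> span ((\<lambda>i. r i x) ` J)" if "x \<in> S" for x
  proof -
    have inj: "inj_on (\<lambda>i. r i x) (insert j J)" and ind: "independent ((\<lambda>i. r i x) ` insert j J)"
      using insert.prems(3)[OF that] by blast+
    have "r j x \<notin> (\<lambda>i. r i x) ` J"
      using inj insert.hyps(2) by simp
    then have "independent ((\<lambda>i. r i x) ` J) \<and> r j x \<notin> span ((\<lambda>i. r i x) ` J)"
      using ind by (simp add: independent_insert)
    then show "inj_on (\<lambda>i. r i x) J \<and> independent ((\<lambda>i. r i x) ` J)" "r j x \<notin> span ((\<lambda>i. r i x) ` J)"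
      using inj by simp_all
  qed
  have "\<exists>g. smooth_on S g \<and> (\<forall>x\<in>S. (\<forall>i\<in>J. g x \<bullet> r i x = 0) \<and> h x - g x \<in> span ((\<lambda>i. r i x) ` J))"
    if "smooth_on S h" for h
    by (rule insert.IH[OF insert.prems(1) that ind]) simp_all
  note IH = this
  from IH[OF insert.prems(1)[OF insertI1]] obtain gj where "smooth_on S gj \<and>
    (\<forall>x\<in>S. (\<forall>i\<in>J. gj x \<bullet> r i x = 0) \<and> r j x - gj x \<in> span ((\<lambda>i. r i x) ` J))" ..
  note gj = conjunct1[OF this] bspec[OF conjunct2[OF this]]
  from IH[OF insert.prems(2)] obtain gh where "smooth_on S gh \<and>
    (\<forall>x\<in>S. (\<forall>i\<in>J. gh x \<bullet> r i x = 0) \<and> h x - gh x \<in> span ((\<lambda>i. r i x) ` J))" ..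
  note gh = conjunct1[OF this] bspec[OF conjunct2[OF this]]
  have nz: "gj x \<noteq> 0" if "x \<in> S" for x
    using gj(2)[OF that] notin[OF that] by auto
  \<comment> \<open>The part of \<open>r j\<close> orthogonal to the earlier vectors is non-zero by independence, and
    subtracting its multiple \<open>t\<close> makes \<open>gh\<close> orthogonal to \<open>r j\<close> as well.\<close>
  define t where "t x = (gh x \<bullet> gj x) * inverse (gj x \<bullet> gj x)" for x
  have "smooth_on S (\<lambda>x. gh x - t x *\<^sub>R gj x)"
    unfolding t_def
    by (intro smooth_on_diff smooth_on_scaleR smooth_on_mult smooth_on_inner smooth_on_inverse gj gh)
      (use nz in auto)
  moreover have "(gh x - t x *\<^sub>R gj x) \<bullet> r i x = 0" if "x \<in> S" "i \<in> insert j J" for x i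
  proof (cases "i = j")
    case True
    let ?d = "r j x - gj x"
    have "orthogonal y ?d" if "\<forall>i\<in>J. y \<bullet> r i x = 0" for y
      using orthogonal_to_span[OF conjunct2[OF gj(2)[OF \<open>x \<in> S\<close>]], of y] that
      by (auto simp: orthogonal_def)
    then have "orthogonal (gj x) ?d" "orthogonal (gh x) ?d"
      using gj(2)[OF that(1)] gh(2)[OF that(1)] by blast+
    then have "gj x \<bullet> r j x = gj x \<bullet> gj x" "gh x \<bullet> r j x = gh x \<bullet> gj x"
      by (auto simp: orthogonal_def inner_diff_right)
    then show ?thesis using nz[OF that(1)] True by (simp add: t_def inner_diff_left)
  next
    case False
    then show ?thesis using that gj(2)[OF that(1)] gh(2)[OF that(1)] by (simp add: inner_diff_left)
  qed
  moreover have "h x - (gh x - t x *\<^sub>R gj x) \<in> span ((\<lambda>i. r i x) ` insert j J)" if "x \<in> S" for x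
  proof -
    have sub: "span ((\<lambda>i. r i x) ` J) \<subseteq> span ((\<lambda>i. r i x) ` insert j J)"
      by (intro span_mono) auto
    have "gj x = r j x - (r j x - gj x)" by simp
    also have "\<dots> \<in> span ((\<lambda>i. r i x) ` insert j J)"
      by (rule span_diff) (use sub gj(2)[OF that] in \<open>auto intro: span_base\<close>)
    finally have "(h x - gh x) + t x *\<^sub>R gj x \<in> span ((\<lambda>i. r i x) ` insert j J)"
      using sub gh(2)[OF that] by (intro span_add span_scale) auto
    then show ?thesis by (simp add: algebra_simps)
  qed
  ultimately show ?case by blast
qed

text \<open>
  Orthogonality to all \<open>r i\<close> with \<open>i \<noteq> j\<close> determines \<open>f j\<close> up to scale, and the component of \<open>r j\<close>
  orthogonal to them is such a vector. This takes the place of the smoothness of matrix inversion.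
\<close>
lemma smooth_dual_frame:
  fixes r f :: "'i \<Rightarrow> 'a::real_normed_vector \<Rightarrow> 'e::euclidean_space"
  assumes "open S" "finite I" "card I = DIM('e)"
    and r: "\<And>i. i \<in> I \<Longrightarrow> smooth_on S (r i)"
    and dual: "\<And>x i j. x \<in> S \<Longrightarrow> i \<in> I \<Longrightarrow> j \<in> I \<Longrightarrow> r i x \<bullet> f j x = (if i = j then 1 else 0)"
    and "j \<in> I"
  shows "smooth_on S (f j)"
proof -
  have inj: "inj_on (\<lambda>i. r i x) I" if "x \<in> S" for x
    using dual[OF that] by (intro inj_onI) (metis zero_neq_one)
  have notin: "r i x \<notin> span ((\<lambda>i. r i x) ` (I - {i}))" if "x \<in> S" "i \<in> I" for x i
  proof
    assume "r i x \<in> span ((\<lambda>i. r i x) ` (I - {i}))"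
    then have "orthogonal (f i x) (r i x)"
      by (rule orthogonal_to_span[where S = "(\<lambda>i. r i x) ` (I - {i})"])
        (use dual[OF that(1)] that in \<open>auto simp: orthogonal_def inner_commute split: if_splits\<close>)
    then show False using dual[OF that(1,2,2)] by (simp add: orthogonal_def inner_commute)
  qed
  have ind: "independent ((\<lambda>i. r i x) ` I)" if "x \<in> S" for x
    unfolding dependent_def
  proof safe
    fix i assume i: "i \<in> I" "r i x \<in> span ((\<lambda>i. r i x) ` I - {r i x})"
    have "(\<lambda>i. r i x) ` I - {r i x} = (\<lambda>i. r i x) ` (I - {i})"
      using inj[OF that] i(1) by (auto simp: inj_on_def)
    then show False using notin[OF that i(1)] i(2) by simp
  qed
  have span: "span ((\<lambda>i. r i x) ` I) = UNIV" if "x \<in> S" for x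
    using dim_eq_full[of "(\<lambda>i. r i x) ` I"] dim_eq_card_independent[OF ind[OF that]]
      card_image[OF inj[OF that]] assms(3) by simp
  obtain g where g: "smooth_on S g"
    "\<And>x. x \<in> S \<Longrightarrow> (\<forall>i\<in>I - {j}. g x \<bullet> r i x = 0) \<and> r j x - g x \<in> span ((\<lambda>i. r i x) ` (I - {j}))"
  proof -
    have "inj_on (\<lambda>i. r i x) (I - {j}) \<and> independent ((\<lambda>i. r i x) ` (I - {j}))" if "x \<in> S" for x
      using inj_on_subset[OF inj[OF that]] independent_mono[OF ind[OF that]] by (meson Diff_subset image_mono)
    then show thesis
      using smooth_orthogonal_component[of "I - {j}" S r "r j"] assms(1,2) r \<open>j \<in> I\<close> that by auto
  qed
  have nz: "g x \<noteq> 0" if "x \<in> S" for x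
    using g(2)[OF that] notin[OF that \<open>j \<in> I\<close>] by auto
  have "inverse (g x \<bullet> g x) *\<^sub>R g x = f j x" if "x \<in> S" for x
  proof -
    have "orthogonal (g x) (r j x - g x)"
      by (rule orthogonal_to_span[where S = "(\<lambda>i. r i x) ` (I - {j})"])
        (use g(2)[OF that] in \<open>auto simp: orthogonal_def\<close>)
    then have "g x \<bullet> r j x = g x \<bullet> g x" by (simp add: orthogonal_def inner_diff_right)
    then have "(inverse (g x \<bullet> g x) *\<^sub>R g x - f j x) \<bullet> r i x = 0" if "i \<in> I" for i
      using that g(2)[OF \<open>x \<in> S\<close>] nz[OF \<open>x \<in> S\<close>] dual[OF \<open>x \<in> S\<close> that \<open>j \<in> I\<close>]
      by (cases "i = j") (auto simp: inner_diff_left inner_commute[of "f j x"])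
    then have "orthogonal (inverse (g x \<bullet> g x) *\<^sub>R g x - f j x) y"
      if "y \<in> span ((\<lambda>i. r i x) ` I)" for y
      by (intro orthogonal_to_span[OF that]) (auto simp: orthogonal_def)
    then have "orthogonal (inverse (g x \<bullet> g x) *\<^sub>R g x - f j x) (inverse (g x \<bullet> g x) *\<^sub>R g x - f j x)"
      by (simp add: span[OF that])
    then show ?thesis by (simp add: orthogonal_self)
  qed
  moreover have "smooth_on S (\<lambda>x. inverse (g x \<bullet> g x) *\<^sub>R g x)"
    by (intro smooth_on_scaleR smooth_on_inner smooth_on_inverse g) (use nz in auto)
  ultimately show ?thesis
    by (intro smooth_on_cong[OF assms(1), of "\<lambda>x. inverse (g x \<bullet> g x) *\<^sub>R g x" "f j"])
qed

section \<open>Bases and spans\<close>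

text \<open>
  Linear functionals that detect exactly one member of a family each. For points on a moment
  curve such functionals are products of linear forms.
\<close>
lemma independent_if_dual:
  fixes u :: "'i \<Rightarrow> 'a::real_vector" and g :: "'i \<Rightarrow> 'a \<Rightarrow> real"
  assumes lin: "\<And>i. i \<in> I \<Longrightarrow> linear (g i)"
    and dual: "\<And>i j. i \<in> I \<Longrightarrow> j \<in> I \<Longrightarrow> g i (u j) \<noteq> 0 \<longleftrightarrow> i = j"
  shows "inj_on u I \<and> independent (u ` I)"
proof
  show "inj_on u I"
    using dual by (intro inj_onI) metis
  show "independent (u ` I)"
    unfolding dependent_def
  proof safe
    fix i assume i: "i \<in> I" "u i \<in> span (u ` I - {u i})"
    have "g i x = 0" if "x \<in> u ` I - {u i}" for x
      using that dual i(1) by blast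
    then have "g i (u i) = 0"
      using linear_eq_0_on_span[OF lin[OF i(1)] _ i(2)] by blast
    then show False using dual i(1) by blast
  qed
qed

lemma span_eq_if_independent_card:
  assumes "finite B" "independent A" "A \<subseteq> span B" "card B \<le> card A"
  shows "span A = span B"
proof
  show "span A \<subseteq> span B" using assms(3) by (rule span_minimal) simp
  have fin: "finite A" using independent_span_bound[OF assms(1-3)] by blast
  have "x \<in> span A" if "x \<in> B" for x
  proof (rule ccontr)
    assume x: "x \<notin> span A"
    then have "independent (insert x A)" using assms(2) by (simp add: independent_insert)
    moreover have "insert x A \<subseteq> span B" using that assms(3) by (simp add: span_base)
    ultimately have "card (insert x A) \<le> card B"
      using independent_span_bound[OF assms(1)] by blast
    moreover have "x \<notin> A" using x span_base by blast
    ultimately show False using assms(4) fin by simp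
  qed
  then show "span B \<subseteq> span A" by (intro span_minimal) auto
qed

lemma span_image_eq_if_independent:
  assumes "finite I" "inj_on f I" "independent (f ` I)" "f ` I \<subseteq> span (b ` I)"
  shows "span (f ` I) = span (b ` I)"
  using span_eq_if_independent_card[OF finite_imageI[OF assms(1)] assms(3,4)]
    card_image_le[OF assms(1), of b] card_image[OF assms(2)] by simp

lemma independent_if_spanning_card:
  fixes f :: "'i \<Rightarrow> 'a::real_vector"
  assumes "finite I" "independent A" "A \<subseteq> span (f ` I)" "card A = card I"
  shows "inj_on f I \<and> independent (f ` I)"
proof -
  obtain B where B: "B \<subseteq> f ` I" "independent B" "f ` I \<subseteq> span B"
    using maximal_independent_subset by blast
  have fin: "finite B" using B(1) assms(1) by (auto intro: finite_subset)
  have "A \<subseteq> span B" using assms(3) B(3) span_mono[OF B(3)] by (simp add: span_span)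
  then have "card A \<le> card B" using independent_span_bound[OF fin assms(2)] by blast
  moreover have "card B \<le> card (f ` I)" "card (f ` I) \<le> card I"
    using B(1) assms(1) by (auto intro: card_mono card_image_le)
  ultimately have "card (f ` I) = card I" "card B = card (f ` I)" using assms(4) by auto
  then show ?thesis
    using B(1,2) assms(1) card_subset_eq[of "f ` I" B] by (auto intro: eq_card_imp_inj_on)
qed

lemma in_span_image_obtain:
  fixes f :: "'i \<Rightarrow> 'a::real_vector"
  assumes "finite I" "inj_on f I" "x \<in> span (f ` I)"
  obtains a where "x = (\<Sum>i\<in>I. a i *\<^sub>R f i)"
proof -
  from assms(1,3) obtain c where "x = (\<Sum>v\<in>f ` I. c v *\<^sub>R v)"
    by (auto simp: span_finite)
  then have "x = (\<Sum>i\<in>I. c (f i) *\<^sub>R f i)" using assms(2) by (simp add: sum.reindex)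
  then show thesis by (rule that)
qed

lemma independent_functional:
  fixes f :: "'i \<Rightarrow> 'a::real_vector"
  assumes "inj_on f I" "independent (f ` I)"
  obtains g :: "'a \<Rightarrow> real" where "linear g" "\<And>i. i \<in> I \<Longrightarrow> g (f i) = c i"
proof -
  from linear_independent_extend[OF assms(2)]
  obtain g :: "'a \<Rightarrow> real" where g: "linear g \<and> (\<forall>x\<in>f ` I. g x = c (inv_into I f x))" ..
  show thesis
    by (rule that[OF conjunct1[OF g]]) (use g assms(1) in simp)
qed

lemma independent_coeff_unique:
  fixes f :: "'i \<Rightarrow> 'a::real_vector"
  assumes "finite I" "inj_on f I" "independent (f ` I)"
    and eq: "(\<Sum>i\<in>I. a i *\<^sub>R f i) = (\<Sum>i\<in>I. b i *\<^sub>R f i)" and "k \<in> I"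
  shows "a k = b k"
proof -
  obtain g :: "'a \<Rightarrow> real" where g: "linear g" "\<And>i. i \<in> I \<Longrightarrow> g (f i) = (if i = k then 1 else 0)"
    by (rule independent_functional[OF assms(2,3)]) (rule that)
  have "g (\<Sum>i\<in>I. x i *\<^sub>R f i) = x k" for x
  proof -
    have "g (\<Sum>i\<in>I. x i *\<^sub>R f i) = (\<Sum>i\<in>I. x i * g (f i))"
      by (simp add: linear_sum[OF g(1)] linear_cmul[OF g(1)])
    also have "\<dots> = (\<Sum>i\<in>I. if i = k then x i else 0)"
      by (rule sum.cong) (use g(2) in auto)
    finally show ?thesis using \<open>k \<in> I\<close> \<open>finite I\<close> by simp
  qed
  then show ?thesis using eq by metis
qed

section \<open>Binary forms\<close>

definition det2 :: "real^2 \<Rightarrow> real^2 \<Rightarrow> real" where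
  "det2 z y = z $ 1 * y $ 2 - z $ 2 * y $ 1"

lemma det2_self [simp]: "det2 z z = 0"
  by (simp add: det2_def)

lemma det2_commute: "det2 z y = - det2 y z"
  by (simp add: det2_def)

lemma det2_linear_comb: "det2 (a *\<^sub>R x + b *\<^sub>R y) z = a * det2 x z + b * det2 y z"
  by (simp add: det2_def algebra_simps)

lemma det2_scaleR_left: "det2 (a *\<^sub>R x) z = a * det2 x z"
  by (simp add: det2_def algebra_simps)

lemma det2_expand: "det2 y z *\<^sub>R x = det2 x z *\<^sub>R y + det2 y x *\<^sub>R z"
  by (simp add: vec_eq_iff forall_2 det2_def algebra_simps)

lemma nonzero_vec2: "z \<noteq> (0::real^2) \<longleftrightarrow> z $ 1 \<noteq> 0 \<or> z $ 2 \<noteq> 0"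
  by (auto simp: vec_eq_iff forall_2)

lemma det2_eq_0E:
  assumes "z \<noteq> 0" "y \<noteq> 0" "det2 z y = 0"
  obtains t where "t \<noteq> 0" "z = t *\<^sub>R y"
proof -
  have e: "z $ 1 * y $ 2 = z $ 2 * y $ 1" using assms(3) by (simp add: det2_def)
  define t where "t = (if y $ 1 = 0 then z $ 2 / y $ 2 else z $ 1 / y $ 1)"
  have "z = t *\<^sub>R y"
    using e assms(2) by (auto simp: t_def vec_eq_iff forall_2 field_simps)
  moreover from this assms(1) have "t \<noteq> 0" by auto
  ultimately show thesis using that by blast
qed

lemma span_singleton_eq:
  fixes v w :: "'a::real_vector"
  assumes "span {v} = span {w}" "v \<noteq> 0"
  obtains s where "s \<noteq> 0" "v = s *\<^sub>R w"
proof -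
  have "v \<in> span {w}" using assms(1) span_base[of v "{v}"] by simp
  then obtain s where "v = s *\<^sub>R w" by (auto simp: span_singleton)
  then show thesis using that[of s] assms(2) by force
qed

lemma span_singleton_scaleR:
  fixes v :: "'a::real_vector"
  assumes "s \<noteq> 0"
  shows "span {s *\<^sub>R v} = span {v}"
  using span_image_scale[of "{v}" "\<lambda>_. s"] assms by simp

lemma span_vec2_eq_iff:
  assumes "z \<noteq> 0" "y \<noteq> (0::real^2)"
  shows "span {z} = span {y} \<longleftrightarrow> det2 z y = 0"
proof
  assume "span {z} = span {y}"
  then obtain s where "z = s *\<^sub>R y" using span_singleton_eq assms(1) by blast
  then show "det2 z y = 0" by (simp add: det2_scaleR_left)
next
  assume "det2 z y = 0"
  then obtain t where "t \<noteq> 0" "z = t *\<^sub>R y" using det2_eq_0E assms by blast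
  then show "span {z} = span {y}" by (simp add: span_singleton_scaleR)
qed

text \<open>
  The coefficient of \<open>x\<^sup>d\<^sup>-\<^sup>k y\<^sup>k\<close> in the product of the linear forms \<open>\<alpha> j * x + \<gamma> j * y\<close> with \<open>j \<in> J\<close>, where
  \<open>d = card J\<close>. It is spelled out because it has to be recognised as a smooth function of
  \<open>\<alpha>\<close> and \<open>\<gamma>\<close>.
\<close>
definition form_coeff :: "'i set \<Rightarrow> ('i \<Rightarrow> real) \<Rightarrow> ('i \<Rightarrow> real) \<Rightarrow> nat \<Rightarrow> real" where
  "form_coeff J \<alpha> \<gamma> k = (\<Sum>T | T \<subseteq> J \<and> card T = k. (\<Prod>j\<in>T. \<gamma> j) * (\<Prod>j\<in>J - T. \<alpha> j))"

lemma prod_linear_forms: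
  assumes "finite J"
  shows "(\<Prod>j\<in>J. \<alpha> j * x + \<gamma> j * y)
    = (\<Sum>k<Suc (card J). x ^ (card J - k) * y ^ k * form_coeff J \<alpha> \<gamma> k)"
proof -
  have "(\<Prod>j\<in>J. \<alpha> j * x + \<gamma> j * y) = (\<Prod>j\<in>J. \<gamma> j * y + \<alpha> j * x)"
    by (simp add: add.commute)
  also have "\<dots> = (\<Sum>T\<in>Pow J. (\<Prod>j\<in>T. \<gamma> j * y) * (\<Prod>j\<in>J - T. \<alpha> j * x))"
    using assms by (rule prod_add)
  also have "\<dots> = (\<Sum>k<Suc (card J). \<Sum>T | T \<in> Pow J \<and> card T = k.
      (\<Prod>j\<in>T. \<gamma> j * y) * (\<Prod>j\<in>J - T. \<alpha> j * x))"
    using assms by (intro sum.group[symmetric]) (auto intro!: le_imp_less_Suc card_mono)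
  also have "\<dots> = (\<Sum>k<Suc (card J). x ^ (card J - k) * y ^ k * form_coeff J \<alpha> \<gamma> k)"
  proof (rule sum.cong[OF refl])
    fix k
    have "(\<Prod>j\<in>T. \<gamma> j * y) * (\<Prod>j\<in>J - T. \<alpha> j * x)
        = x ^ (card J - k) * y ^ k * ((\<Prod>j\<in>T. \<gamma> j) * (\<Prod>j\<in>J - T. \<alpha> j))"
      if "T \<subseteq> J" "card T = k" for T
    proof -
      have "card (J - T) = card J - k" using that assms by (simp add: card_Diff_subset finite_subset)
      then show ?thesis using that by (simp add: prod.distrib mult_ac)
    qed
    then show "(\<Sum>T | T \<in> Pow J \<and> card T = k. (\<Prod>j\<in>T. \<gamma> j * y) * (\<Prod>j\<in>J - T. \<alpha> j * x))
        = x ^ (card J - k) * y ^ k * form_coeff J \<alpha> \<gamma> k"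
      by (simp add: form_coeff_def sum_distrib_left)
  qed
  finally show ?thesis .
qed

section \<open>Rational normal curves\<close>

text \<open>
  The rational normal curve with basis \<open>b\<close>, as a vector-valued form of degree \<open>n - 1\<close>.
\<close>
definition moment_curve :: "nat \<Rightarrow> (nat \<Rightarrow> 'a::real_vector) \<Rightarrow> real^2 \<Rightarrow> 'a" where
  "moment_curve n b z = (\<Sum>j<n. (z $ 1 ^ (n - 1 - j) * z $ 2 ^ j) *\<^sub>R b j)"

lemma rational_normal_curve_moment:
  "rational_normal_curve V K \<longleftrightarrow> (\<exists>b. inj_on b {..<dim V} \<and> independent (b ` {..<dim V})
     \<and> span (b ` {..<dim V}) = V \<and> K = {span {moment_curve (dim V) b z} | z. z \<noteq> 0})"
  unfolding rational_normal_curve_def moment_curve_def Let_def ..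

lemma moment_curve_scaleR: "moment_curve n b (t *\<^sub>R z) = t ^ (n - 1) *\<^sub>R moment_curve n b z"
proof -
  have "t ^ (n - 1) = t ^ (n - 1 - j) * t ^ j" if "j < n" for j
    using that by (simp flip: power_add)
  then show ?thesis
    unfolding moment_curve_def scaleR_sum_right
    by (intro sum.cong) (simp_all add: power_mult_distrib algebra_simps)
qed

lemma linear_moment_curve:
  "linear h \<Longrightarrow> h (moment_curve n b z) = moment_curve n (\<lambda>j. h (b j)) z"
  unfolding moment_curve_def by (simp add: linear_sum linear_cmul)

lemma moment_curve_in_span: "moment_curve n b z \<in> span (b ` {..<n})"
  unfolding moment_curve_def by (intro span_sum span_scale span_base) auto

text \<open>
  A linear functional composed with the moment curve can be any binary form of degree \<open>n - 1\<close>, as the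
  components of the moment curve in the basis \<open>b\<close> are all the monomials of this degree. Suitable
  products of linear forms then show that the moment curve has no zeros, is injective on \<open>\<real>P\<^sup>1\<close>, is an
  immersion, and has its points in general position.
\<close>
lemma moment_curve_form_functional:
  fixes b :: "nat \<Rightarrow> 'a::real_vector"
  assumes "inj_on b {..<n}" "independent (b ` {..<n})" "finite J" "Suc (card J) = n"
  obtains g :: "'a \<Rightarrow> real"
  where "linear g" "\<And>z. g (moment_curve n b z) = (\<Prod>j\<in>J. det2 z (w j))"
proof -
  obtain g :: "'a \<Rightarrow> real" where g: "linear g"
    "\<And>k. k \<in> {..<n} \<Longrightarrow> g (b k) = form_coeff J (\<lambda>j. w j $ 2) (\<lambda>j. - w j $ 1) k"
    by (rule independent_functional[OF assms(1,2)]) (rule that)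
  have "g (moment_curve n b z) = (\<Prod>j\<in>J. det2 z (w j))" for z
  proof -
    have "(\<Prod>j\<in>J. det2 z (w j)) = (\<Prod>j\<in>J. w j $ 2 * z $ 1 + (- w j $ 1) * z $ 2)"
      by (simp add: det2_def algebra_simps)
    also have "\<dots> = g (moment_curve n b z)"
      unfolding linear_moment_curve[OF g(1)] unfolding prod_linear_forms[OF assms(3)] moment_curve_def
      using assms(4) g(2) by (intro sum.cong) auto
    finally show ?thesis by simp
  qed
  then show thesis by (rule that[OF g(1)])
qed

lemma moment_curve_nonzero:
  assumes "inj_on b {..<n}" "independent (b ` {..<n})" "n > 0" "z \<noteq> 0"
  shows "moment_curve n b z \<noteq> 0"
proof -
  \<comment> \<open>The form with an \<open>(n - 1)\<close>-fold zero at the direction orthogonal to \<open>z\<close>.\<close>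
  define y :: "real^2" where "y = vector [- z $ 2, z $ 1]"
  have "det2 z y = (z $ 1)\<^sup>2 + (z $ 2)\<^sup>2"
    by (simp add: det2_def y_def power2_eq_square)
  then have "det2 z y \<noteq> 0" using assms(4) by (auto simp: nonzero_vec2 sum_power2_eq_zero_iff)
  have "Suc (card {..<n - 1}) = n" using assms(3) by simp
  then obtain g :: "_ \<Rightarrow> real" where "linear g" "\<And>z. g (moment_curve n b z) = (\<Prod>j<n - 1. det2 z y)"
    by (rule moment_curve_form_functional[OF assms(1,2) finite_lessThan, where w = "\<lambda>_. y"]) (rule that)
  then show ?thesis using \<open>det2 z y \<noteq> 0\<close> by (metis linear_0 prod_zero_iff finite_lessThan)
qed

lemma moment_curve_proportional:
  assumes "inj_on b {..<n}" "independent (b ` {..<n})" "n \<ge> 2" "y \<noteq> 0" "z \<noteq> 0"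
    and eq: "span {moment_curve n b y} = span {moment_curve n b z}"
  shows "det2 y z = 0"
proof -
  have "moment_curve n b y \<noteq> 0"
    by (rule moment_curve_nonzero) (use assms in auto)
  with eq obtain s where s: "s \<noteq> 0" "moment_curve n b y = s *\<^sub>R moment_curve n b z"
    by (rule span_singleton_eq) (rule that)
  have "Suc (card {..<n - 1}) = n" using assms(3) by simp
  then obtain g :: "_ \<Rightarrow> real" where g: "linear g" "\<And>x. g (moment_curve n b x) = (\<Prod>j<n - 1. det2 x z)"
    by (rule moment_curve_form_functional[OF assms(1,2) finite_lessThan, where w = "\<lambda>_. z"]) (rule that)
  have "det2 y z ^ (n - 1) = s * det2 z z ^ (n - 1)"
    using arg_cong[OF s(2), of g] g by (simp add: linear_cmul)
  then show ?thesis using assms(3) by (simp add: power_0_left)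
qed

text \<open>
  The Lagrange polynomial for the node \<open>z i\<close>, up to normalisation, in homogeneous coordinates.
\<close>
definition cofactor_form :: "nat \<Rightarrow> (nat \<Rightarrow> real^2) \<Rightarrow> nat \<Rightarrow> real^2 \<Rightarrow> real" where
  "cofactor_form n z i x = (\<Prod>j\<in>{..<n} - {i}. det2 x (z j))"

text \<open>
  The cofactor form of \<open>i\<close> vanishes at all nodes but \<open>z i\<close>. Read as linear functionals, these forms prove the
  independence of the points at the nodes and compute the coordinates of any other point.
\<close>
lemma moment_curve_Lagrange:
  fixes b :: "nat \<Rightarrow> 'a::real_vector"
  assumes b: "inj_on b {..<n}" "independent (b ` {..<n})"
    and z: "\<And>i j. i < n \<Longrightarrow> j < n \<Longrightarrow> i \<noteq> j \<Longrightarrow> det2 (z i) (z j) \<noteq> 0"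
  shows "inj_on (\<lambda>i. moment_curve n b (z i)) {..<n}"
    and "independent ((\<lambda>i. moment_curve n b (z i)) ` {..<n})"
    and "span ((\<lambda>i. moment_curve n b (z i)) ` {..<n}) = span (b ` {..<n})"
    and "moment_curve n b x = (\<Sum>i<n. (cofactor_form n z i x / cofactor_form n z i (z i)) *\<^sub>R moment_curve n b (z i))"
proof -
  let ?m = "\<lambda>i. moment_curve n b (z i)"
  have "\<forall>i\<in>{..<n}. \<exists>g :: 'a \<Rightarrow> real. linear g \<and> (\<forall>x. g (moment_curve n b x) = cofactor_form n z i x)"
  proof
    fix i assume "i \<in> {..<n}"
    then have "Suc (card ({..<n} - {i})) = n" by simp
    then obtain g :: "'a \<Rightarrow> real"
      where "linear g" "\<And>x. g (moment_curve n b x) = (\<Prod>j\<in>{..<n} - {i}. det2 x (z j))"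
      by (rule moment_curve_form_functional[OF b finite_Diff[OF finite_lessThan], where w = z]) (rule that)
    then show "\<exists>g :: 'a \<Rightarrow> real. linear g \<and> (\<forall>x. g (moment_curve n b x) = cofactor_form n z i x)"
      by (intro exI[of _ g]) (simp add: cofactor_form_def)
  qed
  from bchoice[OF this] obtain g :: "nat \<Rightarrow> 'a \<Rightarrow> real" where
    "\<forall>i\<in>{..<n}. linear (g i) \<and> (\<forall>x. g i (moment_curve n b x) = cofactor_form n z i x)" ..
  then have g: "\<And>i. i < n \<Longrightarrow> linear (g i)"
    "\<And>i x. i < n \<Longrightarrow> g i (moment_curve n b x) = cofactor_form n z i x" by simp_all
  have nz: "cofactor_form n z i (z j) \<noteq> 0 \<longleftrightarrow> i = j" if "i < n" "j < n" for i j
    using that z by (cases "i = j") (auto simp: cofactor_form_def intro!: bexI[of _ j])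
  have ind: "inj_on ?m {..<n} \<and> independent (?m ` {..<n})"
    by (rule independent_if_dual[of _ g]) (use g nz in auto)
  then show inj: "inj_on ?m {..<n}" and ind': "independent (?m ` {..<n})" by auto
  show span: "span (?m ` {..<n}) = span (b ` {..<n})"
    using ind' by (rule span_eq_if_independent_card[rotated])
      (use moment_curve_in_span card_image[OF inj] card_image_le[of "{..<n}" b] in auto)
  obtain a where a: "moment_curve n b x = (\<Sum>i<n. a i *\<^sub>R ?m i)"
    using in_span_image_obtain[OF _ inj] moment_curve_in_span[of n b x] span by auto
  have "a i = cofactor_form n z i x / cofactor_form n z i (z i)" if "i < n" for i
  proof -
    have "cofactor_form n z i x = g i (\<Sum>k<n. a k *\<^sub>R ?m k)"
      using a g(2)[OF that] by metis
    also have "\<dots> = (\<Sum>k<n. a k * cofactor_form n z i (z k))"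
      using that g by (simp add: linear_sum linear_cmul)
    also have "\<dots> = (\<Sum>k<n. if k = i then a i * cofactor_form n z i (z i) else 0)"
      using nz[OF that] by (intro sum.cong) auto
    also have "\<dots> = a i * cofactor_form n z i (z i)" using that by simp
    finally show ?thesis using nz[OF that that] by simp
  qed
  then show "moment_curve n b x = (\<Sum>i<n. (cofactor_form n z i x / cofactor_form n z i (z i)) *\<^sub>R ?m i)"
    using a by simp
qed

text \<open>
  The coefficients of the vector-valued form \<open>\<Sum>\<^sub>i u\<^sub>i \<Prod>\<^sub>j\<^sub>\<noteq>\<^sub>i (\<alpha>\<^sub>j x + \<gamma>\<^sub>j y)\<close>.
\<close>
definition interpolation_frame ::
    "nat \<Rightarrow> (nat \<Rightarrow> real) \<Rightarrow> (nat \<Rightarrow> real) \<Rightarrow> (nat \<Rightarrow> 'a::real_vector) \<Rightarrow> nat \<Rightarrow> 'a" where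
  "interpolation_frame n \<alpha> \<gamma> u k = (\<Sum>i<n. form_coeff ({..<n} - {i}) \<alpha> \<gamma> k *\<^sub>R u i)"

lemma moment_curve_interpolation_frame:
  "moment_curve n (interpolation_frame n \<alpha> \<gamma> u) x
    = (\<Sum>i<n. (\<Prod>j\<in>{..<n} - {i}. \<alpha> j * x $ 1 + \<gamma> j * x $ 2) *\<^sub>R u i)"
proof -
  have "moment_curve n (interpolation_frame n \<alpha> \<gamma> u) x
    = (\<Sum>i<n. (\<Sum>k<n. x $ 1 ^ (n - 1 - k) * x $ 2 ^ k * form_coeff ({..<n} - {i}) \<alpha> \<gamma> k) *\<^sub>R u i)"
    unfolding moment_curve_def interpolation_frame_def
    by (simp add: scaleR_sum_left scaleR_sum_right) (rule sum.swap)
  also have "\<dots> = (\<Sum>i<n. (\<Prod>j\<in>{..<n} - {i}. \<alpha> j * x $ 1 + \<gamma> j * x $ 2) *\<^sub>R u i)"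
  proof (rule sum.cong[OF refl])
    fix i assume i: "i \<in> {..<n}"
    then have "Suc (card ({..<n} - {i})) = n" "card ({..<n} - {i}) = n - 1" by simp_all
    then show "(\<Sum>k<n. x $ 1 ^ (n - 1 - k) * x $ 2 ^ k * form_coeff ({..<n} - {i}) \<alpha> \<gamma> k) *\<^sub>R u i
      = (\<Prod>j\<in>{..<n} - {i}. \<alpha> j * x $ 1 + \<gamma> j * x $ 2) *\<^sub>R u i"
      using prod_linear_forms[of "{..<n} - {i}" \<alpha> "x $ 1" \<gamma> "x $ 2"] by simp
  qed
  finally show ?thesis .
qed

text \<open>
  Steiner's construction. Let the given curve be \<open>m\<close> and the given points \<open>u\<^sub>i = s\<^sub>i m(z\<^sub>i)\<close>. By Lagrange
  interpolation in the nodes \<open>z\<^sub>0, \<dots>, z\<^sub>n\<^sub>-\<^sub>1\<close> the coordinates of \<open>u\<^sub>k\<close>, for \<open>k = n\<close> or \<open>k = n + 1\<close>, are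
  \<open>s\<^sub>k P\<^sub>i(z\<^sub>k) / \<rho>\<^sub>i\<close> with \<open>\<rho>\<^sub>i = s\<^sub>i P\<^sub>i(z\<^sub>i)\<close>. Up to a factor that depends on \<open>k\<close> only, the inverse of this
  coordinate is \<open>\<rho>\<^sub>i det(z\<^sub>k, z\<^sub>i)\<close>, as \<open>P\<^sub>i(z\<^sub>k) det(z\<^sub>k, z\<^sub>i)\<close> is the same for all \<open>i\<close>. Therefore the linear
  form \<open>x / a\<^sub>i + y / c\<^sub>i\<close> is \<open>\<rho>\<^sub>i det(T(x, y), z\<^sub>i)\<close> for one linear isomorphism \<open>T\<close> of \<open>\<real>\<^sup>2\<close>, and the interpolating
  curve is a constant multiple of \<open>m \<circ> T\<close>, again by Lagrange interpolation.
\<close>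
lemma rational_normal_curve_interpolation:
  fixes b u :: "nat \<Rightarrow> 'a::real_vector" and z :: "nat \<Rightarrow> real^2"
  assumes n: "n > 0"
    and b: "inj_on b {..<n}" "independent (b ` {..<n})"
    and u: "\<And>i. i < n + 2 \<Longrightarrow> u i = s i *\<^sub>R moment_curve n b (z i)"
    and s: "\<And>i. i < n + 2 \<Longrightarrow> s i \<noteq> 0"
    and z: "\<And>i j. i < n + 2 \<Longrightarrow> j < n + 2 \<Longrightarrow> i \<noteq> j \<Longrightarrow> det2 (z i) (z j) \<noteq> 0"
  shows "inj_on u {..<n} \<and> independent (u ` {..<n}) \<and> span (u ` {..<n}) = span (b ` {..<n})"
    and "u n = (\<Sum>i<n. a i *\<^sub>R u i) \<Longrightarrow> u (Suc n) = (\<Sum>i<n. c i *\<^sub>R u i) \<Longrightarrow>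
      (\<forall>i<n. a i \<noteq> 0 \<and> c i \<noteq> 0) \<and>
      (let f = interpolation_frame n (\<lambda>i. inverse (a i)) (\<lambda>i. inverse (c i)) u in
        inj_on f {..<n} \<and> independent (f ` {..<n}) \<and> span (f ` {..<n}) = span (b ` {..<n}) \<and>
        {span {moment_curve n f x} | x. x \<noteq> 0} = {span {moment_curve n b x} | x. x \<noteq> 0})"
proof -
  define m where "m = moment_curve n b"
  define P where "P = cofactor_form n z"
  have um: "u i = s i *\<^sub>R m (z i)" if "i < n + 2" for i using u that by (simp add: m_def)
  have zz: "det2 (z i) (z j) \<noteq> 0" if "i < n" "j < n" "i \<noteq> j" for i j using z that by simp
  have L: "inj_on (\<lambda>i. m (z i)) {..<n}" "independent ((\<lambda>i. m (z i)) ` {..<n})"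
    "span ((\<lambda>i. m (z i)) ` {..<n}) = span (b ` {..<n})"
    "\<And>x. m x = (\<Sum>i<n. (P i x / P i (z i)) *\<^sub>R m (z i))"
    unfolding m_def P_def by (rule moment_curve_Lagrange[OF b], erule (2) zz)+
  have Pnz: "P i (z k) \<noteq> 0" if "i < n" "k < n + 2" "k = i \<or> n \<le> k" for i k
    unfolding P_def cofactor_form_def using that z[of k] by (auto simp: prod_zero_iff)
  \<comment> \<open>The functionals dual to the points at the first \<open>n\<close> nodes.\<close>
  obtain g :: "nat \<Rightarrow> 'a \<Rightarrow> real" where g: "\<And>i. linear (g i)"
    "\<And>i k. k < n \<Longrightarrow> g i (m (z k)) = (if k = i then 1 else 0)"
  proof -
    have "\<exists>g :: 'a \<Rightarrow> real. linear g \<and> (\<forall>k<n. g (m (z k)) = (if k = i then 1 else 0))" for i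
    proof -
      obtain g :: "'a \<Rightarrow> real" where "linear g"
        "\<And>k. k \<in> {..<n} \<Longrightarrow> g (m (z k)) = (if k = i then 1 else 0)"
        by (rule independent_functional[OF L(1,2)]) (rule that)
      then show ?thesis by (intro exI[of _ g]) simp
    qed
    then have "\<exists>g :: nat \<Rightarrow> 'a \<Rightarrow> real.
        \<forall>i. linear (g i) \<and> (\<forall>k<n. g i (m (z k)) = (if k = i then 1 else 0))"
      by (rule choice[OF allI])
    then obtain g :: "nat \<Rightarrow> 'a \<Rightarrow> real" where
      "\<forall>i. linear (g i) \<and> (\<forall>k<n. g i (m (z k)) = (if k = i then 1 else 0))" ..
    then show thesis by (intro that[of g]) simp_all
  qed
  have gsum: "g i (\<Sum>k<n. x k *\<^sub>R u k) = x i * s i" if "i < n" for i x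
  proof -
    have "g i (\<Sum>k<n. x k *\<^sub>R u k) = (\<Sum>k<n. x k * (s k * g i (m (z k))))"
      using um by (simp add: linear_sum[OF g(1)] linear_cmul[OF g(1)] mult.assoc)
    also have "\<dots> = (\<Sum>k<n. if k = i then x i * s i else 0)"
      by (rule sum.cong) (use g(2) in auto)
    finally show ?thesis using that by simp
  qed
  have gm: "g i (m x) = P i x / P i (z i)" if "i < n" for i x
  proof -
    have "g i (m x) = (\<Sum>k<n. (P k x / P k (z k)) * g i (m (z k)))"
      using L(4)[of x] by (simp add: linear_sum[OF g(1)] linear_cmul[OF g(1)])
    also have "\<dots> = (\<Sum>k<n. if k = i then P i x / P i (z i) else 0)"
      by (rule sum.cong) (use g(2) in auto)
    finally show ?thesis using that by simp
  qed
  have "inj_on u {..<n} \<and> independent (u ` {..<n})"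
    by (rule independent_if_dual[of _ g])
      (use g um s in \<open>auto simp: linear_cmul[OF g(1)] split: if_splits\<close>)
  moreover have "u ` {..<n} \<subseteq> span (b ` {..<n})"
    using um moment_curve_in_span[of n b] by (auto simp: m_def intro!: span_scale)
  ultimately show basis: "inj_on u {..<n} \<and> independent (u ` {..<n}) \<and> span (u ` {..<n}) = span (b ` {..<n})"
    using span_image_eq_if_independent[OF finite_lessThan] by blast
  assume a: "u n = (\<Sum>i<n. a i *\<^sub>R u i)" and c: "u (Suc n) = (\<Sum>i<n. c i *\<^sub>R u i)"
  have coeff: "x i = s k * P i (z k) / (P i (z i) * s i)"
    if "u k = (\<Sum>i<n. x i *\<^sub>R u i)" "i < n" "k < n + 2" for x i k
  proof -
    have "x i * s i = s k * (P i (z k) / P i (z i))"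
      using arg_cong[OF that(1), of "g i"] gsum[OF that(2)] um[OF that(3)] gm[OF that(2)]
      by (simp add: linear_cmul[OF g(1)])
    then show ?thesis using s[of i] that(2) Pnz[of i i] by (simp add: field_simps)
  qed
  have coeff_nz: "x i \<noteq> 0" if "u k = (\<Sum>i<n. x i *\<^sub>R u i)" "i < n" "k < n + 2" "n \<le> k" for x i k
    using coeff[OF that(1-3)] s[of k] s[of i] Pnz[of i k] Pnz[of i i] that by simp
  define D where "D k = (\<Prod>j<n. det2 (z k) (z j))" for k
  have Dnz: "D k \<noteq> 0" if "k < n + 2" "n \<le> k" for k
    unfolding D_def using z[of k] that by (auto simp: prod_zero_iff)
  have PD: "D k = P i (z k) * det2 (z k) (z i)" if "i < n" for i k
    unfolding D_def P_def cofactor_form_def using that by (simp add: prod.remove[of _ i] mult.commute)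
  define \<rho> where "\<rho> i = P i (z i) * s i" for i
  have \<rho>: "\<rho> i \<noteq> 0" if "i < n" for i using Pnz[of i i] s[of i] that by (simp add: \<rho>_def)
  have inv: "inverse (x i) = \<rho> i * (det2 (z k) (z i) / (s k * D k))"
    if "u k = (\<Sum>i<n. x i *\<^sub>R u i)" "i < n" "k < n + 2" "n \<le> k" for x i k
    using coeff[OF that(1-3)] PD[OF that(2), of k] Dnz[OF that(3,4)] by (simp add: \<rho>_def)
  define T where "T x = (x $ 1 / (s n * D n)) *\<^sub>R z n + (x $ 2 / (s (Suc n) * D (Suc n))) *\<^sub>R z (Suc n)"
    for x :: "real^2"
  define R where "R = (\<Prod>j<n. \<rho> j)"
  have R: "R \<noteq> 0" unfolding R_def using \<rho> by simp
  define f where "f = interpolation_frame n (\<lambda>i. inverse (a i)) (\<lambda>i. inverse (c i)) u"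
  have form: "inverse (a j) * x $ 1 + inverse (c j) * x $ 2 = \<rho> j * det2 (T x) (z j)" if "j < n" for j x
    using inv[OF a that] inv[OF c that] by (simp add: T_def det2_linear_comb algebra_simps)
  have key: "moment_curve n f x = R *\<^sub>R m (T x)" for x
  proof -
    have "(\<Prod>j\<in>{..<n} - {i}. inverse (a j) * x $ 1 + inverse (c j) * x $ 2) *\<^sub>R u i
        = R *\<^sub>R ((P i (T x) / P i (z i)) *\<^sub>R m (z i))" if "i < n" for i
    proof -
      have "(\<Prod>j\<in>{..<n} - {i}. inverse (a j) * x $ 1 + inverse (c j) * x $ 2)
          = (\<Prod>j\<in>{..<n} - {i}. \<rho> j) * P i (T x)"
        unfolding P_def cofactor_form_def prod.distrib[symmetric]
        by (rule prod.cong) (use form in auto)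
      moreover have "R = (\<Prod>j\<in>{..<n} - {i}. \<rho> j) * \<rho> i"
        unfolding R_def using that by (simp add: prod.remove[of _ i] mult.commute)
      ultimately show ?thesis
        using um[of i] that Pnz[of i i] by (simp add: \<rho>_def field_simps)
    qed
    then show ?thesis
      unfolding f_def moment_curve_interpolation_frame L(4)[of "T x"] scaleR_sum_right
      by (intro sum.cong) auto
  qed
  have dnz: "det2 (z n) (z (Suc n)) \<noteq> 0" using z by simp
  have T_surj: "\<exists>x. x \<noteq> 0 \<and> T x = y" if "y \<noteq> 0" for y
  proof -
    \<comment> \<open>The coordinates of \<open>y\<close> with respect to \<open>z n\<close> and \<open>z (Suc n)\<close>, by Cramer's rule.\<close>
    define d where "d = det2 (z n) (z (Suc n))"
    define x :: "real^2" where "x = vector [s n * D n * (det2 y (z (Suc n)) / d),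
      s (Suc n) * D (Suc n) * (det2 (z n) y / d)]"
    have "d *\<^sub>R T x = d *\<^sub>R y"
      using s[of n] s[of "Suc n"] Dnz[of n] Dnz[of "Suc n"] dnz
        det2_expand[of "z n" "z (Suc n)" y]
      by (simp add: T_def x_def d_def scaleR_add_right)
    then have "T x = y" using dnz by (simp add: d_def)
    moreover from this that have "x \<noteq> 0" by (auto simp: T_def)
    ultimately show ?thesis by blast
  qed
  have T_nz: "T x \<noteq> 0" if "x \<noteq> 0" for x
  proof
    assume "T x = 0"
    then have "det2 (T x) (z (Suc n)) = 0" "det2 (T x) (z n) = 0"
      by (simp_all add: det2_def)
    then show False
      using that dnz det2_commute[of "z n" "z (Suc n)"] s[of n] s[of "Suc n"] Dnz[of n] Dnz[of "Suc n"]
      by (auto simp: T_def det2_linear_comb det2_scaleR_left nonzero_vec2)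
  qed
  have fspan: "m (z i) \<in> span (f ` {..<n})" if "i < n" for i
  proof -
    have "z i \<noteq> 0" using z[of i "Suc n"] that by (auto simp: det2_def)
    then obtain x where "T x = z i" using T_surj by blast
    then have "R *\<^sub>R m (z i) \<in> span (f ` {..<n})"
      using key[of x] moment_curve_in_span[of n f x] by simp
    then show ?thesis using R span_scale[of _ "f ` {..<n}" "inverse R"] by fastforce
  qed
  have f_basis: "inj_on f {..<n} \<and> independent (f ` {..<n})"
    by (rule independent_if_spanning_card[OF _ L(2)]) (use fspan card_image[OF L(1)] in auto)
  have "f ` {..<n} \<subseteq> span (u ` {..<n})"
    unfolding f_def interpolation_frame_def by (auto intro!: span_sum span_scale intro: span_base)
  then have "span (f ` {..<n}) = span (b ` {..<n})"
    using span_image_eq_if_independent[OF finite_lessThan, of f n u] f_basis basis by simp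
  moreover have "{span {moment_curve n f x} | x. x \<noteq> 0} = {span {m x} | x. x \<noteq> 0}"
  proof -
    have e: "span {moment_curve n f x} = span {m (T x)}" for x
      using key R by (simp add: span_singleton_scaleR)
    show ?thesis unfolding e using T_nz T_surj by (auto; metis)
  qed
  moreover have "\<forall>i<n. a i \<noteq> 0 \<and> c i \<noteq> 0"
    using coeff_nz[OF a] coeff_nz[OF c] by simp
  ultimately show "(\<forall>i<n. a i \<noteq> 0 \<and> c i \<noteq> 0) \<and>
      (let f = interpolation_frame n (\<lambda>i. inverse (a i)) (\<lambda>i. inverse (c i)) u in
        inj_on f {..<n} \<and> independent (f ` {..<n}) \<and> span (f ` {..<n}) = span (b ` {..<n}) \<and>
        {span {moment_curve n f x} | x. x \<noteq> 0} = {span {moment_curve n b x} | x. x \<noteq> 0})"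
    unfolding Let_def using f_basis by (simp add: f_def m_def)
qed

section \<open>Symmetric powers of the plane\<close>

lemma sum_fun_apply: "(\<Sum>i\<in>I. f i) x = (\<Sum>i\<in>I. f i x)"
  by (induction I rule: infinite_finite_induct) auto

text \<open>
  The component array of the monomial \<open>z\<^sub>1\<^sup>k\<^sup>-\<^sup>j z\<^sub>2\<^sup>j\<close>, scaled such that all its non-zero entries are \<open>1\<close>.
  With this scaling the power of a vector has the monomials themselves as coordinates.
\<close>
definition sym_basis :: "nat \<Rightarrow> nat \<Rightarrow> 2 list \<Rightarrow> real" where
  "sym_basis k j = (\<lambda>l. if length l = k \<and> count_list l 2 = j then 1 else 0)"

lemma linear_apply: "linear (\<lambda>f :: 'i \<Rightarrow> 'a::real_vector. f x)"
  by (intro linearI) (simp_all add: scaleR_fun_def)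

lemma two_cases: "a = (1::2) \<or> a = 2"
  using exhaust_2 .

lemma count_list_two:
  fixes l :: "2 list"
  shows "count_list l 1 + count_list l (2::2) = length l"
proof (induction l)
  case (Cons a l)
  then show ?case using two_cases[of a] by auto
qed simp

lemma tensor_power_apply:
  fixes l :: "2 list"
  shows "tensor_power k s l = (if length l = k then s $ 1 ^ (k - count_list l 2) * s $ 2 ^ count_list l 2 else 0)"
proof -
  have "(\<Prod>i<length l. s $ (l ! i)) = s $ 1 ^ count_list l 1 * s $ 2 ^ count_list l 2"
  proof (induction l)
    case (Cons a l)
    have "(\<Prod>i<length (a # l). s $ ((a # l) ! i)) = s $ a * (\<Prod>i<length l. s $ (l ! i))"
      by (simp add: prod.lessThan_Suc_shift del: prod.lessThan_Suc)
    then show ?case using Cons two_cases[of a] by (auto simp: mult_ac)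
  qed simp
  moreover have "count_list l 1 = length l - count_list l 2" using count_list_two[of l] by linarith
  ultimately show ?thesis by (auto simp: tensor_power_def)
qed

lemma tensor_power_moment_curve: "tensor_power k s = moment_curve (Suc k) (sym_basis k) s"
proof
  fix l
  have "moment_curve (Suc k) (sym_basis k) s l
      = (\<Sum>j<Suc k. if count_list l 2 = j then (if length l = k then s $ 1 ^ (k - j) * s $ 2 ^ j else 0) else 0)"
    unfolding moment_curve_def sum_fun_apply
    by (intro sum.cong) (auto simp: sym_basis_def scaleR_fun_def)
  also have "\<dots> = tensor_power k s l"
    using count_le_length[of l 2] by (simp add: tensor_power_apply)
  finally show "tensor_power k s l = moment_curve (Suc k) (sym_basis k) s l" by simp
qed

abbreviation sym_index :: "nat \<Rightarrow> nat \<Rightarrow> 2 list" where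
  "sym_index k j \<equiv> replicate (k - j) 1 @ replicate j 2"

lemma count_list_replicate: "count_list (replicate k a) b = (if a = b then k else 0)"
  by (induction k) auto

lemma sym_basis_sym_index:
  "j \<le> k \<Longrightarrow> sym_basis k i (sym_index k j) = (if i = j then 1 else 0)"
  by (auto simp: sym_basis_def count_list_replicate)

lemma sym_basis_independent:
  "inj_on (sym_basis k) {..<Suc k} \<and> independent (sym_basis k ` {..<Suc k})"
  by (rule independent_if_dual[of _ "\<lambda>j f. f (sym_index k j)"])
    (use linear_apply in \<open>auto simp: sym_basis_sym_index less_Suc_eq_le\<close>)

lemma sym_power_eq: "\<psi> \<in> sym_power k \<Longrightarrow> mset l = mset l' \<Longrightarrow> \<psi> l = \<psi> l'"
  unfolding sym_power_def by blast

lemma sym_power_0: "\<psi> \<in> sym_power k \<Longrightarrow> length l \<noteq> k \<Longrightarrow> \<psi> l = 0"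
  unfolding sym_power_def by blast

lemma sym_powerI:
  "(\<And>l. length l \<noteq> k \<Longrightarrow> \<psi> l = 0) \<Longrightarrow> (\<And>l l'. mset l = mset l' \<Longrightarrow> \<psi> l = \<psi> l')
    \<Longrightarrow> \<psi> \<in> sym_power k"
  unfolding sym_power_def by blast

lemma subspace_sym_power: "subspace (sym_power k)"
proof (rule subspaceI)
  fix x y :: "'a list \<Rightarrow> real" and c
  assume x: "x \<in> sym_power k"
  show "c *\<^sub>R x \<in> sym_power k"
  proof (rule sym_powerI)
    fix l l' :: "'a list" assume "mset l = mset l'"
    then show "(c *\<^sub>R x) l = (c *\<^sub>R x) l'"
      unfolding scaleR_fun_def using sym_power_eq[OF x] by metis
  qed (simp add: scaleR_fun_def sym_power_0[OF x])
  assume y: "y \<in> sym_power k"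
  show "x + y \<in> sym_power k"
  proof (rule sym_powerI)
    fix l l' :: "'a list" assume "mset l = mset l'"
    then show "(x + y) l = (x + y) l'"
      using sym_power_eq[OF x] sym_power_eq[OF y] by (metis plus_fun_apply)
  qed (simp add: sym_power_0[OF x] sym_power_0[OF y])
qed (simp add: sym_power_def)

lemma count_mset_count_list: "count (mset l) a = count_list l a"
  by (induction l) auto

lemma span_sym_basis: "span (sym_basis k ` {..<Suc k}) = sym_power k"
proof
  have "sym_basis k j l = sym_basis k j l'" if "mset l = mset l'" for j l l'
    using mset_eq_length[OF that] that by (simp add: sym_basis_def flip: count_mset_count_list)
  moreover have "sym_basis k j l = 0" if "length l \<noteq> k" for j l
    using that by (simp add: sym_basis_def)
  ultimately have "sym_basis k j \<in> sym_power k" for j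
    by (rule sym_powerI[rotated])
  then show "span (sym_basis k ` {..<Suc k}) \<subseteq> sym_power k"
    by (intro span_minimal subspace_sym_power) auto
next
  show "sym_power k \<subseteq> span (sym_basis k ` {..<Suc k})"
  proof
    fix \<psi> :: "2 list \<Rightarrow> real" assume \<psi>: "\<psi> \<in> sym_power k"
    have "\<psi> = (\<Sum>j<Suc k. \<psi> (sym_index k j) *\<^sub>R sym_basis k j)"
    proof
      fix l :: "2 list"
      let ?j = "count_list l 2"
      have "(\<Sum>j<Suc k. \<psi> (sym_index k j) *\<^sub>R sym_basis k j) l
          = (\<Sum>j<Suc k. if ?j = j then (if length l = k then \<psi> (sym_index k j) else 0) else 0)"
        unfolding sum_fun_apply by (intro sum.cong) (auto simp: sym_basis_def scaleR_fun_def)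
      also have "\<dots> = (if length l = k then \<psi> (sym_index k ?j) else 0)"
        using count_le_length[of l 2] by simp
      also have "\<dots> = \<psi> l"
      proof (cases "length l = k")
        case True
        \<comment> \<open>Over a two-element alphabet the length and the number of occurrences of \<open>2\<close> determine the multiset.\<close>
        have "count (mset l) a = count (mset (sym_index k ?j)) a" for a
          using two_cases[of a] count_list_two[of l] True
          by (auto simp: count_mset_count_list count_list_replicate simp del: mset_append mset_replicate)
        then have "mset l = mset (sym_index k ?j)" by (rule multiset_eqI)
        from sym_power_eq[OF \<psi> this] show ?thesis using True by simp
      next
        case False
        then show ?thesis using sym_power_0[OF \<psi>] by simp
      qed
      finally show "\<psi> l = (\<Sum>j<Suc k. \<psi> (sym_index k j) *\<^sub>R sym_basis k j) l" by simp
    qed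
    also have "\<dots> \<in> span (sym_basis k ` {..<Suc k})"
      by (intro span_sum span_scale span_base) auto
    finally show "\<psi> \<in> span (sym_basis k ` {..<Suc k})" .
  qed
qed

lemma det2_standard_points: "det2 (vector [1, real i]) (vector [1, real j]) = real j - real i"
  by (simp add: det2_def)

text \<open>
  Powers span the symmetric power, since any \<open>k + 1\<close> points of a rational normal curve of degree \<open>k\<close> are
  independent. Hence identities between linear maps on the symmetric power, such as functoriality of
  \<open>tensor_map\<close>, need to be checked on powers only, where they are obvious.
\<close>
lemma span_tensor_powers: "span (range (tensor_power k)) = (sym_power k :: (2 list \<Rightarrow> real) set)"
proof
  show "span (range (tensor_power k)) \<subseteq> (sym_power k :: (2 list \<Rightarrow> real) set)"
    using moment_curve_in_span[of "Suc k" "sym_basis k"]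
    unfolding tensor_power_moment_curve span_sym_basis
    by (intro span_minimal subspace_sym_power) auto
  have "sym_power k = span ((\<lambda>i. moment_curve (Suc k) (sym_basis k) (vector [1, real i])) ` {..<Suc k})"
    unfolding span_sym_basis[symmetric]
    by (rule moment_curve_Lagrange(3)[symmetric])
      (use sym_basis_independent[of k] in \<open>auto simp: det2_standard_points\<close>)
  also have "\<dots> \<subseteq> span (range (tensor_power k))"
    unfolding tensor_power_moment_curve by (intro span_mono) auto
  finally show "(sym_power k :: (2 list \<Rightarrow> real) set) \<subseteq> span (range (tensor_power k))" .
qed

lemma linear_tensor_map: "linear (tensor_map g)"
  by (intro linearI ext)
    (simp_all add: tensor_map_def scaleR_fun_def algebra_simps sum.distrib sum_distrib_left)

lemma sum_lists_prod:
  fixes h :: "nat \<Rightarrow> 'r::finite \<Rightarrow> real"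
  shows "(\<Sum>m | length m = k. \<Prod>i<k. h i (m ! i)) = (\<Prod>i<k. \<Sum>a\<in>UNIV. h i a)"
proof (induction k arbitrary: h)
  case (Suc k)
  have eq: "{m :: 'r list. length m = Suc k} = (\<lambda>(a, m). a # m) ` (UNIV \<times> {m. length m = k})"
    by (auto simp: image_iff length_Suc_conv)
  have "(\<Sum>m | length m = Suc k. \<Prod>i<Suc k. h i (m ! i))
      = (\<Sum>(a, m)\<in>UNIV \<times> {m. length m = k}. h 0 a * (\<Prod>i<k. h (Suc i) (m ! i)))"
    unfolding eq by (subst sum.reindex)
      (auto simp: inj_on_def prod.lessThan_Suc_shift simp del: prod.lessThan_Suc intro!: sum.cong)
  also have "\<dots> = (\<Sum>a\<in>UNIV. h 0 a) * (\<Sum>m | length m = k. \<Prod>i<k. h (Suc i) (m ! i))"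
    by (simp add: sum.cartesian_product[symmetric] sum_product)
  also have "\<dots> = (\<Prod>i<Suc k. \<Sum>a\<in>UNIV. h i a)"
    by (simp only: Suc[of "\<lambda>i. h (Suc i)"] prod.lessThan_Suc_shift[of _ k])
  finally show ?case .
qed simp

lemma tensor_map_tensor_power: "tensor_map g (tensor_power k s) = tensor_power k (g *v s)"
proof
  fix l
  have "tensor_map g (tensor_power k s) l = tensor_power k (g *v s) l" if "length l = k"
  proof -
    have "tensor_map g (tensor_power k s) l
        = (\<Sum>m | length m = k. \<Prod>i<k. g $ (l ! i) $ (m ! i) * s $ (m ! i))"
      using that by (simp add: tensor_map_def tensor_power_def prod.distrib)
    also have "\<dots> = (\<Prod>i<k. \<Sum>a\<in>UNIV. g $ (l ! i) $ a * s $ a)"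
      by (rule sum_lists_prod)
    also have "\<dots> = tensor_power k (g *v s) l"
      using that by (simp add: tensor_power_def matrix_vector_mult_def)
    finally show ?thesis .
  qed
  moreover have "tensor_map g (tensor_power k s) l = tensor_power k (g *v s) l" if "length l \<noteq> k"
    using that by (simp add: tensor_map_def tensor_power_def)
  ultimately show "tensor_map g (tensor_power k s) l = tensor_power k (g *v s) l" by blast
qed

lemma tensor_map_sym_power:
  fixes \<psi> :: "2 list \<Rightarrow> real"
  assumes "\<psi> \<in> sym_power k"
  shows "tensor_map g \<psi> \<in> sym_power k"
    and "tensor_map g (tensor_map h \<psi>) = tensor_map (g ** h) \<psi>"
proof -
  have \<psi>: "\<psi> \<in> span (range (tensor_power k))" using assms by (simp add: span_tensor_powers)
  have "tensor_map g \<psi> \<in> span (tensor_map g ` range (tensor_power k))"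
    using \<psi> linear_span_image[OF linear_tensor_map] by blast
  also have "\<dots> \<subseteq> span (range (tensor_power k))"
    by (intro span_mono) (auto simp: tensor_map_tensor_power)
  finally show "tensor_map g \<psi> \<in> sym_power k" by (simp add: span_tensor_powers)
  have "linear (tensor_map g \<circ> tensor_map h)"
    by (intro linear_compose linear_tensor_map)
  then have "(tensor_map g \<circ> tensor_map h) \<psi> = tensor_map (g ** h) \<psi>"
    by (rule linear_eq_on_span[OF _ linear_tensor_map _ \<psi>])
      (auto simp: tensor_map_tensor_power matrix_vector_mul_assoc)
  then show "tensor_map g (tensor_map h \<psi>) = tensor_map (g ** h) \<psi>" by simp
qed

lemma tensor_map_mat_1:
  fixes \<psi> :: "2 list \<Rightarrow> real"
  assumes "\<psi> \<in> sym_power k"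
  shows "tensor_map (mat 1) \<psi> = \<psi>"
proof -
  have "\<psi> \<in> span (range (tensor_power k))" using assms by (simp add: span_tensor_powers)
  then show ?thesis
    by (rule linear_eq_on_span[OF linear_tensor_map linear_ident, rotated])
      (auto simp: tensor_map_tensor_power)
qed

section \<open>Tangent spaces\<close>

lemma chart_homeomorphic:
  assumes "smooth_manifold X A" "(U, \<phi>) \<in> A"
  shows "openin X U" "open (\<phi> ` U)" "homeomorphic_map (subtopology X U) (top_of_set (\<phi> ` U)) \<phi>"
proof -
  have "\<forall>(U, \<phi>)\<in>A. openin X U \<and> open (\<phi> ` U)
      \<and> homeomorphic_map (subtopology X U) (top_of_set (\<phi> ` U)) \<phi>"
    using assms(1) unfolding smooth_manifold_def by (elim conjE)
  from bspec[OF this assms(2)]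
  show "openin X U" "open (\<phi> ` U)" "homeomorphic_map (subtopology X U) (top_of_set (\<phi> ` U)) \<phi>"
    by simp_all
qed

lemma chart_transition_smooth:
  assumes "smooth_manifold X A" "(U, \<phi>) \<in> A" "(V, \<psi>) \<in> A"
  shows "smooth_on (\<phi> ` (U \<inter> V)) (\<psi> \<circ> inv_into U \<phi>)"
proof -
  have "\<forall>(U, \<phi>)\<in>A. \<forall>(V, \<psi>)\<in>A. smooth_on (\<phi> ` (U \<inter> V)) (\<psi> \<circ> inv_into U \<phi>)"
    using assms(1) unfolding smooth_manifold_def by (elim conjE)
  from bspec[OF this assms(2)] assms(3) show ?thesis by auto
qed

lemma chart_inj_on:
  assumes "smooth_manifold X A" "(U, \<phi>) \<in> A"
  shows "inj_on \<phi> U"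
  using homeomorphic_imp_injective_map[OF chart_homeomorphic(3)[OF assms]]
    openin_subset[OF chart_homeomorphic(1)[OF assms]] by (simp add: Int_absorb1)

lemma chart_openin: "smooth_manifold X A \<Longrightarrow> c \<in> A \<Longrightarrow> openin X (fst c)"
  using chart_homeomorphic(1)[of X A "fst c" "snd c"] by simp

lemma chart_image_open:
  assumes "smooth_manifold X A" "(V, \<phi>) \<in> A" "openin X N"
  shows "open (\<phi> ` (N \<inter> V))"
proof -
  have "openin (subtopology X V) (N \<inter> V)"
    using assms(3) by (auto simp: openin_subtopology)
  then have "openin (top_of_set (\<phi> ` V)) (\<phi> ` (N \<inter> V))"
    using homeomorphic_imp_open_map[OF chart_homeomorphic(3)[OF assms(1,2)]]
    by (simp add: open_map_def)
  then show ?thesis using chart_homeomorphic(2)[OF assms(1,2)] openin_open_trans by blast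
qed

lemma chart_exists:
  assumes "smooth_manifold X A" "p \<in> topspace X"
  obtains c where "c \<in> A" "p \<in> fst c"
proof -
  have "\<Union> (fst ` A) = topspace X"
    using assms(1) unfolding smooth_manifold_def by (elim conjE)
  then show thesis using assms(2) that by blast
qed

lemma transition_has_derivative:
  assumes "smooth_manifold X A" "c \<in> A" "d \<in> A" "p \<in> fst c" "p \<in> fst d"
  shows "((snd d \<circ> inv_into (fst c) (snd c)) has_derivative
    frechet_derivative (snd d \<circ> inv_into (fst c) (snd c)) (at (snd c p))) (at (snd c p))"
proof -
  obtain U \<phi> V \<psi> where cd: "c = (U, \<phi>)" "d = (V, \<psi>)" by (metis prod.exhaust)
  have "smooth_on (\<phi> ` (U \<inter> V)) (\<psi> \<circ> inv_into U \<phi>)"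
    using chart_transition_smooth[OF assms(1)] assms(2,3) cd by simp
  then have "(\<psi> \<circ> inv_into U \<phi>) differentiable (at (\<phi> p))"
    by (rule smooth_on_imp_differentiable) (use assms(4,5) cd in auto)
  then show ?thesis unfolding cd by (simp add: frechet_derivative_works)
qed

text \<open>
  The chain rule for changes of coordinates, which makes the compatibility conditions on tangent
  vectors consistent with each other.
\<close>
lemma transition_derivative_compose:
  assumes "smooth_manifold X A" "b \<in> A" "c \<in> A" "d \<in> A" "p \<in> fst b" "p \<in> fst c" "p \<in> fst d"
  shows "frechet_derivative (snd d \<circ> inv_into (fst b) (snd b)) (at (snd b p)) w
    = frechet_derivative (snd d \<circ> inv_into (fst c) (snd c)) (at (snd c p))
        (frechet_derivative (snd c \<circ> inv_into (fst b) (snd b)) (at (snd b p)) w)"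
proof -
  let ?T = "\<lambda>b c. snd c \<circ> inv_into (fst b) (snd b)"
  let ?D = "\<lambda>b c. frechet_derivative (?T b c) (at (snd b p))"
  have inj: "inj_on (snd b) (fst b)" "inj_on (snd c) (fst c)"
    using chart_inj_on[OF assms(1)] assms(2,3) by (metis prod.collapse)+
  have Tp: "?T b c (snd b p) = snd c p" using inj assms(5) by simp
  have 1: "(?T b c has_derivative ?D b c) (at (snd b p))"
    using transition_has_derivative[OF assms(1)] assms by blast
  have 2: "(?T c d has_derivative ?D c d) (at (?T b c (snd b p)))"
    unfolding Tp using transition_has_derivative[OF assms(1)] assms by blast
  have "(?T c d \<circ> ?T b c has_derivative ?D c d \<circ> ?D b c) (at (snd b p))"
    by (rule diff_chain_at[OF 1 2])
  moreover have "open (snd b ` (fst c \<inter> fst b))"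
    using chart_image_open[OF assms(1) _ chart_openin[OF assms(1,3)], of "fst b" "snd b"] assms(2) by simp
  moreover have "(?T c d \<circ> ?T b c) x = ?T b d x" if "x \<in> snd b ` (fst c \<inter> fst b)" for x
    using that inj by auto
  ultimately have "(?T b d has_derivative ?D c d \<circ> ?D b c) (at (snd b p))"
    using has_derivative_transform_within_open[of "?T c d \<circ> ?T b c" "?D c d \<circ> ?D b c" "snd b p" UNIV
        "snd b ` (fst c \<inter> fst b)" "?T b d"] assms(5,6) by blast
  then have "?D c d \<circ> ?D b c = ?D b d" by (rule frechet_derivative_at)
  then show ?thesis by (metis comp_apply)
qed

lemma coord_vector_in_tangent_space:
  assumes "smooth_manifold X A" "c \<in> A" "p \<in> fst c"
  shows "coord_vector A c p w \<in> tangent_space A p"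
  unfolding tangent_space_def
proof (safe)
  fix U \<phi> V \<psi> assume a: "(U, \<phi>) \<in> A" "(V, \<psi>) \<in> A" "p \<in> U" "p \<in> V"
  then show "coord_vector A c p w (V, \<psi>)
      = frechet_derivative (\<psi> \<circ> inv_into U \<phi>) (at (\<phi> p)) (coord_vector A c p w (U, \<phi>))"
    using transition_derivative_compose[OF assms(1,2) a(1,2) assms(3)] by (simp add: coord_vector_def)
qed (auto simp: coord_vector_def)

lemma coord_vector_self:
  assumes "smooth_manifold X A" "c \<in> A" "p \<in> fst c"
  shows "coord_vector A c p w c = w"
proof -
  have inj: "inj_on (snd c) (fst c)"
    using chart_inj_on[OF assms(1)] assms(2) by (metis prod.collapse)
  have "open (snd c ` (fst c \<inter> fst c))"
    using chart_image_open[OF assms(1) _ chart_openin[OF assms(1,2)], of "fst c" "snd c"] assms(2) by simp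
  then have "(snd c \<circ> inv_into (fst c) (snd c) has_derivative (\<lambda>x. x)) (at (snd c p))"
    by (rule has_derivative_transform_within_open[OF has_derivative_ident]) (use inj assms(3) in auto)
  then have "(\<lambda>x. x) = frechet_derivative (snd c \<circ> inv_into (fst c) (snd c)) (at (snd c p))"
    by (rule frechet_derivative_at)
  then show ?thesis using assms(2,3) unfolding coord_vector_def by (metis (no_types, lifting))
qed

lemma tangent_space_eq_coord_vector:
  fixes A :: "('m, 'e::euclidean_space) chart set"
  assumes "\<xi> \<in> tangent_space A p" "c \<in> A" "p \<in> fst c"
  shows "\<xi> = coord_vector A c p (\<xi> c)"
proof
  fix d :: "('m, 'e) chart"
  obtain U \<phi> V \<psi> where cd: "c = (U, \<phi>)" "d = (V, \<psi>)" by (metis prod.exhaust)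
  show "\<xi> d = coord_vector A c p (\<xi> c) d"
    using assms unfolding tangent_space_def coord_vector_def cd by auto
qed

lemma tangent_space_eqI:
  assumes "\<xi> \<in> tangent_space A p" "\<eta> \<in> tangent_space A p" "c \<in> A" "p \<in> fst c" "\<xi> c = \<eta> c"
  shows "\<xi> = \<eta>"
  using tangent_space_eq_coord_vector assms by metis

lemma subspace_tangent_space:
  assumes "smooth_manifold X A"
  shows "subspace (tangent_space A p)"
proof -
  have lin: "linear (frechet_derivative (\<psi> \<circ> inv_into U \<phi>) (at (\<phi> p)))"
    if "(U, \<phi>) \<in> A" "(V, \<psi>) \<in> A" "p \<in> U" "p \<in> V" for U \<phi> V \<psi>
    using has_derivative_linear[OF transition_has_derivative[OF assms that(1,2), of p]] that by simp
  have D: "\<xi> (V, \<psi>) = frechet_derivative (\<psi> \<circ> inv_into U \<phi>) (at (\<phi> p)) (\<xi> (U, \<phi>))"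
    if "\<xi> \<in> tangent_space A p" "(U, \<phi>) \<in> A" "(V, \<psi>) \<in> A" "p \<in> U" "p \<in> V" for \<xi> U \<phi> V \<psi>
    using that unfolding tangent_space_def by blast
  have Z: "\<xi> c = 0" if "\<xi> \<in> tangent_space A p" "c \<notin> A \<or> p \<notin> fst c" for \<xi> c
    using that unfolding tangent_space_def by blast
  have I: "\<xi> \<in> tangent_space A p"
    if "\<And>U \<phi> V \<psi>. (U, \<phi>) \<in> A \<Longrightarrow> (V, \<psi>) \<in> A \<Longrightarrow> p \<in> U \<Longrightarrow> p \<in> V \<Longrightarrow>
        \<xi> (V, \<psi>) = frechet_derivative (\<psi> \<circ> inv_into U \<phi>) (at (\<phi> p)) (\<xi> (U, \<phi>))"
      "\<And>c. c \<notin> A \<or> p \<notin> fst c \<Longrightarrow> \<xi> c = 0" for \<xi>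
    using that unfolding tangent_space_def by blast
  show ?thesis
  proof (rule subspaceI)
    show "0 \<in> tangent_space A p"
      by (rule I) (simp_all add: linear_0[OF lin])
    fix x y c assume x: "x \<in> tangent_space A p"
    show "c *\<^sub>R x \<in> tangent_space A p"
    proof (rule I)
      fix U \<phi> V \<psi> assume a: "(U, \<phi>) \<in> A" "(V, \<psi>) \<in> A" "p \<in> U" "p \<in> V"
      show "(c *\<^sub>R x) (V, \<psi>) = frechet_derivative (\<psi> \<circ> inv_into U \<phi>) (at (\<phi> p)) ((c *\<^sub>R x) (U, \<phi>))"
        unfolding scaleR_fun_def linear_cmul[OF lin[OF a]] D[OF x a] ..
    qed (simp add: scaleR_fun_def Z[OF x])
    assume y: "y \<in> tangent_space A p"
    show "x + y \<in> tangent_space A p"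
    proof (rule I)
      fix U \<phi> V \<psi> assume a: "(U, \<phi>) \<in> A" "(V, \<psi>) \<in> A" "p \<in> U" "p \<in> V"
      show "(x + y) (V, \<psi>) = frechet_derivative (\<psi> \<circ> inv_into U \<phi>) (at (\<phi> p)) ((x + y) (U, \<phi>))"
        unfolding plus_fun_apply linear_add[OF lin[OF a]] D[OF x a] D[OF y a] ..
    qed (simp add: Z[OF x] Z[OF y])
  qed
qed

lemma chart_component_bij:
  assumes "smooth_manifold X A" "c \<in> A" "p \<in> fst c"
  shows "bij_betw (\<lambda>\<xi>. \<xi> c) (tangent_space A p) UNIV"
proof (intro bij_betw_imageI inj_onI)
  fix x y assume "x \<in> tangent_space A p" "y \<in> tangent_space A p" "x c = y c"
  then show "x = y" using tangent_space_eqI assms(2,3) by metis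
next
  show "(\<lambda>\<xi>. \<xi> c) ` tangent_space A p = UNIV"
    using coord_vector_in_tangent_space[OF assms] coord_vector_self[OF assms] by (metis UNIV_eq_I imageI)
qed

text \<open>
  Passing to the components in one chart turns statements about frames of \<open>TM\<close> into statements about
  frames of a fixed Euclidean space.
\<close>
lemma independent_chart_component:
  fixes A :: "('m, 'e::euclidean_space) chart set"
  assumes "smooth_manifold X A" "c \<in> A" "p \<in> fst c" "f ` I \<subseteq> tangent_space A p"
    "inj_on f I" "independent (f ` I)"
  shows "inj_on (\<lambda>i. f i c) I \<and> independent ((\<lambda>i. f i c) ` I)"
proof -
  have lin: "linear (\<lambda>\<xi> :: ('m, 'e) tangent. \<xi> c)" by (rule linear_apply)
  have "span (f ` I) \<subseteq> tangent_space A p"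
    using assms(4) subspace_tangent_space[OF assms(1)] by (rule span_minimal)
  then have inj: "inj_on (\<lambda>\<xi> :: ('m, 'e) tangent. \<xi> c) (span (f ` I))"
    using chart_component_bij[OF assms(1-3)] by (meson bij_betw_imp_inj_on inj_on_subset)
  then have "independent ((\<lambda>\<xi>. \<xi> c) ` f ` I)"
    using linear_independent_injective_image[OF lin assms(6)] by blast
  moreover have "inj_on ((\<lambda>\<xi>. \<xi> c) \<circ> f) I"
    using assms(5) inj by (meson comp_inj_on inj_on_subset span_superset)
  ultimately show ?thesis by (simp add: image_image o_def)
qed

lemma tangent_space_expand:
  assumes "smooth_manifold X A" "\<xi> \<in> tangent_space A p" "c \<in> A" "p \<in> fst c"
  shows "\<xi> = (\<Sum>e\<in>Basis. (\<xi> c \<bullet> e) *\<^sub>R coord_vector A c p e)"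
proof (rule tangent_space_eqI[OF assms(2) _ assms(3,4)])
  show "(\<Sum>e\<in>Basis. (\<xi> c \<bullet> e) *\<^sub>R coord_vector A c p e) \<in> tangent_space A p"
    by (intro subspace_sum subspace_scale subspace_tangent_space[OF assms(1)]
        coord_vector_in_tangent_space[OF assms(1,3,4)])
  show "\<xi> c = (\<Sum>e\<in>Basis. (\<xi> c \<bullet> e) *\<^sub>R coord_vector A c p e) c"
    by (simp add: sum_fun_apply scaleR_fun_def coord_vector_self[OF assms(1,3,4)] euclidean_representation)
qed

lemma dim_tangent_space:
  fixes A :: "('m, 'e::euclidean_space) chart set"
  assumes "smooth_manifold X A" "p \<in> topspace X"
  shows "dim (tangent_space A p) = DIM('e)"
proof -
  obtain c where c: "c \<in> A" "p \<in> fst c" using chart_exists[OF assms] .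
  let ?b = "coord_vector A c p"
  have bT: "?b ` Basis \<subseteq> tangent_space A p"
    using coord_vector_in_tangent_space[OF assms(1) c] by blast
  have bc: "?b w c = w" for w by (rule coord_vector_self[OF assms(1) c])
  have basis: "inj_on ?b Basis \<and> independent (?b ` Basis)"
  proof (rule independent_if_dual)
    fix i :: 'e assume "i \<in> Basis"
    show "linear (\<lambda>\<xi> :: ('m, 'e) tangent. \<xi> c \<bullet> i)"
      by (intro linearI) (simp_all add: inner_add_left scaleR_fun_def)
    fix j :: 'e assume "j \<in> Basis"
    with \<open>i \<in> Basis\<close> show "?b j c \<bullet> i \<noteq> 0 \<longleftrightarrow> i = j"
      by (auto simp: bc inner_Basis)
  qed
  have "\<xi> \<in> span (?b ` Basis)" if "\<xi> \<in> tangent_space A p" for \<xi>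
    by (subst tangent_space_expand[OF assms(1) that c]) (intro span_sum span_scale span_base, auto)
  then have "tangent_space A p \<subseteq> span (?b ` Basis)" by blast
  from basis_card_eq_dim[OF bT this] basis show ?thesis by (simp add: card_image)
qed

section \<open>Linear isomorphisms between subspaces\<close>

lemma linear_iso_on_sum:
  assumes "linear_iso_on V V' f" "subspace V" "\<And>i. i \<in> I \<Longrightarrow> x i \<in> V"
  shows "f (\<Sum>i\<in>I. a i *\<^sub>R x i) = (\<Sum>i\<in>I. a i *\<^sub>R f (x i))"
  using assms(3)
proof (induction I rule: infinite_finite_induct)
  have add: "f (x + y) = f x + f y" and scale: "f (r *\<^sub>R x) = r *\<^sub>R f x" if "x \<in> V" "y \<in> V" for x y r
    using assms(1) that unfolding linear_iso_on_def by blast+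
  have "f (0 *\<^sub>R 0) = 0 *\<^sub>R f 0" by (rule scale) (rule subspace_0[OF assms(2)])+
  then have f0: "f 0 = 0" by simp
  {
    case (infinite I)
    then show ?case by (simp add: f0)
  next
    case empty
    then show ?case by (simp add: f0)
  next
    case (insert i I)
    have "a i *\<^sub>R x i \<in> V" "x i \<in> V" "(\<Sum>i\<in>I. a i *\<^sub>R x i) \<in> V"
      using insert.prems assms(2) by (auto intro: subspace_sum subspace_scale)
    then show ?case using insert add scale by simp
  }
qed

lemma linear_iso_on_comp:
  assumes "linear_iso_on V V' f" "linear_iso_on V' V'' g"
  shows "linear_iso_on V V'' (\<lambda>x. g (f x))"
proof -
  have f: "bij_betw f V V'" "\<And>x y. x \<in> V \<Longrightarrow> y \<in> V \<Longrightarrow> f (x + y) = f x + f y"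
    "\<And>r x. x \<in> V \<Longrightarrow> f (r *\<^sub>R x) = r *\<^sub>R f x"
    using assms(1) unfolding linear_iso_on_def by blast+
  have g: "bij_betw g V' V''" "\<And>x y. x \<in> V' \<Longrightarrow> y \<in> V' \<Longrightarrow> g (x + y) = g x + g y"
    "\<And>r x. x \<in> V' \<Longrightarrow> g (r *\<^sub>R x) = r *\<^sub>R g x"
    using assms(2) unfolding linear_iso_on_def by blast+
  have "f x \<in> V'" if "x \<in> V" for x using f(1) that bij_betwE by blast
  then show ?thesis
    unfolding linear_iso_on_def using f g bij_betw_trans[OF f(1) g(1)] by (simp add: o_def)
qed

lemma independent_familyI:
  fixes b :: "'i \<Rightarrow> 'a::real_vector"
  assumes "finite I" and zero: "\<And>a i. (\<Sum>i\<in>I. a i *\<^sub>R b i) = 0 \<Longrightarrow> i \<in> I \<Longrightarrow> a i = 0"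
  shows "inj_on b I \<and> independent (b ` I)"
proof
  show inj: "inj_on b I"
  proof (intro inj_onI)
    fix i j assume ij: "i \<in> I" "j \<in> I" "b i = b j"
    show "i = j"
    proof (rule ccontr)
      assume "i \<noteq> j"
      let ?a = "\<lambda>k. if k = i then 1 else if k = j then - 1 else (0::real)"
      have "(\<Sum>k\<in>I. ?a k *\<^sub>R b k) = (\<Sum>k\<in>{i, j}. ?a k *\<^sub>R b k)"
        using ij assms(1) by (intro sum.mono_neutral_right) auto
      also have "\<dots> = 0" using ij \<open>i \<noteq> j\<close> by simp
      finally show False using zero[of ?a i] ij(1) by simp
    qed
  qed
  show "independent (b ` I)"
  proof
    assume "dependent (b ` I)"
    then obtain u i where u: "(\<Sum>v\<in>b ` I. u v *\<^sub>R v) = 0" "i \<in> I" "u (b i) \<noteq> 0"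
      using assms(1) by (auto simp: dependent_finite)
    then have "(\<Sum>i\<in>I. u (b i) *\<^sub>R b i) = 0" by (simp add: sum.reindex[OF inj])
    then show False using zero[of "\<lambda>i. u (b i)" i] u by simp
  qed
qed

text \<open>
  Bases can be pulled back along an isomorphism \<open>f\<close> that is linear on the subspace \<open>V\<close> only: the
  values of \<open>f\<close> elsewhere are arbitrary, so the facts on linear maps of whole spaces do not apply.
\<close>
lemma linear_iso_on_basis:
  assumes f: "linear_iso_on V V' f" and V: "subspace V" and I: "finite I"
    and b: "\<And>i. i \<in> I \<Longrightarrow> b i \<in> V" "\<And>i. i \<in> I \<Longrightarrow> f (b i) = b' i"
    and b': "inj_on b' I" "independent (b' ` I)" "span (b' ` I) = V'"
  shows "inj_on b I \<and> independent (b ` I) \<and> span (b ` I) = V"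
proof -
  have inj: "inj_on f V" and img: "f ` V = V'"
    using f unfolding linear_iso_on_def bij_betw_def by blast+
  have f_sum: "f (\<Sum>i\<in>I. a i *\<^sub>R b i) = (\<Sum>i\<in>I. a i *\<^sub>R b' i)" for a
    using linear_iso_on_sum[OF f V, where I = I and x = b and a = a] b(1) b(2) by simp
  have "f 0 = 0" using linear_iso_on_sum[OF f V, where I = "{}"] by simp
  then have "(\<Sum>i\<in>I. a i *\<^sub>R b' i) = (\<Sum>i\<in>I. 0 *\<^sub>R b' i)" if "(\<Sum>i\<in>I. a i *\<^sub>R b i) = 0" for a
    using f_sum[of a] that by simp
  then have "inj_on b I \<and> independent (b ` I)"
    using independent_coeff_unique[OF I b'(1,2), where b = "\<lambda>_. 0"] by (intro independent_familyI[OF I]) blast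
  moreover have "x \<in> span (b ` I)" if "x \<in> V" for x
  proof -
    have "f x \<in> span (b' ` I)" using that img b'(3) by blast
    then obtain a where "f x = (\<Sum>i\<in>I. a i *\<^sub>R b' i)"
      by (rule in_span_image_obtain[OF I b'(1)]) (rule that)
    then have "f x = f (\<Sum>i\<in>I. a i *\<^sub>R b i)" using f_sum by simp
    moreover have "(\<Sum>i\<in>I. a i *\<^sub>R b i) \<in> V" using b(1) V by (intro subspace_sum subspace_scale)
    ultimately have "x = (\<Sum>i\<in>I. a i *\<^sub>R b i)" using inj that by (simp add: inj_on_def)
    then show ?thesis by (auto intro!: span_sum span_scale intro: span_base)
  qed
  moreover have "span (b ` I) \<subseteq> V" using b(1) V by (intro span_minimal) auto
  ultimately show ?thesis by blast
qed

lemma linear_iso_on_tensor_map: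
  assumes "invertible g"
  shows "linear_iso_on (sym_power k) (sym_power k) (tensor_map (g :: real^2^2))"
proof -
  from assms obtain h where inv: "h ** g = mat 1" "g ** h = mat 1"
    unfolding invertible_def by blast
  have "bij_betw (tensor_map g) (sym_power k) (sym_power k)"
    by (rule bij_betw_byWitness[where f' = "tensor_map h"])
      (auto simp: tensor_map_sym_power inv tensor_map_mat_1)
  then show ?thesis
    unfolding linear_iso_on_def using linear_add[OF linear_tensor_map] linear_cmul[OF linear_tensor_map] by blast
qed

section \<open>Smooth frames of the tangent bundle\<close>

definition smooth_frame ::
    "('m, 'e::euclidean_space) chart set \<Rightarrow> 'm set \<Rightarrow> ('m \<Rightarrow> nat \<Rightarrow> ('m, 'e) tangent) \<Rightarrow> bool" where
  "smooth_frame A N f \<longleftrightarrow>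
     (\<forall>q\<in>N. inj_on (f q) {..<DIM('e)} \<and> independent (f q ` {..<DIM('e)})
        \<and> span (f q ` {..<DIM('e)}) = tangent_space A q)
     \<and> (\<forall>c\<in>A. \<forall>k<DIM('e). smooth_fun A (N \<inter> fst c) (\<lambda>q. f q k c))"

definition moment_image :: "nat \<Rightarrow> (nat \<Rightarrow> 'a::real_vector) \<Rightarrow> 'a set set" where
  "moment_image n b = {span {moment_curve n b z} | z. z \<noteq> 0}"

lemma smooth_frameD:
  fixes f :: "'m \<Rightarrow> nat \<Rightarrow> ('m, 'e::euclidean_space) tangent"
  assumes "smooth_frame A N f"
  shows "q \<in> N \<Longrightarrow> inj_on (f q) {..<DIM('e)}" "q \<in> N \<Longrightarrow> independent (f q ` {..<DIM('e)})"
    "q \<in> N \<Longrightarrow> span (f q ` {..<DIM('e)}) = tangent_space A q"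
    "c \<in> A \<Longrightarrow> k < DIM('e) \<Longrightarrow> smooth_fun A (N \<inter> fst c) (\<lambda>q. f q k c)"
  using assms unfolding smooth_frame_def by blast+

lemma smooth_frame_in_tangent_space:
  fixes f :: "'m \<Rightarrow> nat \<Rightarrow> ('m, 'e::euclidean_space) tangent"
  assumes "smooth_frame A N f" "q \<in> N" "k < DIM('e)"
  shows "f q k \<in> tangent_space A q"
  unfolding smooth_frameD(3)[OF assms(1,2), symmetric] using assms(3) by (intro span_base) simp

lemma moment_curve_in_tangent_space:
  fixes f :: "'m \<Rightarrow> nat \<Rightarrow> ('m, 'e::euclidean_space) tangent"
  assumes "smooth_frame A N f" "q \<in> N"
  shows "moment_curve DIM('e) (f q) z \<in> tangent_space A q"
  using moment_curve_in_span[of "DIM('e)" "f q" z] smooth_frameD(3)[OF assms] by simp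

lemma smooth_frame_chart_component:
  fixes f :: "'m \<Rightarrow> nat \<Rightarrow> ('m, 'e::euclidean_space) tangent"
  assumes "smooth_manifold X A" "smooth_frame A N f" "q \<in> N" "c \<in> A" "q \<in> fst c"
  shows "inj_on (\<lambda>j. f q j c) {..<DIM('e)} \<and> independent ((\<lambda>j. f q j c) ` {..<DIM('e)})"
  using smooth_frame_in_tangent_space[OF assms(2,3)] smooth_frameD(1,2)[OF assms(2,3)]
  by (intro independent_chart_component[OF assms(1,4,5)]) auto

lemma smooth_fun_subset: "smooth_fun A U f \<Longrightarrow> N \<subseteq> U \<Longrightarrow> smooth_fun A N f"
  unfolding smooth_fun_def by (blast intro: smooth_on_subset)

lemma smooth_funD: "smooth_fun A U f \<Longrightarrow> (V, \<phi>) \<in> A \<Longrightarrow> smooth_on (\<phi> ` (U \<inter> V)) (\<lambda>x. f (inv_into V \<phi> x))"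
  unfolding smooth_fun_def o_def by auto

lemma smooth_funI:
  "(\<And>V \<phi>. (V, \<phi>) \<in> A \<Longrightarrow> smooth_on (\<phi> ` (U \<inter> V)) (\<lambda>x. f (inv_into V \<phi> x))) \<Longrightarrow> smooth_fun A U f"
  unfolding smooth_fun_def o_def by auto

lemma inv_chart_in:
  assumes "smooth_manifold X A" "(V, \<phi>) \<in> A" "x \<in> \<phi> ` (U \<inter> V)"
  shows "inv_into V \<phi> x \<in> U \<inter> V"
  using assms(3) chart_inj_on[OF assms(1,2)] by auto

section \<open>From paraconformal structures to frames\<close>

lemma paraconformal_structureD:
  fixes A :: "('m, 'e::euclidean_space) chart set"
  assumes "paraconformal_structure X A W S \<Phi>"
  shows "openin X W" "\<Union> (fst ` S) = W"
    "(U, \<tau>) \<in> S \<Longrightarrow> openin X U" "(U, \<tau>) \<in> S \<Longrightarrow> U \<subseteq> W"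
    "(U, \<tau>) \<in> S \<Longrightarrow> q \<in> U \<Longrightarrow> invertible (\<tau> q)"
    "q \<in> W \<Longrightarrow> linear_iso_on (tangent_space A q) (sym_power (DIM('e) - 1)) (\<Phi> q)"
    "c \<in> A \<Longrightarrow> (U, \<tau>) \<in> S \<Longrightarrow>
      smooth_fun A (U \<inter> fst c) (\<lambda>p. tensor_map (\<tau> p) (\<Phi> p (coord_vector A c p w)) l)"
proof -
  have S: "openin X W" "vector_bundle X A W S"
    and iso: "\<forall>p\<in>W. linear_iso_on (tangent_space A p) (sym_power (DIM('e) - 1)) (\<Phi> p)"
    and smooth: "\<forall>c\<in>A. \<forall>(U, \<tau>)\<in>S. \<forall>w l.
      smooth_fun A (U \<inter> fst c) (\<lambda>p. tensor_map (\<tau> p) (\<Phi> p (coord_vector A c p w)) l)"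
    using assms unfolding paraconformal_structure_def by simp_all
  have triv: "\<forall>(U, \<tau>)\<in>S. openin X U \<and> U \<subseteq> W \<and> (\<forall>p\<in>U. invertible (\<tau> p))"
    and cover: "\<Union> (fst ` S) = W"
    using S(2) unfolding vector_bundle_def by simp_all
  show "openin X W" by (rule S(1))
  show "\<Union> (fst ` S) = W" by (rule cover)
  show "(U, \<tau>) \<in> S \<Longrightarrow> openin X U" "(U, \<tau>) \<in> S \<Longrightarrow> U \<subseteq> W"
    "(U, \<tau>) \<in> S \<Longrightarrow> q \<in> U \<Longrightarrow> invertible (\<tau> q)"
    using triv by auto
  show "q \<in> W \<Longrightarrow> linear_iso_on (tangent_space A q) (sym_power (DIM('e) - 1)) (\<Phi> q)"
    using iso by simp
  assume "c \<in> A" "(U, \<tau>) \<in> S"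
  from bspec[OF bspec[OF smooth this(1)] this(2)]
  show "smooth_fun A (U \<inter> fst c) (\<lambda>p. tensor_map (\<tau> p) (\<Phi> p (coord_vector A c p w)) l)"
    by simp
qed

text \<open>
  Composing \<open>\<Phi>\<close> with the trivialisation gives an isomorphism \<open>\<Psi>\<close> to the symmetric power of \<open>\<real>\<^sup>2\<close>, and the
  frame consists of the preimages of the monomials. The curves agree because a trivialisation acts on
  powers through \<open>s \<mapsto> \<tau> s\<close>, which permutes the non-zero vectors. The components of \<open>\<Psi>\<close> are smooth
  covector fields by assumption, and the frame is dual to them.
\<close>
lemma paraconformal_imp_frame:
  fixes A :: "('m, 'e::euclidean_space) chart set"
  assumes M: "smooth_manifold X A" and para: "paraconformal_structure X A W S \<Phi>" and US: "(U, \<tau>) \<in> S"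
  shows "\<exists>f. smooth_frame A U f \<and> (\<forall>q\<in>U. power_curve A \<Phi> q = moment_image DIM('e) (f q))"
proof -
  define k where "k = DIM('e) - 1"
  have dim: "DIM('e) = Suc k" using DIM_positive[where 'a = 'e] unfolding k_def by linarith
  note D = paraconformal_structureD[OF para, folded k_def]
  have UW: "q \<in> W" if "q \<in> U" for q using D(4)[OF US] that by blast
  define \<Psi> where "\<Psi> q \<xi> = tensor_map (\<tau> q) (\<Phi> q \<xi>)" for q \<xi>
  have iso: "linear_iso_on (tangent_space A q) (sym_power k) (\<Psi> q)" if "q \<in> U" for q
    unfolding \<Psi>_def
    by (rule linear_iso_on_comp[OF D(6)[OF UW[OF that]] linear_iso_on_tensor_map[OF D(5)[OF US that]]])
  have sub: "subspace (tangent_space A q)" for q by (rule subspace_tangent_space[OF M])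
  define f where "f q j = inv_into (tangent_space A q) (\<Psi> q) (sym_basis k j)" for q j
  have bij: "bij_betw (\<Psi> q) (tangent_space A q) (sym_power k)" if "q \<in> U" for q
    using iso[OF that] unfolding linear_iso_on_def by blast
  have sb: "sym_basis k j \<in> sym_power k" if "j \<in> {..<Suc k}" for j
    unfolding span_sym_basis[symmetric] using that by (intro span_base imageI)
  have fT: "f q j \<in> tangent_space A q" and f\<Psi>: "\<Psi> q (f q j) = sym_basis k j"
    if "q \<in> U" "j \<in> {..<Suc k}" for q j
    using bij[OF that(1)] sb[OF that(2)] unfolding f_def bij_betw_def
    by (simp_all add: inv_into_into f_inv_into_f)
  have basis: "inj_on (f q) {..<Suc k} \<and> independent (f q ` {..<Suc k})
      \<and> span (f q ` {..<Suc k}) = tangent_space A q" if "q \<in> U" for q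
    by (rule linear_iso_on_basis[OF iso[OF that] sub finite_lessThan, where b' = "sym_basis k"])
      (use fT[OF that] f\<Psi>[OF that] sym_basis_independent[of k] span_sym_basis[of k] in simp_all)
  have curve: "\<Psi> q (moment_curve (Suc k) (f q) z) = tensor_power k z" if "q \<in> U" for q z
  proof -
    have "\<Psi> q (moment_curve (Suc k) (f q) z)
        = (\<Sum>j<Suc k. (z $ 1 ^ (Suc k - 1 - j) * z $ 2 ^ j) *\<^sub>R \<Psi> q (f q j))"
      unfolding moment_curve_def by (rule linear_iso_on_sum[OF iso[OF that] sub fT[OF that]])
    also have "\<dots> = tensor_power k z"
      unfolding moment_curve_def tensor_power_moment_curve
      by (intro sum.cong) (simp_all add: f\<Psi>[OF that])
    finally show ?thesis .
  qed
  have curveT: "moment_curve (Suc k) (f q) z \<in> tangent_space A q" if "q \<in> U" for q z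
    using moment_curve_in_span[of "Suc k" "f q" z] basis[OF that] by simp
  have "power_curve A \<Phi> q = moment_image (Suc k) (f q)" if q: "q \<in> U" for q
  proof -
    obtain h where h: "\<tau> q ** h = mat 1" "h ** \<tau> q = mat 1"
      using D(5)[OF US q] unfolding invertible_def by blast
    have th: "\<tau> q *v (h *v s) = s" and ht: "h *v (\<tau> q *v s) = s" for s
      using h by (simp_all add: matrix_vector_mul_assoc)
    have \<Phi>\<Psi>: "\<Phi> q \<xi> = tensor_power k s \<longleftrightarrow> \<xi> = moment_curve (Suc k) (f q) (\<tau> q *v s)"
      if "\<xi> \<in> tangent_space A q" for \<xi> s
    proof -
      have inj: "inj_on (tensor_map (\<tau> q)) (sym_power k)"
        using linear_iso_on_tensor_map[OF D(5)[OF US q]] unfolding linear_iso_on_def bij_betw_def by blast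
      have "\<Phi> q \<xi> \<in> sym_power k"
        using D(6)[OF UW[OF q]] that bij_betwE unfolding linear_iso_on_def by blast
      moreover have "tensor_power k s \<in> sym_power k"
        unfolding span_tensor_powers[symmetric] by (intro span_base) simp
      ultimately have "\<Phi> q \<xi> = tensor_power k s \<longleftrightarrow> \<Psi> q \<xi> = tensor_map (\<tau> q) (tensor_power k s)"
        unfolding \<Psi>_def using inj_on_eq_iff[OF inj] by metis
      also have "\<dots> \<longleftrightarrow> \<Psi> q \<xi> = \<Psi> q (moment_curve (Suc k) (f q) (\<tau> q *v s))"
        by (simp add: tensor_map_tensor_power curve[OF q])
      also have "\<dots> \<longleftrightarrow> \<xi> = moment_curve (Suc k) (f q) (\<tau> q *v s)"
        using bij[OF q] that curveT[OF q] by (meson bij_betw_imp_inj_on inj_on_eq_iff)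
      finally show ?thesis .
    qed
    have nz: "\<tau> q *v s \<noteq> 0" "h *v s \<noteq> 0" if "s \<noteq> 0" for s
      using th[of s] ht[of s] that by auto
    show ?thesis
    proof (intro equalityI subsetI)
      fix K assume "K \<in> power_curve A \<Phi> q"
      then obtain \<xi> s where "K = span {\<xi>}" "\<xi> \<in> tangent_space A q" "s \<noteq> 0" "\<Phi> q \<xi> = tensor_power k s"
        unfolding power_curve_def k_def by blast
      then show "K \<in> moment_image (Suc k) (f q)"
        using \<Phi>\<Psi> nz(1) unfolding moment_image_def by auto
    next
      fix K assume "K \<in> moment_image (Suc k) (f q)"
      then obtain z where z: "z \<noteq> 0" "K = span {moment_curve (Suc k) (f q) z}"
        unfolding moment_image_def by blast
      have "\<Phi> q (moment_curve (Suc k) (f q) z) = tensor_power k (h *v z)"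
        using \<Phi>\<Psi>[OF curveT[OF q]] th by simp
      then show "K \<in> power_curve A \<Phi> q"
        using z nz(2)[OF z(1)] curveT[OF q] unfolding power_curve_def k_def by blast
    qed
  qed
  moreover have "smooth_fun A (U \<inter> fst c) (\<lambda>q. f q j c)" if c: "c \<in> A" and j: "j < Suc k" for c j
  proof (rule smooth_funI)
    fix V \<phi> assume V: "(V, \<phi>) \<in> A"
    define \<Omega> where "\<Omega> = \<phi> ` (U \<inter> fst c \<inter> V)"
    have op: "open \<Omega>"
      unfolding \<Omega>_def using D(3)[OF US] chart_openin[OF M c] by (intro chart_image_open[OF M V] openin_Int)
    \<comment> \<open>The covector that sends the coordinates of a vector \<open>\<xi>\<close> to the coefficient of the \<open>i\<close>-th monomial in \<open>\<Psi> \<xi>\<close>.\<close>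
    define r where "r i x = (\<Sum>e\<in>Basis. \<Psi> (inv_into V \<phi> x) (coord_vector A c (inv_into V \<phi> x) e) (sym_index k i) *\<^sub>R e)"
      for i and x :: 'e
    have "smooth_on \<Omega> (r i)" for i
      unfolding r_def \<Omega>_def \<Psi>_def
      by (intro smooth_on_sum smooth_on_scaleR smooth_on_const smooth_funD[OF D(7)[OF c US] V])
    moreover have "r i x \<bullet> f (inv_into V \<phi> x) j c = (if i = j then 1 else 0)"
      if x: "x \<in> \<Omega>" and i: "i < Suc k" and j: "j < Suc k" for x i j
    proof -
      define q where "q = inv_into V \<phi> x"
      have q: "q \<in> U" "q \<in> fst c"
        using inv_chart_in[OF M V, of x "U \<inter> fst c"] x unfolding \<Omega>_def q_def by auto
      have cv: "coord_vector A c q e \<in> tangent_space A q" for e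
        by (rule coord_vector_in_tangent_space[OF M c q(2)])
      have "r i x \<bullet> f q j c = (\<Sum>e\<in>Basis. (f q j c \<bullet> e) * \<Psi> q (coord_vector A c q e) (sym_index k i))"
        unfolding r_def q_def[symmetric] by (simp add: inner_sum_left) (simp add: inner_commute mult.commute)
      also have "\<dots> = (\<Sum>e\<in>Basis. (f q j c \<bullet> e) *\<^sub>R \<Psi> q (coord_vector A c q e)) (sym_index k i)"
        by (simp add: sum_fun_apply scaleR_fun_def)
      also have "\<dots> = \<Psi> q (\<Sum>e\<in>Basis. (f q j c \<bullet> e) *\<^sub>R coord_vector A c q e) (sym_index k i)"
        by (rule fun_cong[OF linear_iso_on_sum[OF iso[OF q(1)] sub cv, symmetric]])
      also have "\<dots> = \<Psi> q (f q j) (sym_index k i)"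
        by (subst tangent_space_expand[OF M fT[OF q(1)] c q(2), of j, symmetric]) (use j in simp_all)
      also have "\<dots> = (if i = j then 1 else 0)"
        using f\<Psi>[OF q(1)] i j by (simp add: sym_basis_sym_index)
      finally show ?thesis unfolding q_def .
    qed
    ultimately show "smooth_on (\<phi> ` (U \<inter> fst c \<inter> V)) (\<lambda>x. f (inv_into V \<phi> x) j c)"
      unfolding \<Omega>_def[symmetric]
      by (intro smooth_dual_frame[where I = "{..<Suc k}" and r = r
            and f = "\<lambda>j x. f (inv_into V \<phi> x) j c"] op)
        (simp_all add: dim j)
  qed
  ultimately have "smooth_frame A U f \<and> (\<forall>q\<in>U. power_curve A \<Phi> q = moment_image DIM('e) (f q))"
    unfolding smooth_frame_def dim using basis by simp
  then show ?thesis by (intro exI[of _ f])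
qed

section \<open>From frames to sub-bundles\<close>

lemma span_moment_curve_image: "span (moment_curve n b ` span {z}) = span {moment_curve n b z}"
proof
  show "span (moment_curve n b ` span {z}) \<subseteq> span {moment_curve n b z}"
    by (intro span_minimal subspace_span)
      (auto simp: span_singleton moment_curve_scaleR)
  show "span {moment_curve n b z} \<subseteq> span (moment_curve n b ` span {z})"
    by (intro span_mono) (auto intro: span_base)
qed

lemma moment_image_bij:
  assumes "inj_on b {..<n}" "independent (b ` {..<n})" "n \<ge> 2"
  shows "bij_betw (\<lambda>K. span (moment_curve n b ` K)) RP1 (moment_image n b)"
proof (rule bij_betw_imageI)
  show "inj_on (\<lambda>K. span (moment_curve n b ` K)) RP1"
  proof (rule inj_onI)
    fix K K' assume "K \<in> RP1" "K' \<in> RP1" and eq: "span (moment_curve n b ` K) = span (moment_curve n b ` K')"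
    then obtain y z where yz: "K = span {y}" "y \<noteq> 0" "K' = span {z}" "z \<noteq> 0"
      unfolding projective_space_def by blast
    from eq have "span {moment_curve n b y} = span {moment_curve n b z}"
      unfolding yz span_moment_curve_image .
    then have "det2 y z = 0" using moment_curve_proportional[OF assms yz(2,4)] by blast
    then show "K = K'" using yz span_vec2_eq_iff by simp
  qed
  show "(\<lambda>K. span (moment_curve n b ` K)) ` RP1 = moment_image n b"
  proof (intro equalityI subsetI)
    fix K assume "K \<in> (\<lambda>K. span (moment_curve n b ` K)) ` RP1"
    then obtain z where "z \<noteq> 0" "K = span (moment_curve n b ` span {z})"
      unfolding projective_space_def by blast
    then show "K \<in> moment_image n b"
      unfolding moment_image_def span_moment_curve_image by blast
  next
    fix K assume "K \<in> moment_image n b"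
    then obtain z where "z \<noteq> 0" "K = span (moment_curve n b ` span {z})"
      unfolding moment_image_def span_moment_curve_image by blast
    then show "K \<in> (\<lambda>K. span (moment_curve n b ` K)) ` RP1"
      unfolding projective_space_def by blast
  qed
qed

lemma smooth_on_moment_coeff: "smooth_on S (\<lambda>z :: real^2. z $ 1 ^ i * z $ 2 ^ j)"
  by (intro smooth_on_mult smooth_on_power smooth_on_bounded_linear bounded_linear_vec_nth)

text \<open>
  Take the form \<open>det(\<cdot>, y) det(\<cdot>, w)\<^sup>n\<^sup>-\<^sup>2\<close> as a linear functional \<open>g\<close> along the curve. It vanishes at \<open>y\<close>, but it has
  a simple zero there, so \<open>g\<close> kills the line through the point and not the derivative in
  direction \<open>w\<close>. On the line \<open>t \<mapsto> y + t w\<close> the form is linear in \<open>t\<close>, which avoids computing the derivative of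
  the curve.
\<close>
lemma moment_curve_immersion:
  fixes b :: "nat \<Rightarrow> 'e::euclidean_space"
  assumes b: "inj_on b {..<n}" "independent (b ` {..<n})" and n: "n \<ge> 2"
    and y: "y \<noteq> 0" and w: "w \<notin> span {y}"
  shows "frechet_derivative (moment_curve n b) (at y) w \<notin> span {moment_curve n b y}"
proof
  let ?V = "moment_curve n b"
  assume "frechet_derivative ?V (at y) w \<in> span {?V y}"
  then obtain r where r: "frechet_derivative ?V (at y) w = r *\<^sub>R ?V y" by (auto simp: span_singleton)
  have "smooth_on UNIV ?V"
    unfolding moment_curve_def by (intro smooth_on_sum smooth_on_scaleR smooth_on_moment_coeff smooth_on_const)
  then have V: "(?V has_derivative frechet_derivative ?V (at y)) (at y)"
    using smooth_on_imp_differentiable frechet_derivative_works by blast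
  have "w \<noteq> 0" using w span_zero by blast
  have dw: "det2 y w \<noteq> 0"
  proof
    assume "det2 y w = 0"
    then have "det2 w y = 0" using det2_commute[of w y] by simp
    then obtain t where "w = t *\<^sub>R y" using det2_eq_0E[OF \<open>w \<noteq> 0\<close> y] by blast
    then show False using w by (simp add: span_base span_scale)
  qed
  obtain m where m: "n = Suc (Suc m)" using n by (metis add_2_eq_Suc le_Suc_ex)
  obtain g :: "'e \<Rightarrow> real" where g: "linear g"
    "\<And>z. g (?V z) = (\<Prod>j<Suc m. det2 z (if j = 0 then y else w))"
    by (rule moment_curve_form_functional[OF b finite_lessThan, where w = "\<lambda>j. if j = 0 then y else w"])
      (simp add: m, rule that)
  have gV: "g (?V z) = det2 z y * det2 z w ^ m" for z
    unfolding g(2) by (simp add: prod.lessThan_Suc_shift del: prod.lessThan_Suc)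
  have "((\<lambda>t. y + t *\<^sub>R w) has_derivative (\<lambda>t. t *\<^sub>R w)) (at (0::real))"
    by (auto intro!: derivative_eq_intros)
  moreover have "(?V has_derivative frechet_derivative ?V (at y)) (at (y + 0 *\<^sub>R w))"
    using V by simp
  ultimately have "((\<lambda>t. ?V (y + t *\<^sub>R w)) has_derivative
      (\<lambda>t. frechet_derivative ?V (at y) (t *\<^sub>R w))) (at (0::real))"
    by (rule has_derivative_compose)
  from bounded_linear.has_derivative[OF linear_conv_bounded_linear[THEN iffD1, OF g(1)] this]
  have "((\<lambda>t. g (?V (y + t *\<^sub>R w))) has_derivative
      (\<lambda>t. g (frechet_derivative ?V (at y) (t *\<^sub>R w)))) (at (0::real))" .
  moreover have "(\<lambda>t. g (?V (y + t *\<^sub>R w))) = (\<lambda>t. t * (det2 w y * det2 y w ^ m))"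
  proof
    fix t :: real
    have "det2 (y + t *\<^sub>R w) x = det2 y x + t * det2 w x" for x
      using det2_linear_comb[of 1 y t w x] by simp
    then show "g (?V (y + t *\<^sub>R w)) = t * (det2 w y * det2 y w ^ m)"
      unfolding gV by simp
  qed
  moreover have "((\<lambda>t. t * (det2 w y * det2 y w ^ m)) has_derivative
      (\<lambda>t. t * (det2 w y * det2 y w ^ m))) (at (0::real))"
    by (auto intro!: derivative_eq_intros)
  ultimately have "(\<lambda>t. g (frechet_derivative ?V (at y) (t *\<^sub>R w))) = (\<lambda>t. t * (det2 w y * det2 y w ^ m))"
    by (metis has_derivative_unique)
  then have "g (r *\<^sub>R ?V y) = det2 w y * det2 y w ^ m"
    using r by (metis mult_1 scaleR_one)
  then have "det2 w y * det2 y w ^ m = 0"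
    using gV[of y] by (simp add: linear_cmul[OF g(1)])
  then show False using dw det2_commute[of w y] by simp
qed

lemma smooth_frame_immersion:
  fixes f :: "'m \<Rightarrow> nat \<Rightarrow> ('m, 'e::euclidean_space) tangent"
  assumes M: "smooth_manifold X A" and f: "smooth_frame A U f" and U: "openin X U" and n: "DIM('e) \<ge> 2"
  shows "smooth_immersion_over X A U (\<lambda>q K. span (moment_curve DIM('e) (f q) ` K))"
  unfolding smooth_immersion_over_def
proof (intro ballI allI impI)
  fix q and z :: "real^2" assume "q \<in> U" "z \<noteq> 0"
  let ?v = "\<lambda>p y. moment_curve DIM('e) (f p) y"
  have "smooth_fun2 A (U \<inter> fst c) (- {0 :: real^2}) (\<lambda>p y. ?v p y c)" if c: "c \<in> A" for c
    unfolding smooth_fun2_def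
  proof (clarify)
    fix V \<phi> assume V: "(V, \<phi>) \<in> A"
    let ?S = "\<phi> ` (U \<inter> fst c \<inter> V)"
    have "smooth_on (?S \<times> (- {0 :: real^2})) (\<lambda>xz. \<Sum>j<DIM('e).
        (snd xz $ 1 ^ (DIM('e) - 1 - j) * snd xz $ 2 ^ j) *\<^sub>R f (inv_into V \<phi> (fst xz)) j c)"
    proof (intro smooth_on_sum smooth_on_scaleR)
      fix j assume "j \<in> {..<DIM('e)}"
      then show "smooth_on (?S \<times> (- {0 :: real^2})) (\<lambda>xz. f (inv_into V \<phi> (fst xz)) j c)"
        using smooth_on_compose_fst[OF smooth_funD[OF smooth_frameD(4)[OF f c] V]] by simp
      show "smooth_on (?S \<times> (- {0 :: real^2})) (\<lambda>xz. snd xz $ 1 ^ (DIM('e) - 1 - j) * snd xz $ 2 ^ j)"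
        by (rule smooth_on_compose_snd[OF smooth_on_moment_coeff])
    qed
    then show "smooth_on (?S \<times> (- {0 :: real^2})) (\<lambda>(x, z). ?v (inv_into V \<phi> x) z c)"
      by (simp add: moment_curve_def sum_fun_apply scaleR_fun_def case_prod_unfold)
  qed
  moreover have "frechet_derivative (\<lambda>y. ?v p y c) (at y) w \<notin> span {?v p y c}"
    if p: "p \<in> U" "p \<in> fst c" and c: "c \<in> A" and y: "y \<noteq> 0" and w: "w \<notin> span {y}" for p y c w
  proof -
    have vc: "?v p y c = moment_curve DIM('e) (\<lambda>j. f p j c) y" for y
      by (simp add: moment_curve_def sum_fun_apply scaleR_fun_def)
    from smooth_frame_chart_component[OF M f p(1) c p(2)]
    show ?thesis unfolding vc by (elim conjE) (rule moment_curve_immersion[OF _ _ n y w])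
  qed
  moreover have "?v p y \<noteq> 0" if "p \<in> U" "y \<noteq> 0" for p y
    using moment_curve_nonzero[OF smooth_frameD(1,2)[OF f that(1)] _ that(2)] n by simp
  moreover have "?v p y \<in> tangent_space A p" if "p \<in> U" for p y
    by (rule moment_curve_in_tangent_space[OF f that])
  ultimately show "\<exists>N Z v. openin X N \<and> q \<in> N \<and> N \<subseteq> U \<and> open Z \<and> z \<in> Z \<and> 0 \<notin> Z \<and>
      (\<forall>c\<in>A. smooth_fun2 A (N \<inter> fst c) Z (\<lambda>p y. v p y c)) \<and>
      (\<forall>p\<in>N. \<forall>y\<in>Z. v p y \<in> tangent_space A p \<and> v p y \<noteq> 0 \<and>
         span (?v p ` span {y}) = span {v p y} \<and>
         (\<forall>c\<in>A. p \<in> fst c \<longrightarrow> (\<forall>w. w \<notin> span {y} \<longrightarrow>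
            frechet_derivative (\<lambda>y. v p y c) (at y) w \<notin> span {v p y c})))"
    unfolding span_moment_curve_image using U \<open>q \<in> U\<close> \<open>z \<noteq> 0\<close>
    by (intro exI[of _ U] exI[of _ "- {0}"] exI[of _ ?v]) (auto simp: open_Compl)
qed

section \<open>From frames to paraconformal structures\<close>

text \<open>
  The coefficients are the inner products with the dual frame, which is smooth.
\<close>
lemma smooth_coefficients:
  fixes b :: "nat \<Rightarrow> 'a::real_normed_vector \<Rightarrow> 'e::euclidean_space"
  assumes S: "open S" and b: "\<And>j. j < DIM('e) \<Longrightarrow> smooth_on S (b j)"
    and ind: "\<And>x. x \<in> S \<Longrightarrow> inj_on (\<lambda>j. b j x) {..<DIM('e)} \<and> independent ((\<lambda>j. b j x) ` {..<DIM('e)})"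
    and h: "smooth_on S h" "\<And>x. x \<in> S \<Longrightarrow> h x = (\<Sum>j<DIM('e). a j x *\<^sub>R b j x)"
    and j: "j < DIM('e)"
  shows "smooth_on S (a j)"
proof -
  have "\<exists>d :: nat \<Rightarrow> 'e. \<forall>i<DIM('e). \<forall>j<DIM('e). b i x \<bullet> d j = (if i = j then 1 else 0)" if x: "x \<in> S" for x
  proof -
    have "\<exists>d :: 'e. \<forall>i<DIM('e). b i x \<bullet> d = (if i = j then 1 else 0)" for j
    proof -
      obtain g :: "'e \<Rightarrow> real" where g: "linear g"
        "\<And>i. i \<in> {..<DIM('e)} \<Longrightarrow> g (b i x) = (if i = j then 1 else 0)"
        by (rule independent_functional[OF conjunct1[OF ind[OF x]] conjunct2[OF ind[OF x]]]) (rule that)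
      have "y \<bullet> adjoint g 1 = g y" for y using adjoint_works[OF g(1), of y 1] by simp
      then show ?thesis using g(2) by (intro exI[of _ "adjoint g 1"]) simp
    qed
    then have "\<exists>d :: nat \<Rightarrow> 'e. \<forall>j. \<forall>i<DIM('e). b i x \<bullet> d j = (if i = j then 1 else 0)"
      by (rule choice[OF allI])
    then obtain d :: "nat \<Rightarrow> 'e" where "\<forall>j. \<forall>i<DIM('e). b i x \<bullet> d j = (if i = j then 1 else 0)" ..
    then show ?thesis by (intro exI[of _ d]) simp
  qed
  then have "\<forall>x\<in>S. \<exists>d :: nat \<Rightarrow> 'e. \<forall>i<DIM('e). \<forall>j<DIM('e). b i x \<bullet> d j = (if i = j then 1 else 0)"
    by blast
  from bchoice[OF this] obtain d :: "'a \<Rightarrow> nat \<Rightarrow> 'e"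
    where d: "\<forall>x\<in>S. \<forall>i<DIM('e). \<forall>j<DIM('e). b i x \<bullet> d x j = (if i = j then 1 else 0)" ..
  have "smooth_on S (\<lambda>x. d x j)"
    by (rule smooth_dual_frame[where I = "{..<DIM('e)}" and r = b and f = "\<lambda>j x. d x j", OF S])
      (use d b j in simp_all)
  then have "smooth_on S (\<lambda>x. h x \<bullet> d x j)"
    by (rule smooth_on_inner[OF h(1)])
  moreover have "h x \<bullet> d x j = a j x" if "x \<in> S" for x
  proof -
    have "h x \<bullet> d x j = (\<Sum>i<DIM('e). a i x * (b i x \<bullet> d x j))"
      by (simp add: h(2)[OF that] inner_sum_left)
    also have "\<dots> = (\<Sum>i<DIM('e). if i = j then a j x else 0)"
      using d that j by (intro sum.cong) auto
    finally show ?thesis using j by simp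
  qed
  ultimately show ?thesis by (rule smooth_on_cong[OF S, rotated])
qed

text \<open>
  The isomorphism maps the frame to the monomials, and \<open>S\<close> is the trivial bundle with a single
  trivialisation. Its components on a coordinate vector field are the coefficients of that field in the
  frame.
\<close>
lemma frame_imp_paraconformal:
  fixes f :: "'m \<Rightarrow> nat \<Rightarrow> ('m, 'e::euclidean_space) tangent"
  assumes M: "smooth_manifold X A" and N: "openin X N" and f: "smooth_frame A N f"
  shows "\<exists>S \<Phi>. paraconformal_structure X A N S \<Phi> \<and> (\<forall>q\<in>N. power_curve A \<Phi> q = moment_image DIM('e) (f q))"
proof -
  define k where "k = DIM('e) - 1"
  have dim: "DIM('e) = Suc k" using DIM_positive[where 'a = 'e] unfolding k_def by linarith
  note F = smooth_frameD[OF f, unfolded dim]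
  \<comment> \<open>Choosing \<open>\<Phi> q\<close> linear on the whole function space makes its linearity on the tangent space immediate.\<close>
  have "\<forall>q\<in>N. \<exists>g :: ('m, 'e) tangent \<Rightarrow> 2 list \<Rightarrow> real.
      linear g \<and> (\<forall>x\<in>f q ` {..<Suc k}. g x = sym_basis k (inv_into {..<Suc k} (f q) x))"
    by (rule ballI) (rule linear_independent_extend[OF F(2)])
  from bchoice[OF this] obtain \<Phi> :: "'m \<Rightarrow> ('m, 'e) tangent \<Rightarrow> 2 list \<Rightarrow> real" where
    \<Phi>: "\<forall>q\<in>N. linear (\<Phi> q) \<and> (\<forall>x\<in>f q ` {..<Suc k}. \<Phi> q x = sym_basis k (inv_into {..<Suc k} (f q) x))" ..
  have lin: "linear (\<Phi> q)" and \<Phi>f: "j < Suc k \<Longrightarrow> \<Phi> q (f q j) = sym_basis k j" if "q \<in> N" for q j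
    using \<Phi> that F(1)[OF that] by auto
  have sb: "inj_on (sym_basis k) {..<Suc k}" "independent (sym_basis k ` {..<Suc k})"
    using sym_basis_independent by blast+
  have iso: "linear_iso_on (tangent_space A q) (sym_power k) (\<Phi> q)" if q: "q \<in> N" for q
  proof -
    have img: "\<Phi> q ` f q ` {..<Suc k} = sym_basis k ` {..<Suc k}"
      unfolding image_image using \<Phi>f[OF q] by (intro image_cong) auto
    have "\<Phi> q ` tangent_space A q = sym_power k"
      unfolding F(3)[OF q, symmetric] linear_span_image[OF lin[OF q], symmetric] img by (rule span_sym_basis)
    moreover have "inj_on (\<Phi> q) (f q ` {..<Suc k})"
    proof (rule inj_onI, elim imageE)
      fix x y i j assume "\<Phi> q x = \<Phi> q y" "x = f q i" "i \<in> {..<Suc k}" "y = f q j" "j \<in> {..<Suc k}"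
      then show "x = y" using \<Phi>f[OF q] inj_onD[OF sb(1), of i j] by simp
    qed
    then have "inj_on (\<Phi> q) (tangent_space A q)"
      unfolding F(3)[OF q, symmetric]
      using linear_inj_on_span_iff_independent_image[OF lin[OF q]] img sb(2) by metis
    ultimately show ?thesis
      unfolding linear_iso_on_def bij_betw_def
      using linear_add[OF lin[OF q]] linear_cmul[OF lin[OF q]] by blast
  qed
  have curve: "\<Phi> q (moment_curve (Suc k) (f q) z) = tensor_power k z" if "q \<in> N" for q z
    unfolding linear_moment_curve[OF lin[OF that]] tensor_power_moment_curve
    unfolding moment_curve_def using \<Phi>f[OF that] by (intro sum.cong) simp_all
  have curveT: "moment_curve (Suc k) (f q) z \<in> tangent_space A q" if "q \<in> N" for q z
    using moment_curve_in_tangent_space[OF f that] by (simp add: dim)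
  have "power_curve A \<Phi> q = moment_image (Suc k) (f q)" if q: "q \<in> N" for q
  proof -
    have iff: "\<Phi> q \<xi> = tensor_power k s \<longleftrightarrow> \<xi> = moment_curve (Suc k) (f q) s"
      if "\<xi> \<in> tangent_space A q" for \<xi> s
      using iso[OF q] curve[OF q, of s] curveT[OF q, of s] that
      unfolding linear_iso_on_def bij_betw_def inj_on_def by metis
    show ?thesis
    proof (intro equalityI subsetI)
      fix K assume "K \<in> power_curve A \<Phi> q"
      then obtain \<xi> s where "K = span {\<xi>}" "\<xi> \<in> tangent_space A q" "s \<noteq> 0" "\<Phi> q \<xi> = tensor_power k s"
        unfolding power_curve_def k_def by blast
      then show "K \<in> moment_image (Suc k) (f q)"
        using iff unfolding moment_image_def by auto
    next
      fix K assume "K \<in> moment_image (Suc k) (f q)"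
      then obtain z where z: "z \<noteq> 0" "K = span {moment_curve (Suc k) (f q) z}"
        unfolding moment_image_def by blast
      then show "K \<in> power_curve A \<Phi> q"
        using curve[OF q, of z] curveT[OF q, of z] unfolding power_curve_def k_def by blast
    qed
  qed
  moreover have "paraconformal_structure X A N {(N, \<lambda>_. mat 1)} \<Phi>"
  proof -
    have "smooth_fun A (N \<inter> fst c) (\<lambda>p. tensor_map (mat 1) (\<Phi> p (coord_vector A c p w)) l)"
      if c: "c \<in> A" for c w l
    proof (rule smooth_funI)
      fix V \<phi> assume V: "(V, \<phi>) \<in> A"
      define \<Omega> where "\<Omega> = \<phi> ` (N \<inter> fst c \<inter> V)"
      define p where "p = inv_into V \<phi>"
      have op: "open \<Omega>"
        unfolding \<Omega>_def using N chart_openin[OF M c] by (intro chart_image_open[OF M V] openin_Int)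
      have pN: "p x \<in> N" "p x \<in> fst c" if "x \<in> \<Omega>" for x
        using inv_chart_in[OF M V, of x "N \<inter> fst c"] that unfolding \<Omega>_def p_def by auto
      have cv: "coord_vector A c (p x) w \<in> tangent_space A (p x)" if "x \<in> \<Omega>" for x
        by (rule coord_vector_in_tangent_space[OF M c pN(2)[OF that]])
      have "\<forall>x\<in>\<Omega>. \<exists>a. coord_vector A c (p x) w = (\<Sum>j<Suc k. a j *\<^sub>R f (p x) j)"
      proof
        fix x assume x: "x \<in> \<Omega>"
        have "coord_vector A c (p x) w \<in> span (f (p x) ` {..<Suc k})"
          using cv[OF x] F(3)[OF pN(1)[OF x]] by simp
        then obtain a where "coord_vector A c (p x) w = (\<Sum>j<Suc k. a j *\<^sub>R f (p x) j)"
          by (rule in_span_image_obtain[OF finite_lessThan F(1)[OF pN(1)[OF x]]]) (rule that)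
        then show "\<exists>a. coord_vector A c (p x) w = (\<Sum>j<Suc k. a j *\<^sub>R f (p x) j)" by (rule exI[of _ a])
      qed
      from bchoice[OF this] obtain a where
        a: "\<forall>x\<in>\<Omega>. coord_vector A c (p x) w = (\<Sum>j<Suc k. a x j *\<^sub>R f (p x) j)" ..
      have "smooth_on \<Omega> (\<lambda>x. a x j)" if "j < Suc k" for j
      proof (rule smooth_coefficients[OF op, where a = "\<lambda>j x. a x j" and j = j])
        show "smooth_on \<Omega> (\<lambda>x. f (p x) j c)" if "j < DIM('e)" for j
          unfolding \<Omega>_def p_def by (rule smooth_funD[OF smooth_frameD(4)[OF f c that] V])
        show "inj_on (\<lambda>j. f (p x) j c) {..<DIM('e)} \<and> independent ((\<lambda>j. f (p x) j c) ` {..<DIM('e)})"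
          if "x \<in> \<Omega>" for x
          by (rule smooth_frame_chart_component[OF M f pN(1)[OF that] c pN(2)[OF that]])
        show "smooth_on \<Omega> (\<lambda>_. w)" by (rule smooth_on_const)
        show "w = (\<Sum>j<DIM('e). a x j *\<^sub>R f (p x) j c)" if "x \<in> \<Omega>" for x
          using fun_cong[OF bspec[OF a that], of c] coord_vector_self[OF M c pN(2)[OF that], of w]
          by (simp add: sum_fun_apply scaleR_fun_def dim)
        show "j < DIM('e)" using that by (simp add: dim)
      qed
      then have "smooth_on \<Omega> (\<lambda>x. \<Sum>j<Suc k. a x j * sym_basis k j l)"
        by (intro smooth_on_sum smooth_on_mult smooth_on_const) simp
      moreover have "(\<Sum>j<Suc k. a x j * sym_basis k j l)
          = tensor_map (mat 1) (\<Phi> (p x) (coord_vector A c (p x) w)) l" if "x \<in> \<Omega>" for x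
      proof -
        have "\<Phi> (p x) (coord_vector A c (p x) w) = (\<Sum>j<Suc k. a x j *\<^sub>R \<Phi> (p x) (f (p x) j))"
          unfolding bspec[OF a that] linear_sum[OF lin[OF pN(1)[OF that]]]
            linear_cmul[OF lin[OF pN(1)[OF that]]] ..
        also have "\<dots> = (\<Sum>j<Suc k. a x j *\<^sub>R sym_basis k j)"
          using \<Phi>f[OF pN(1)[OF that]] by (intro sum.cong) simp_all
        finally have "\<Phi> (p x) (coord_vector A c (p x) w) l = (\<Sum>j<Suc k. a x j * sym_basis k j l)"
          by (simp only: sum_fun_apply scaleR_fun_def real_scaleR_def)
        moreover have "\<Phi> (p x) (coord_vector A c (p x) w) \<in> sym_power k"
          using iso[OF pN(1)[OF that]] cv[OF that] bij_betwE unfolding linear_iso_on_def by blast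
        ultimately show ?thesis by (simp add: tensor_map_mat_1)
      qed
      ultimately have "smooth_on \<Omega> (\<lambda>x. tensor_map (mat 1) (\<Phi> (p x) (coord_vector A c (p x) w)) l)"
        by (rule smooth_on_cong[OF op, rotated])
      then show "smooth_on (\<phi> ` (N \<inter> fst c \<inter> V))
          (\<lambda>x. tensor_map (mat 1) (\<Phi> (inv_into V \<phi> x) (coord_vector A c (inv_into V \<phi> x) w)) l)"
        unfolding \<Omega>_def p_def .
    qed
    moreover have "vector_bundle X A N {(N, \<lambda>_. mat 1 :: real^2^2)}"
      unfolding vector_bundle_def using N
      by (auto simp: invertible_def intro!: smooth_funI smooth_on_const exI[of _ "mat 1"])
    ultimately show ?thesis
      unfolding paraconformal_structure_def k_def[symmetric] using N iso by simp
  qed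
  ultimately show ?thesis unfolding dim by blast
qed

section \<open>From sub-bundles to frames\<close>

lemma moment_curve_scaled_span_eq:
  assumes "det2 y z = 0" "y \<noteq> 0" "z \<noteq> 0"
  shows "span {moment_curve n b y} = span {moment_curve n b z}"
proof -
  obtain t where "t \<noteq> 0" "y = t *\<^sub>R z" using det2_eq_0E[OF assms(2,3,1)] .
  then show ?thesis by (simp add: moment_curve_scaleR span_singleton_scaleR)
qed

text \<open>
  Distinct points of the curve have pairwise independent parameters, whichever rational normal
  parametrisation is used.
\<close>
lemma distinct_points_on_rational_normal_curve:
  fixes u :: "nat \<Rightarrow> 'a::real_vector"
  assumes "rational_normal_curve V K"
    and u: "\<And>i. i < m \<Longrightarrow> u i \<noteq> 0" "\<And>i. i < m \<Longrightarrow> span {u i} \<in> K"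
      "\<And>i j. i < m \<Longrightarrow> j < m \<Longrightarrow> i \<noteq> j \<Longrightarrow> span {u i} \<noteq> span {u j}"
  obtains b z s where "inj_on b {..<dim V}" "independent (b ` {..<dim V})" "span (b ` {..<dim V}) = V"
    "K = moment_image (dim V) b"
    "\<And>i. i < m \<Longrightarrow> u i = s i *\<^sub>R moment_curve (dim V) b (z i)" "\<And>i. i < m \<Longrightarrow> s i \<noteq> 0"
    "\<And>i j. i < m \<Longrightarrow> j < m \<Longrightarrow> i \<noteq> j \<Longrightarrow> det2 (z i) (z j) \<noteq> 0"
proof -
  from assms(1) obtain b where b: "inj_on b {..<dim V} \<and> independent (b ` {..<dim V})
     \<and> span (b ` {..<dim V}) = V \<and> K = {span {moment_curve (dim V) b z} | z. z \<noteq> 0}"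
    unfolding rational_normal_curve_moment ..
  have "\<forall>i\<in>{..<m}. \<exists>zs. fst zs \<noteq> 0 \<and> snd zs \<noteq> 0 \<and> u i = snd zs *\<^sub>R moment_curve (dim V) b (fst zs)"
  proof
    fix i assume "i \<in> {..<m}"
    then have "span {u i} \<in> {span {moment_curve (dim V) b z} | z. z \<noteq> 0}" "u i \<noteq> 0" using u b by auto
    then obtain z where z: "span {u i} = span {moment_curve (dim V) b z}" "z \<noteq> 0" by blast
    obtain s where "s \<noteq> 0" "u i = s *\<^sub>R moment_curve (dim V) b z"
      using span_singleton_eq[OF z(1) \<open>u i \<noteq> 0\<close>] .
    then show "\<exists>zs. fst zs \<noteq> 0 \<and> snd zs \<noteq> 0 \<and> u i = snd zs *\<^sub>R moment_curve (dim V) b (fst zs)"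
      using z(2) by (intro exI[of _ "(z, s)"]) simp
  qed
  from bchoice[OF this] obtain zs where zs: "\<forall>i\<in>{..<m}. fst (zs i) \<noteq> 0 \<and> snd (zs i) \<noteq> 0
    \<and> u i = snd (zs i) *\<^sub>R moment_curve (dim V) b (fst (zs i))" ..
  have span_u: "span {u i} = span {moment_curve (dim V) b (fst (zs i))}" if "i < m" for i
    using zs that span_singleton_scaleR[of "snd (zs i)"] by simp
  show thesis
  proof (rule that[of b "\<lambda>i. snd (zs i)" "\<lambda>i. fst (zs i)"])
    show "det2 (fst (zs i)) (fst (zs j)) \<noteq> 0" if ij: "i < m" "j < m" "i \<noteq> j" for i j
      using moment_curve_scaled_span_eq[of "fst (zs i)" "fst (zs j)" "dim V" b] u(3)[OF ij]
        span_u[OF ij(1)] span_u[OF ij(2)] zs ij by auto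
  qed (use b zs in \<open>simp_all add: moment_image_def\<close>)
qed

text \<open>
  Freezing the parameter \<open>y\<close> in the local lifts of the immersion gives a smooth vector field which spans
  the point of the curve with parameter \<open>y\<close>.
\<close>
lemma curve_subbundle_local_section:
  fixes A :: "('m, 'e::euclidean_space) chart set"
  assumes F: "smooth_immersion_over X A U F" and p: "p \<in> U" and y: "y \<noteq> 0"
  shows "\<exists>N v. openin X N \<and> p \<in> N \<and> N \<subseteq> U \<and> (\<forall>c\<in>A. smooth_fun A (N \<inter> fst c) (\<lambda>q. v q c))
    \<and> (\<forall>q\<in>N. v q \<in> tangent_space A q \<and> v q \<noteq> 0 \<and> F q (span {y}) = span {v q})"
proof -
  from F p y have "\<exists>N Z v.
        openin X N \<and> p \<in> N \<and> N \<subseteq> U \<and> open Z \<and> y \<in> Z \<and> 0 \<notin> Z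
        \<and> (\<forall>c\<in>A. smooth_fun2 A (N \<inter> fst c) Z (\<lambda>p y. v p y c))
        \<and> (\<forall>p\<in>N. \<forall>y\<in>Z. v p y \<in> tangent_space A p \<and> v p y \<noteq> 0 \<and> F p (span {y}) = span {v p y}
             \<and> (\<forall>c\<in>A. p \<in> fst c \<longrightarrow> (\<forall>w. w \<notin> span {y} \<longrightarrow>
                   frechet_derivative (\<lambda>y. v p y c) (at y) w \<notin> span {v p y c})))"
    unfolding smooth_immersion_over_def by simp
  then obtain N Z v where N: "openin X N" "p \<in> N" "N \<subseteq> U" and Z: "y \<in> Z"
    and smooth: "\<forall>c\<in>A. smooth_fun2 A (N \<inter> fst c) Z (\<lambda>p y. v p y c)"
    and v: "\<forall>p\<in>N. \<forall>y\<in>Z. v p y \<in> tangent_space A p \<and> v p y \<noteq> 0 \<and> F p (span {y}) = span {v p y}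
             \<and> (\<forall>c\<in>A. p \<in> fst c \<longrightarrow> (\<forall>w. w \<notin> span {y} \<longrightarrow>
                   frechet_derivative (\<lambda>y. v p y c) (at y) w \<notin> span {v p y c}))"
    by (elim exE conjE) (rule that)
  have "smooth_fun A (N \<inter> fst c) (\<lambda>q. v q y c)" if c: "c \<in> A" for c
  proof (rule smooth_funI)
    fix V \<phi> assume V: "(V, \<phi>) \<in> A"
    have "smooth_on (\<phi> ` (N \<inter> fst c \<inter> V) \<times> Z) (\<lambda>(x, z). v (inv_into V \<phi> x) z c)"
      using bspec[OF bspec[OF smooth c, unfolded smooth_fun2_def] V] by simp
    from smooth_on_slice[OF this Z]
    show "smooth_on (\<phi> ` (N \<inter> fst c \<inter> V)) (\<lambda>x. v (inv_into V \<phi> x) y c)" by simp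
  qed
  moreover have "v q y \<in> tangent_space A q \<and> v q y \<noteq> 0 \<and> F q (span {y}) = span {v q y}" if "q \<in> N" for q
    using bspec[OF bspec[OF v that] Z] by blast
  ultimately show ?thesis
    using N by (intro exI[of _ N] exI[of _ "\<lambda>q. v q y"]) simp
qed

lemma smooth_on_form_coeff:
  assumes "\<And>j. j \<in> J \<Longrightarrow> smooth_on S (\<lambda>x. \<alpha> x j)" "\<And>j. j \<in> J \<Longrightarrow> smooth_on S (\<lambda>x. \<gamma> x j)"
  shows "smooth_on S (\<lambda>x. form_coeff J (\<alpha> x) (\<gamma> x) k)"
  unfolding form_coeff_def
  by (intro smooth_on_sum smooth_on_mult smooth_on_prod assms) auto

text \<open>
  The interpolation points are the values of the smooth parametrisation \<open>F\<close> at the \<open>n + 2\<close> directions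
  \<open>[1 : i]\<close>, which are distinct as \<open>F q\<close> is injective. The interpolation formula then gives
  the frame, and the possibly discontinuous parametrisations \<open>b\<close>, \<open>s\<close>, \<open>z\<close> of the single fibres do
  not occur in it.
\<close>
lemma rnc_subbundle_imp_frame:
  fixes A :: "('m, 'e::euclidean_space) chart set"
  assumes M: "smooth_manifold X A" and C: "rnc_subbundle X A W C" and p: "p \<in> W"
  shows "\<exists>N f. openin X N \<and> p \<in> N \<and> N \<subseteq> W \<and> smooth_frame A N f
    \<and> (\<forall>q\<in>N. C `` {q} = moment_image DIM('e) (f q))"
proof -
  let ?n = "DIM('e)"
  have CS: "curve_subbundle X A W C" and rnc: "\<forall>p\<in>W. rational_normal_curve (tangent_space A p) (C `` {p})"
    using C unfolding rnc_subbundle_def by blast+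
  have W: "openin X W" and loc: "\<forall>p\<in>W. \<exists>U F. openin X U \<and> p \<in> U \<and> U \<subseteq> W
           \<and> smooth_immersion_over X A U F \<and> (\<forall>q\<in>U. bij_betw (F q) RP1 (C `` {q}))"
    using CS unfolding curve_subbundle_def by blast+
  from bspec[OF loc p] obtain U F where U: "openin X U" "p \<in> U" "U \<subseteq> W"
    and F: "smooth_immersion_over X A U F" and bij: "\<forall>q\<in>U. bij_betw (F q) RP1 (C `` {q})"
    by (elim exE conjE) (rule that)
  define y :: "nat \<Rightarrow> real^2" where "y i = vector [1, real i]" for i
  have y0: "y i \<noteq> 0" for i by (simp add: y_def nonzero_vec2)
  have y_span: "span {y i} \<noteq> span {y j}" if "i \<noteq> j" for i j
    using span_vec2_eq_iff[OF y0 y0, of i j] det2_standard_points[of i j] that by (simp add: y_def)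
  have "\<forall>i. \<exists>Nv. openin X (fst Nv) \<and> p \<in> fst Nv \<and> fst Nv \<subseteq> U
      \<and> (\<forall>c\<in>A. smooth_fun A (fst Nv \<inter> fst c) (\<lambda>q. snd Nv q c))
      \<and> (\<forall>q\<in>fst Nv. snd Nv q \<in> tangent_space A q \<and> snd Nv q \<noteq> 0 \<and> F q (span {y i}) = span {snd Nv q})"
  proof
    fix i
    from curve_subbundle_local_section[OF F U(2) y0[of i]] obtain N v where
      "openin X N \<and> p \<in> N \<and> N \<subseteq> U \<and> (\<forall>c\<in>A. smooth_fun A (N \<inter> fst c) (\<lambda>q. v q c))
        \<and> (\<forall>q\<in>N. v q \<in> tangent_space A q \<and> v q \<noteq> 0 \<and> F q (span {y i}) = span {v q})"
      by (elim exE) (rule that)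
    then show "\<exists>Nv. openin X (fst Nv) \<and> p \<in> fst Nv \<and> fst Nv \<subseteq> U
      \<and> (\<forall>c\<in>A. smooth_fun A (fst Nv \<inter> fst c) (\<lambda>q. snd Nv q c))
      \<and> (\<forall>q\<in>fst Nv. snd Nv q \<in> tangent_space A q \<and> snd Nv q \<noteq> 0 \<and> F q (span {y i}) = span {snd Nv q})"
      by (intro exI[of _ "(N, v)"]) simp
  qed
  from choice[OF this] obtain Nv where Nv: "\<forall>i. openin X (fst (Nv i)) \<and> p \<in> fst (Nv i) \<and> fst (Nv i) \<subseteq> U
      \<and> (\<forall>c\<in>A. smooth_fun A (fst (Nv i) \<inter> fst c) (\<lambda>q. snd (Nv i) q c))
      \<and> (\<forall>q\<in>fst (Nv i). snd (Nv i) q \<in> tangent_space A q \<and> snd (Nv i) q \<noteq> 0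
          \<and> F q (span {y i}) = span {snd (Nv i) q})" ..
  define N where "N = (\<Inter>i\<in>{..<?n + 2}. fst (Nv i))"
  define u where "u q i = snd (Nv i) q" for q i
  have N_sub: "N \<subseteq> fst (Nv i)" if "i < ?n + 2" for i unfolding N_def using that by auto
  have N: "openin X N" "p \<in> N" "N \<subseteq> U"
  proof -
    show "openin X N" unfolding N_def using Nv by (intro openin_INT2) auto
    show "p \<in> N" unfolding N_def using Nv by auto
    show "N \<subseteq> U" using N_sub[of 0] Nv by (meson add_pos_pos order_trans zero_less_numeral DIM_positive)
  qed
  have u: "u q i \<in> tangent_space A q" "u q i \<noteq> 0" "F q (span {y i}) = span {u q i}"
    if "q \<in> N" "i < ?n + 2" for q i
    using Nv N_sub[OF that(2)] that(1) unfolding u_def by blast+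
  have u_smooth: "smooth_fun A (N \<inter> fst c) (\<lambda>q. u q i c)" if "c \<in> A" "i < ?n + 2" for c i
  proof (rule smooth_fun_subset)
    show "smooth_fun A (fst (Nv i) \<inter> fst c) (\<lambda>q. u q i c)"
      unfolding u_def using spec[OF Nv, of i] that(1) by simp
    show "N \<inter> fst c \<subseteq> fst (Nv i) \<inter> fst c" using N_sub[OF that(2)] by blast
  qed
  have dimT: "dim (tangent_space A q) = ?n" if "q \<in> N" for q
    using dim_tangent_space[OF M] openin_subset[OF N(1)] that by blast
  \<comment> \<open>A rational normal parametrisation of the fibre over \<open>q\<close>, with its parameters for the chosen points.\<close>
  define good where "good q b s z \<longleftrightarrow> inj_on b {..<?n} \<and> independent (b ` {..<?n})
      \<and> span (b ` {..<?n}) = tangent_space A q \<and> C `` {q} = moment_image ?n b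
      \<and> (\<forall>i<?n + 2. u q i = s i *\<^sub>R moment_curve ?n b (z i)) \<and> (\<forall>i<?n + 2. s i \<noteq> 0)
      \<and> (\<forall>i<?n + 2. \<forall>j<?n + 2. i \<noteq> j \<longrightarrow> det2 (z i) (z j) \<noteq> 0)"
    for q and b :: "nat \<Rightarrow> ('m, 'e) tangent" and s :: "nat \<Rightarrow> real" and z :: "nat \<Rightarrow> real^2"
  have good: "\<exists>b s z. good q b s z" if q: "q \<in> N" for q
  proof -
    have qU: "q \<in> U" "q \<in> W" using q N(3) U(3) by blast+
    have RP: "span {y i} \<in> RP1" for i using y0 unfolding projective_space_def by blast
    have inj: "inj_on (F q) RP1" and img: "F q ` RP1 = C `` {q}"
      using bspec[OF bij qU(1)] unfolding bij_betw_def by blast+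
    have on: "span {u q i} \<in> C `` {q}" if "i < ?n + 2" for i
      using u(3)[OF q that] img RP[of i] by blast
    have ne: "span {u q i} \<noteq> span {u q j}" if "i < ?n + 2" "j < ?n + 2" "i \<noteq> j" for i j
      using u(3)[OF q that(1)] u(3)[OF q that(2)] inj_onD[OF inj _ RP RP, of i j] y_span[OF that(3)] by metis
    obtain b z s where "inj_on b {..<dim (tangent_space A q)}" "independent (b ` {..<dim (tangent_space A q)})"
      "span (b ` {..<dim (tangent_space A q)}) = tangent_space A q"
      "C `` {q} = moment_image (dim (tangent_space A q)) b"
      "\<And>i. i < ?n + 2 \<Longrightarrow> u q i = s i *\<^sub>R moment_curve (dim (tangent_space A q)) b (z i)"
      "\<And>i. i < ?n + 2 \<Longrightarrow> s i \<noteq> 0"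
      "\<And>i j. i < ?n + 2 \<Longrightarrow> j < ?n + 2 \<Longrightarrow> i \<noteq> j \<Longrightarrow> det2 (z i) (z j) \<noteq> 0"
      by (rule distinct_points_on_rational_normal_curve[OF bspec[OF rnc qU(2)] u(2)[OF q] on ne])
        (assumption+, rule that)
    then have "good q b s z" unfolding good_def dimT[OF q] by blast
    then show ?thesis by (intro exI)
  qed
  have n0: "?n > 0" by simp
  have interp: "inj_on (u q) {..<?n} \<and> independent (u q ` {..<?n}) \<and> span (u q ` {..<?n}) = tangent_space A q
    \<and> (\<forall>a c. u q ?n = (\<Sum>i<?n. a i *\<^sub>R u q i) \<longrightarrow> u q (Suc ?n) = (\<Sum>i<?n. c i *\<^sub>R u q i) \<longrightarrow>
        (\<forall>i<?n. a i \<noteq> 0 \<and> c i \<noteq> 0) \<and>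
        (let f = interpolation_frame ?n (\<lambda>i. inverse (a i)) (\<lambda>i. inverse (c i)) (u q) in
          inj_on f {..<?n} \<and> independent (f ` {..<?n}) \<and> span (f ` {..<?n}) = tangent_space A q \<and>
          moment_image ?n f = C `` {q}))" if "q \<in> N" for q
  proof -
    from good[OF that] obtain b s z where g: "good q b s z" by (elim exE) (rule that)
    have b: "inj_on b {..<?n}" "independent (b ` {..<?n})" "span (b ` {..<?n}) = tangent_space A q"
      "C `` {q} = moment_image ?n b"
      and us: "\<And>i. i < ?n + 2 \<Longrightarrow> u q i = s i *\<^sub>R moment_curve ?n b (z i)" "\<And>i. i < ?n + 2 \<Longrightarrow> s i \<noteq> 0"
      and z: "\<And>i j. i < ?n + 2 \<Longrightarrow> j < ?n + 2 \<Longrightarrow> i \<noteq> j \<Longrightarrow> det2 (z i) (z j) \<noteq> 0"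
      using g unfolding good_def by simp_all
    note R = rational_normal_curve_interpolation[OF n0 b(1,2), where u = "u q" and s = s and z = z,
        OF us z, unfolded b(3) moment_image_def[symmetric] b(4)[symmetric]]
    show ?thesis using R by blast
  qed
  have coeff: "\<forall>q\<in>N. \<exists>a. u q i = (\<Sum>j<?n. a j *\<^sub>R u q j)" if i: "i < ?n + 2" for i
  proof
    fix q assume q: "q \<in> N"
    have "inj_on (u q) {..<?n}" "u q i \<in> span (u q ` {..<?n})"
      using interp[OF q] u(1)[OF q i] by simp_all
    then obtain a where "u q i = (\<Sum>j<?n. a j *\<^sub>R u q j)"
      by (rule in_span_image_obtain[OF finite_lessThan]) (rule that)
    then show "\<exists>a. u q i = (\<Sum>j<?n. a j *\<^sub>R u q j)" by (rule exI[of _ a])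
  qed
  have "?n < ?n + 2" "Suc ?n < ?n + 2" by simp_all
  from bchoice[OF coeff[OF this(1)]] bchoice[OF coeff[OF this(2)]] obtain a c where
    a: "\<forall>q\<in>N. u q ?n = (\<Sum>j<?n. a q j *\<^sub>R u q j)" and c: "\<forall>q\<in>N. u q (Suc ?n) = (\<Sum>j<?n. c q j *\<^sub>R u q j)"
    by (elim exE) (rule that)
  define f where "f q = interpolation_frame ?n (\<lambda>i. inverse (a q i)) (\<lambda>i. inverse (c q i)) (u q)" for q
  have nz: "a q i \<noteq> 0" "c q i \<noteq> 0" if "q \<in> N" "i < ?n" for q i
    using interp[OF that(1)] a c that by blast+
  have f: "inj_on (f q) {..<?n} \<and> independent (f q ` {..<?n}) \<and> span (f q ` {..<?n}) = tangent_space A q \<and>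
      moment_image ?n (f q) = C `` {q}" if "q \<in> N" for q
    using interp[OF that] a c that unfolding f_def Let_def by blast
  have "smooth_fun A (N \<inter> fst d) (\<lambda>q. f q k d)" if d: "d \<in> A" for d k
  proof (rule smooth_funI)
    fix V \<phi> assume V: "(V, \<phi>) \<in> A"
    define \<Omega> where "\<Omega> = \<phi> ` (N \<inter> fst d \<inter> V)"
    define r where "r = inv_into V \<phi>"
    have op: "open \<Omega>"
      unfolding \<Omega>_def using N(1) chart_openin[OF M d] by (intro chart_image_open[OF M V] openin_Int)
    have rN: "r x \<in> N" "r x \<in> fst d" if "x \<in> \<Omega>" for x
      using inv_chart_in[OF M V, of x "N \<inter> fst d"] that unfolding \<Omega>_def r_def by auto
    have us: "smooth_on \<Omega> (\<lambda>x. u (r x) i d)" if "i < ?n + 2" for i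
      unfolding \<Omega>_def r_def by (rule smooth_funD[OF u_smooth[OF d that] V])
    \<comment> \<open>The coordinates \<open>a\<close> and \<open>c\<close> do not depend on a chart, but they can be computed in any.\<close>
    have coeff_smooth: "smooth_on \<Omega> (\<lambda>x. e (r x) j)"
      if e: "\<forall>q\<in>N. u q i = (\<Sum>j<?n. e q j *\<^sub>R u q j)" and i: "i < ?n + 2" and j: "j < ?n" for e i j
    proof (rule smooth_coefficients[OF op, where a = "\<lambda>j x. e (r x) j" and j = j])
      show "smooth_on \<Omega> (\<lambda>x. u (r x) j d)" if "j < ?n" for j
        by (rule us) (use that in simp)
      show "inj_on (\<lambda>j. u (r x) j d) {..<?n} \<and> independent ((\<lambda>j. u (r x) j d) ` {..<?n})"
        if "x \<in> \<Omega>" for x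
        using interp[OF rN(1)[OF that]] u(1)[OF rN(1)[OF that]]
        by (intro independent_chart_component[OF M d rN(2)[OF that]]) auto
      show "smooth_on \<Omega> (\<lambda>x. u (r x) i d)" by (rule us[OF i])
      show "u (r x) i d = (\<Sum>j<?n. e (r x) j *\<^sub>R u (r x) j d)" if "x \<in> \<Omega>" for x
        using fun_cong[OF bspec[OF e rN(1)[OF that]], of d] by (simp add: sum_fun_apply scaleR_fun_def)
    qed (rule j)
    have "smooth_on \<Omega> (\<lambda>x. \<Sum>i<?n. form_coeff ({..<?n} - {i}) (\<lambda>i. inverse (a (r x) i))
        (\<lambda>i. inverse (c (r x) i)) k *\<^sub>R u (r x) i d)"
    proof (intro smooth_on_sum smooth_on_scaleR smooth_on_form_coeff)
      fix i j assume "i \<in> {..<?n}" "j \<in> {..<?n} - {i}"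
      then have j: "j < ?n" by simp
      show "smooth_on \<Omega> (\<lambda>x. inverse (a (r x) j))"
        by (rule smooth_on_inverse[OF _ coeff_smooth[OF a _ j]]) (use nz(1)[OF rN(1) j] in auto)
      show "smooth_on \<Omega> (\<lambda>x. inverse (c (r x) j))"
        by (rule smooth_on_inverse[OF _ coeff_smooth[OF c _ j]]) (use nz(2)[OF rN(1) j] in auto)
    next
      fix i assume "i \<in> {..<?n}"
      then show "smooth_on \<Omega> (\<lambda>x. u (r x) i d)" by (intro us) simp
    qed
    then show "smooth_on (\<phi> ` (N \<inter> fst d \<inter> V)) (\<lambda>x. f (inv_into V \<phi> x) k d)"
      unfolding f_def interpolation_frame_def \<Omega>_def r_def by (simp add: sum_fun_apply scaleR_fun_def)
  qed
  then have "smooth_frame A N f" unfolding smooth_frame_def using f by simp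
  then show ?thesis using N U(3) f by (intro exI[of _ N] exI[of _ f]) auto
qed

section \<open>The equivalence\<close>

text \<open>
  The common description of both structures.
\<close>
definition locally_framed ::
    "'m topology \<Rightarrow> ('m, 'e::euclidean_space) chart set \<Rightarrow> 'm set
       \<Rightarrow> ('m \<times> ('m, 'e) tangent set) set \<Rightarrow> bool" where
  "locally_framed X A W C \<longleftrightarrow> (\<forall>p\<in>W. \<exists>N f. openin X N \<and> p \<in> N \<and> N \<subseteq> W \<and> smooth_frame A N f
     \<and> (\<forall>q\<in>N. C `` {q} = moment_image DIM('e) (f q)))"

lemma locally_framedE:
  fixes A :: "('m, 'e::euclidean_space) chart set"
  assumes "locally_framed X A W C" "p \<in> W"
  obtains N f where "openin X N" "p \<in> N" "N \<subseteq> W" "smooth_frame A N f"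
    "\<And>q. q \<in> N \<Longrightarrow> C `` {q} = moment_image DIM('e) (f q)"
proof -
  from bspec[OF assms(1)[unfolded locally_framed_def] assms(2)] obtain N f where
    "openin X N \<and> p \<in> N \<and> N \<subseteq> W \<and> smooth_frame A N f
      \<and> (\<forall>q\<in>N. C `` {q} = moment_image DIM('e) (f q))"
    by (elim exE) (rule that)
  then show thesis by (intro that[of N f]) simp_all
qed

lemma moment_image_projective:
  fixes f :: "'m \<Rightarrow> nat \<Rightarrow> ('m, 'e::euclidean_space) tangent"
  assumes "smooth_frame A N f" "q \<in> N"
  shows "moment_image DIM('e) (f q) \<subseteq> projective_space (tangent_space A q)"
proof
  fix K assume "K \<in> moment_image DIM('e) (f q)"
  then obtain z where "z \<noteq> 0" "K = span {moment_curve DIM('e) (f q) z}"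
    unfolding moment_image_def by blast
  then show "K \<in> projective_space (tangent_space A q)"
    using moment_curve_nonzero[OF smooth_frameD(1,2)[OF assms]] moment_curve_in_tangent_space[OF assms]
    unfolding projective_space_def by auto
qed

lemma rnc_subbundle_iff_locally_framed:
  fixes A :: "('m, 'e::euclidean_space) chart set"
  assumes M: "smooth_manifold X A" and n: "DIM('e) \<ge> 2" and W: "openin X W"
    and C: "C \<subseteq> projective_tangent_bundle A W"
  shows "rnc_subbundle X A W C \<longleftrightarrow> locally_framed X A W C"
proof
  assume "rnc_subbundle X A W C"
  then show "locally_framed X A W C"
    unfolding locally_framed_def using rnc_subbundle_imp_frame[OF M] by simp
next
  assume L: "locally_framed X A W C"
  have "\<exists>U F. openin X U \<and> p \<in> U \<and> U \<subseteq> W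
           \<and> smooth_immersion_over X A U F \<and> (\<forall>q\<in>U. bij_betw (F q) RP1 (C `` {q}))" if p: "p \<in> W" for p
  proof -
    obtain N f where N: "openin X N" "p \<in> N" "N \<subseteq> W" and f: "smooth_frame A N f"
      "\<And>q. q \<in> N \<Longrightarrow> C `` {q} = moment_image DIM('e) (f q)"
      by (rule locally_framedE[OF L p]) (rule that)
    have "bij_betw (\<lambda>K. span (moment_curve DIM('e) (f q) ` K)) RP1 (C `` {q})" if "q \<in> N" for q
      unfolding f(2)[OF that] by (rule moment_image_bij[OF smooth_frameD(1,2)[OF f(1) that] n])
    then show ?thesis
      using N smooth_frame_immersion[OF M f(1) N(1) n]
      by (intro exI[of _ N] exI[of _ "\<lambda>q K. span (moment_curve DIM('e) (f q) ` K)"]) simp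
  qed
  moreover have "rational_normal_curve (tangent_space A p) (C `` {p})" if p: "p \<in> W" for p
  proof -
    obtain N f where N: "openin X N" "p \<in> N" "N \<subseteq> W" and f: "smooth_frame A N f"
      "\<And>q. q \<in> N \<Longrightarrow> C `` {q} = moment_image DIM('e) (f q)"
      by (rule locally_framedE[OF L p]) (rule that)
    have "dim (tangent_space A p) = DIM('e)"
      using dim_tangent_space[OF M] openin_subset[OF N(1)] N(2) by blast
    then show ?thesis
      unfolding rational_normal_curve_moment f(2)[OF N(2)] moment_image_def
      using smooth_frameD(1-3)[OF f(1) N(2)] by (intro exI[of _ "f p"]) simp
  qed
  ultimately show "rnc_subbundle X A W C"
    unfolding rnc_subbundle_def curve_subbundle_def using W C by simp
qed

lemma locally_framed_imp_paraconformal: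
  fixes A :: "('m, 'e::euclidean_space) chart set"
  assumes M: "smooth_manifold X A" and C: "locally_framed X A W C" and p: "p \<in> W"
  shows "\<exists>U. p \<in> U \<and> (\<exists>S \<Phi>. paraconformal_structure X A U S \<Phi> \<and> (\<forall>q\<in>U. C `` {q} = power_curve A \<Phi> q))"
proof -
  obtain N f where N: "openin X N" "p \<in> N" "N \<subseteq> W" and f: "smooth_frame A N f"
    "\<And>q. q \<in> N \<Longrightarrow> C `` {q} = moment_image DIM('e) (f q)"
    by (rule locally_framedE[OF C p]) (rule that)
  from frame_imp_paraconformal[OF M N(1) f(1)] obtain S \<Phi> where
    "paraconformal_structure X A N S \<Phi> \<and> (\<forall>q\<in>N. power_curve A \<Phi> q = moment_image DIM('e) (f q))"
    by (elim exE) (rule that)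
  then show ?thesis using N(2) f(2) by (intro exI[of _ N] exI[of _ S] exI[of _ \<Phi>] conjI) simp_all
qed

lemma paraconformal_imp_local_frame:
  fixes A :: "('m, 'e::euclidean_space) chart set"
  assumes M: "smooth_manifold X A" and para: "paraconformal_structure X A U S \<Phi>" and p: "p \<in> U"
  obtains N f where "openin X N" "p \<in> N" "N \<subseteq> U" "smooth_frame A N f"
    "\<And>q. q \<in> N \<Longrightarrow> power_curve A \<Phi> q = moment_image DIM('e) (f q)"
proof -
  have "p \<in> \<Union> (fst ` S)" using paraconformal_structureD(2)[OF para] p by simp
  then obtain N \<tau> where N: "(N, \<tau>) \<in> S" "p \<in> N" by force
  from paraconformal_imp_frame[OF M para N(1)] obtain f where
    "smooth_frame A N f \<and> (\<forall>q\<in>N. power_curve A \<Phi> q = moment_image DIM('e) (f q))"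
    by (elim exE) (rule that)
  then show thesis
    using paraconformal_structureD(3,4)[OF para N(1)] N(2) by (intro that[of N f]) simp_all
qed

lemma paraconformal_imp_locally_framed:
  fixes A :: "('m, 'e::euclidean_space) chart set"
  assumes M: "smooth_manifold X A"
    and para: "\<forall>p\<in>W. \<exists>U. p \<in> U \<and> U \<subseteq> W \<and> (\<exists>S \<Phi>. paraconformal_structure X A U S \<Phi>
      \<and> (\<forall>q\<in>U. C `` {q} = power_curve A \<Phi> q))"
  shows "locally_framed X A W C"
  unfolding locally_framed_def
proof
  fix p assume "p \<in> W"
  from bspec[OF para this] obtain U S \<Phi> where U: "p \<in> U" "U \<subseteq> W"
    "paraconformal_structure X A U S \<Phi>" "\<forall>q\<in>U. C `` {q} = power_curve A \<Phi> q"
    by (elim exE conjE) (rule that)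
  obtain N f where N: "openin X N" "p \<in> N" "N \<subseteq> U" "smooth_frame A N f"
    "\<And>q. q \<in> N \<Longrightarrow> power_curve A \<Phi> q = moment_image DIM('e) (f q)"
    by (rule paraconformal_imp_local_frame[OF M U(3,1)]) (rule that)
  have "C `` {q} = moment_image DIM('e) (f q)" if "q \<in> N" for q
    using U(4) N(5)[OF that] N(3) that by blast
  then show "\<exists>N f. openin X N \<and> p \<in> N \<and> N \<subseteq> W \<and> smooth_frame A N f
     \<and> (\<forall>q\<in>N. C `` {q} = moment_image DIM('e) (f q))"
    using N(1-4) U(2) by (intro exI[of _ N] exI[of _ f]) auto
qed

theorem lemma3p4:
  fixes X :: "'m topology" and A :: "('m, 'e::euclidean_space) chart set"
  assumes "smooth_manifold X A" and "DIM('e) \<ge> 2"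
  shows "((\<forall>p\<in>topspace X. \<exists>U. p \<in> U \<and> (\<exists>S \<Phi>. paraconformal_structure X A U S \<Phi>))
            \<longleftrightarrow> (\<forall>p\<in>topspace X. \<exists>U. p \<in> U \<and> (\<exists>C. rnc_subbundle X A U C)))
         \<and> (\<forall>C \<subseteq> projective_tangent_bundle A (topspace X).
              (\<forall>p\<in>topspace X. \<exists>U. p \<in> U \<and> (\<exists>S \<Phi>. paraconformal_structure X A U S \<Phi>
                    \<and> (\<forall>q\<in>U. C `` {q} = power_curve A \<Phi> q)))
              \<longleftrightarrow> rnc_subbundle X A (topspace X) C)"
proof (intro conjI iffI allI impI ballI)
  fix p
  assume "\<forall>p\<in>topspace X. \<exists>U. p \<in> U \<and> (\<exists>S \<Phi>. paraconformal_structure X A U S \<Phi>)" and "p \<in> topspace X"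
  from bspec[OF this] obtain U S \<Phi> where U: "p \<in> U" and para: "paraconformal_structure X A U S \<Phi>"
    by (elim exE conjE) (rule that)
  define C where "C = (SIGMA q:U. power_curve A \<Phi> q)"
  have Cq: "\<forall>q\<in>U. C `` {q} = power_curve A \<Phi> q" unfolding C_def by auto
  have "power_curve A \<Phi> q \<subseteq> projective_space (tangent_space A q)" if q: "q \<in> U" for q
  proof -
    obtain N f where "q \<in> N" "smooth_frame A N f"
      "\<And>q. q \<in> N \<Longrightarrow> power_curve A \<Phi> q = moment_image DIM('e) (f q)"
      by (rule paraconformal_imp_local_frame[OF assms(1) para q]) (rule that)
    then show ?thesis using moment_image_projective[of A N f q] by simp
  qed
  then have "C \<subseteq> projective_tangent_bundle A U"
    unfolding C_def projective_tangent_bundle_def by blast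
  moreover have "locally_framed X A U C"
    by (rule paraconformal_imp_locally_framed[OF assms(1)])
      (intro ballI exI[of _ U] exI[of _ S] exI[of _ \<Phi>] conjI para Cq, simp_all)
  ultimately have "rnc_subbundle X A U C"
    using rnc_subbundle_iff_locally_framed[OF assms paraconformal_structureD(1)[OF para]] by simp
  then show "\<exists>U. p \<in> U \<and> (\<exists>C. rnc_subbundle X A U C)" using U by blast
next
  fix p
  assume "\<forall>p\<in>topspace X. \<exists>U. p \<in> U \<and> (\<exists>C. rnc_subbundle X A U C)" and "p \<in> topspace X"
  from bspec[OF this] obtain U C where U: "p \<in> U" and C: "rnc_subbundle X A U C"
    by (elim exE conjE) (rule that)
  have "openin X U" "C \<subseteq> projective_tangent_bundle A U"
    using C unfolding rnc_subbundle_def curve_subbundle_def by blast+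
  then have "locally_framed X A U C"
    using rnc_subbundle_iff_locally_framed[OF assms] C by simp
  from locally_framed_imp_paraconformal[OF assms(1) this U]
  show "\<exists>U. p \<in> U \<and> (\<exists>S \<Phi>. paraconformal_structure X A U S \<Phi>)" by blast
next
  fix C
  assume C: "C \<subseteq> projective_tangent_bundle A (topspace X)"
    and para: "\<forall>p\<in>topspace X. \<exists>U. p \<in> U \<and> (\<exists>S \<Phi>. paraconformal_structure X A U S \<Phi>
      \<and> (\<forall>q\<in>U. C `` {q} = power_curve A \<Phi> q))"
  have "locally_framed X A (topspace X) C"
  proof (rule paraconformal_imp_locally_framed[OF assms(1)], rule ballI)
    fix p assume "p \<in> topspace X"
    from bspec[OF para this] obtain U S \<Phi> where U: "p \<in> U" "paraconformal_structure X A U S \<Phi>"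
      "\<forall>q\<in>U. C `` {q} = power_curve A \<Phi> q"
      by (elim exE conjE) (rule that)
    moreover have "U \<subseteq> topspace X"
      by (rule openin_subset[OF paraconformal_structureD(1)[OF U(2)]])
    ultimately show "\<exists>U. p \<in> U \<and> U \<subseteq> topspace X \<and> (\<exists>S \<Phi>. paraconformal_structure X A U S \<Phi>
        \<and> (\<forall>q\<in>U. C `` {q} = power_curve A \<Phi> q))"
      by (intro exI[of _ U] exI[of _ S] exI[of _ \<Phi>] conjI)
  qed
  then show "rnc_subbundle X A (topspace X) C"
    using rnc_subbundle_iff_locally_framed[OF assms openin_topspace C] by simp
next
  fix C p
  assume "C \<subseteq> projective_tangent_bundle A (topspace X)" "rnc_subbundle X A (topspace X) C"
  then have "locally_framed X A (topspace X) C"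
    using rnc_subbundle_iff_locally_framed[OF assms openin_topspace] by simp
  moreover assume "p \<in> topspace X"
  ultimately show "\<exists>U. p \<in> U \<and> (\<exists>S \<Phi>. paraconformal_structure X A U S \<Phi>
      \<and> (\<forall>q\<in>U. C `` {q} = power_curve A \<Phi> q))"
    by (rule locally_framed_imp_paraconformal[OF assms(1)])
qed

end
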